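(* Let $k$ be a field and let $A,B$ be $k$-algebras. There are natural equivalences $$\underline{\mathrm{Alg}}(A\triangleleft -,B)\;\cong\;\underline{\mathrm{Alg}}(A,[-,B])\;\cong\;\underline{\mathrm{Coalg}}(-,\underline{\mathrm{Alg}}(A,B)),$$ that is, isomorphisms of coalgebras $P(A\triangleleft L,B)\cong P(A,[L,B])\cong P(L,P(A,B))$, natural in the coalgebra $L$.
   Context: Everything is over a field $k$; algebras are associative unital, coalgebras coassociative counital. Sweedler notation: $\triangle h=\sum_{(h)}h_{(2)}\otimes h_{(1)}$, counit $\epsilon$. Convolution algebra: for a coalgebra $L$ and algebra $B$, $[L,B]=\mathrm{Hom}_k(L,B)$ with product $(\alpha*\beta)(h)=\sum_{(h)}\alpha(h_{(2)})\beta(h_{(1)})$. Sweedler product: for an algebra $A$ and coalgebra $L$, $A\triangleleft L=T(A\otimes L)/J$, where $T$ is the tensor algebra and $J$ is the two-sided ideal generated by the elements $aa'\otimes h-\sum_{(h)}(a\otimes h_{(2)})\cdot(a'\otimes h_{(1)})$ and $1_A\otimes h-\epsilon(h)1$ for $a,a'\in A$, $h\in L$. It is functorial in $A$ and $L$. Universal measuring coalgebra for algebras: a linear map $\rho:H\to\mathrm{Hom}_k(A,B)$ from a coalgebra $H$ measures if $\rho(h)(aa')=\sum_{(h)}\rho(h_{(2)})(a)\rho(h_{(1)})(a')$ and $\rho(h)(1_A)=\epsilon(h)1_B$. $\pi:P(A,B)\to\mathrm{Hom}_k(A,B)$ is the (existing) universal one: every measuring $\rho:H\to\mathrm{Hom}_k(A,B)$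 is $\pi$ composed with a unique coalgebra map $H\to P(A,B)$. Universal measuring coalgebra for coalgebras: a linear map $\lambda:L\to\mathrm{Hom}_k(H,K)$ ($H,K,L$ coalgebras) measures if $L\otimes H\to K$ is a coalgebra map; $P(H,K)\to\mathrm{Hom}_k(H,K)$ is the (existing) universal one: every measuring $\lambda$ factors through it by a unique coalgebra map $L\to P(H,K)$. $\underline{\mathrm{Alg}}$ is the category of algebras enriched over coalgebras with hom-objects $\underline{\mathrm{Alg}}(A,B)=P(A,B)$, and $\underline{\mathrm{Coalg}}$ the category of coalgebras enriched over coalgebras with $\underline{\mathrm{Coalg}}(H,K)=P(H,K)$. *)

theory Defs
  imports "HOL-Algebra.Module" "HOL-Algebra.QuotRing"
begin

text \<open>
  Modules, algebras and coalgebras are records over a base ring \<open>K\<close> (a field in the main statement).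
  As in \<open>HOL-Algebra.Module\<close>, the record of a module carries the fields \<open>mult\<close> and \<open>one\<close>; they are
  meaningful for algebras only and are ignored for modules and coalgebras.
\<close>

section \<open>Linear maps, quotients and free modules\<close>

definition lin_hom ::
  "('k, 'z) ring_scheme \<Rightarrow> ('k, 'v, 'm) module_scheme \<Rightarrow> ('k, 'w, 'n) module_scheme \<Rightarrow> ('v \<Rightarrow> 'w) set"
  where "lin_hom K V W = {f \<in> carrier V \<rightarrow> carrier W.
    (\<forall>x\<in>carrier V. \<forall>y\<in>carrier V. f (x \<oplus>\<^bsub>V\<^esub> y) = f x \<oplus>\<^bsub>W\<^esub> f y) \<and>
    (\<forall>c\<in>carrier K. \<forall>x\<in>carrier V. f (c \<odot>\<^bsub>V\<^esub> x) = c \<odot>\<^bsub>W\<^esub> f x)}"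

text \<open>Functions in \<open>hom_module\<close> are extensional, so that equality of elements is equality of linear
  maps.\<close>

definition hom_module ::
  "('k, 'z) ring_scheme \<Rightarrow> ('k, 'v, 'm) module_scheme \<Rightarrow> ('k, 'w, 'n) module_scheme
    \<Rightarrow> ('k, 'v \<Rightarrow> 'w) module"
  where "hom_module K V W =
    \<lparr>carrier = lin_hom K V W \<inter> extensional (carrier V),
     mult = undefined, one = undefined,
     zero = (\<lambda>x\<in>carrier V. \<zero>\<^bsub>W\<^esub>),
     add = (\<lambda>f g. \<lambda>x\<in>carrier V. f x \<oplus>\<^bsub>W\<^esub> g x),
     smult = (\<lambda>c f. \<lambda>x\<in>carrier V. c \<odot>\<^bsub>W\<^esub> f x)\<rparr>"

definition ground_module :: "('k, 'z) ring_scheme \<Rightarrow> ('k, 'k) module"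
  where "ground_module K =
    \<lparr>carrier = carrier K, mult = mult K, one = one K, zero = zero K, add = add K, smult = mult K\<rparr>"

text \<open>Used both for the quotient of a module by a submodule and for the quotient of an algebra by a
  two-sided ideal.\<close>

definition quot_module :: "('k, 'v, 'm) module_scheme \<Rightarrow> 'v set \<Rightarrow> ('k, 'v set) module"
  where "quot_module M N =
    \<lparr>carrier = carrier (M Quot N), mult = mult (M Quot N), one = one (M Quot N),
     zero = zero (M Quot N), add = add (M Quot N),
     smult = (\<lambda>c X. \<Union>x\<in>X. N +>\<^bsub>M\<^esub> (c \<odot>\<^bsub>M\<^esub> x))\<rparr>"

definition free_module :: "('k, 'z) ring_scheme \<Rightarrow> 's set \<Rightarrow> ('k, 's \<Rightarrow> 'k) module"
  where "free_module K S =
    \<lparr>carrier = {c. (\<forall>s. c s \<in> carrier K) \<and> finite {s. c s \<noteq> \<zero>\<^bsub>K\<^esub>} \<and> {s. c s \<noteq> \<zero>\<^bsub>K\<^esub>} \<subseteq> S},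
     mult = undefined, one = undefined,
     zero = (\<lambda>s. \<zero>\<^bsub>K\<^esub>),
     add = (\<lambda>c d s. c s \<oplus>\<^bsub>K\<^esub> d s),
     smult = (\<lambda>a c s. a \<otimes>\<^bsub>K\<^esub> c s)\<rparr>"

definition basis_elt :: "('k, 'z) ring_scheme \<Rightarrow> 's \<Rightarrow> ('s \<Rightarrow> 'k)"
  where "basis_elt K s = (\<lambda>t. if t = s then \<one>\<^bsub>K\<^esub> else \<zero>\<^bsub>K\<^esub>)"

definition submodule_span ::
  "('k, 'z) ring_scheme \<Rightarrow> ('k, 'v, 'm) module_scheme \<Rightarrow> 'v set \<Rightarrow> 'v set"
  where "submodule_span K M X = \<Inter>{N. submodule N K M \<and> X \<subseteq> N}"


section \<open>Tensor products\<close>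

type_synonym ('k, 'v, 'w) tensor = "('v \<times> 'w \<Rightarrow> 'k) set"

definition tensor_relations ::
  "('k, 'z) ring_scheme \<Rightarrow> ('k, 'v, 'm) module_scheme \<Rightarrow> ('k, 'w, 'n) module_scheme
    \<Rightarrow> ('v \<times> 'w \<Rightarrow> 'k) set"
  where "tensor_relations K V W =
    (let F = free_module K (carrier V \<times> carrier W); e = (\<lambda>x y. basis_elt K (x, y)) in
      {e (x \<oplus>\<^bsub>V\<^esub> x') y \<ominus>\<^bsub>F\<^esub> (e x y \<oplus>\<^bsub>F\<^esub> e x' y) | x x' y.
         x \<in> carrier V \<and> x' \<in> carrier V \<and> y \<in> carrier W} \<union>
      {e x (y \<oplus>\<^bsub>W\<^esub> y') \<ominus>\<^bsub>F\<^esub> (e x y \<oplus>\<^bsub>F\<^esub> e x y') | x y y'.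
         x \<in> carrier V \<and> y \<in> carrier W \<and> y' \<in> carrier W} \<union>
      {e (c \<odot>\<^bsub>V\<^esub> x) y \<ominus>\<^bsub>F\<^esub> (c \<odot>\<^bsub>F\<^esub> e x y) | c x y.
         c \<in> carrier K \<and> x \<in> carrier V \<and> y \<in> carrier W} \<union>
      {e x (c \<odot>\<^bsub>W\<^esub> y) \<ominus>\<^bsub>F\<^esub> (c \<odot>\<^bsub>F\<^esub> e x y) | c x y.
         c \<in> carrier K \<and> x \<in> carrier V \<and> y \<in> carrier W})"

definition tensor_null ::
  "('k, 'z) ring_scheme \<Rightarrow> ('k, 'v, 'm) module_scheme \<Rightarrow> ('k, 'w, 'n) module_scheme
    \<Rightarrow> ('v \<times> 'w \<Rightarrow> 'k) set"
  where "tensor_null K V W =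
    submodule_span K (free_module K (carrier V \<times> carrier W)) (tensor_relations K V W)"

definition tensor_module ::
  "('k, 'z) ring_scheme \<Rightarrow> ('k, 'v, 'm) module_scheme \<Rightarrow> ('k, 'w, 'n) module_scheme
    \<Rightarrow> ('k, ('k, 'v, 'w) tensor) module"
  where "tensor_module K V W =
    quot_module (free_module K (carrier V \<times> carrier W)) (tensor_null K V W)"

definition tens ::
  "('k, 'z) ring_scheme \<Rightarrow> ('k, 'v, 'm) module_scheme \<Rightarrow> ('k, 'w, 'n) module_scheme
    \<Rightarrow> 'v \<Rightarrow> 'w \<Rightarrow> ('k, 'v, 'w) tensor"
  where "tens K V W x y =
    tensor_null K V W +>\<^bsub>free_module K (carrier V \<times> carrier W)\<^esub> basis_elt K (x, y)"

text \<open>The value at a tensor \<open>X = \<Sum>\<^sub>i c\<^sub>i x\<^sub>i \<otimes> y\<^sub>i\<close> of the linear map induced by a bilinear map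
  \<open>\<beta>\<close> into \<open>U\<close>, that is \<open>\<Sum>\<^sub>i c\<^sub>i \<beta> x\<^sub>i y\<^sub>i\<close>, computed on the representatives of the coset \<open>X\<close>. Taking
  for \<open>X\<close> the comultiplication of \<open>h\<close> gives the Sweedler sum \<open>\<Sum> \<beta> h\<^sub>(\<^sub>2\<^sub>) h\<^sub>(\<^sub>1\<^sub>)\<close>, where, in the
  convention followed here, \<open>h\<^sub>(\<^sub>2\<^sub>)\<close> is the left and \<open>h\<^sub>(\<^sub>1\<^sub>)\<close> the right tensor factor.\<close>

definition tsum ::
  "('k, 'z) ring_scheme \<Rightarrow> ('k, 'u, 'm) module_scheme \<Rightarrow> ('v \<Rightarrow> 'w \<Rightarrow> 'u) \<Rightarrow> ('k, 'v, 'w) tensor \<Rightarrow> 'u"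
  where "tsum K U \<beta> X = the_elem
    ((\<lambda>c. \<Oplus>\<^bsub>U\<^esub>p\<in>{p. c p \<noteq> \<zero>\<^bsub>K\<^esub>}. c p \<odot>\<^bsub>U\<^esub> \<beta> (fst p) (snd p)) ` X)"


section \<open>Algebras\<close>

text \<open>The library locale \<^locale>\<open>algebra\<close> is restricted to commutative algebras.\<close>

locale assoc_algebra = module + ring M +
  assumes smult_mult_left:
      "\<lbrakk>a \<in> carrier R; x \<in> carrier M; y \<in> carrier M\<rbrakk> \<Longrightarrow>
        (a \<odot>\<^bsub>M\<^esub> x) \<otimes>\<^bsub>M\<^esub> y = a \<odot>\<^bsub>M\<^esub> (x \<otimes>\<^bsub>M\<^esub> y)"
    and smult_mult_right:
      "\<lbrakk>a \<in> carrier R; x \<in> carrier M; y \<in> carrier M\<rbrakk> \<Longrightarrow>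
        x \<otimes>\<^bsub>M\<^esub> (a \<odot>\<^bsub>M\<^esub> y) = a \<odot>\<^bsub>M\<^esub> (x \<otimes>\<^bsub>M\<^esub> y)"

definition alg_hom ::
  "('k, 'z) ring_scheme \<Rightarrow> ('k, 'a, 'm) module_scheme \<Rightarrow> ('k, 'b, 'n) module_scheme \<Rightarrow> ('a \<Rightarrow> 'b) set"
  where "alg_hom K A B = ring_hom A B \<inter> lin_hom K A B"

text \<open>The tensor algebra is presented as the free module on words over \<open>V\<close>, multiplied by
  concatenation, modulo multilinearity in the letters. The relations are homogeneous in the word
  length, so this is the direct sum of the tensor powers of \<open>V\<close>.\<close>

definition word_algebra :: "('k, 'z) ring_scheme \<Rightarrow> 's set \<Rightarrow> ('k, 's list \<Rightarrow> 'k) module"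
  where "word_algebra K S = (free_module K (lists S))
    \<lparr>mult := (\<lambda>c d w. \<Oplus>\<^bsub>K\<^esub>i\<in>{..length w}. c (take i w) \<otimes>\<^bsub>K\<^esub> d (drop i w)),
     one := basis_elt K []\<rparr>"

definition multilinear_relations ::
  "('k, 'z) ring_scheme \<Rightarrow> ('k, 'v, 'm) module_scheme \<Rightarrow> ('v list \<Rightarrow> 'k) set"
  where "multilinear_relations K V =
    (let F = word_algebra K (carrier V); e = basis_elt K in
      {e (u @ [x \<oplus>\<^bsub>V\<^esub> y] @ v) \<ominus>\<^bsub>F\<^esub> (e (u @ [x] @ v) \<oplus>\<^bsub>F\<^esub> e (u @ [y] @ v)) | u v x y.
         u \<in> lists (carrier V) \<and> v \<in> lists (carrier V) \<and> x \<in> carrier V \<and> y \<in> carrier V} \<union>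
      {e (u @ [c \<odot>\<^bsub>V\<^esub> x] @ v) \<ominus>\<^bsub>F\<^esub> (c \<odot>\<^bsub>F\<^esub> e (u @ [x] @ v)) | u v c x.
         u \<in> lists (carrier V) \<and> v \<in> lists (carrier V) \<and> c \<in> carrier K \<and> x \<in> carrier V})"

definition tensor_algebra_null ::
  "('k, 'z) ring_scheme \<Rightarrow> ('k, 'v, 'm) module_scheme \<Rightarrow> ('v list \<Rightarrow> 'k) set"
  where "tensor_algebra_null K V =
    submodule_span K (word_algebra K (carrier V)) (multilinear_relations K V)"

definition tensor_algebra ::
  "('k, 'z) ring_scheme \<Rightarrow> ('k, 'v, 'm) module_scheme \<Rightarrow> ('k, ('v list \<Rightarrow> 'k) set) module"
  where "tensor_algebra K V = quot_module (word_algebra K (carrier V)) (tensor_algebra_null K V)"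

definition tensor_algebra_incl ::
  "('k, 'z) ring_scheme \<Rightarrow> ('k, 'v, 'm) module_scheme \<Rightarrow> 'v \<Rightarrow> ('v list \<Rightarrow> 'k) set"
  where "tensor_algebra_incl K V x =
    tensor_algebra_null K V +>\<^bsub>word_algebra K (carrier V)\<^esub> basis_elt K [x]"


section \<open>Coalgebras\<close>

record ('k, 'h) coalg = "('k, 'h) module" +
  comult :: "'h \<Rightarrow> ('k, 'h, 'h) tensor"
  counit :: "'h \<Rightarrow> 'k"

locale coalgebra = module R C for R (structure) and C (structure) +
  assumes comult_linear: "comult C \<in> lin_hom R C (tensor_module R C C)"
    and counit_linear: "counit C \<in> lin_hom R C (ground_module R)"
    and coassoc: "h \<in> carrier C \<Longrightarrow>
      tsum R (tensor_module R C (tensor_module R C C))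
        (\<lambda>x y. tens R C (tensor_module R C C) x (comult C y)) (comult C h) =
      tsum R (tensor_module R C (tensor_module R C C))
        (\<lambda>x y. tsum R (tensor_module R C (tensor_module R C C))
          (\<lambda>u v. tens R C (tensor_module R C C) u (tens R C C v y)) (comult C x)) (comult C h)"
    and counit_left: "h \<in> carrier C \<Longrightarrow>
      tsum R C (\<lambda>x y. counit C x \<odot>\<^bsub>C\<^esub> y) (comult C h) = h"
    and counit_right: "h \<in> carrier C \<Longrightarrow>
      tsum R C (\<lambda>x y. counit C y \<odot>\<^bsub>C\<^esub> x) (comult C h) = h"

definition coalg_hom ::
  "('k, 'z) ring_scheme \<Rightarrow> ('k, 'h, 'm) coalg_scheme \<Rightarrow> ('k, 'd, 'n) coalg_scheme \<Rightarrow> ('h \<Rightarrow> 'd) set"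
  where "coalg_hom K H D = {f \<in> lin_hom K H D. \<forall>h\<in>carrier H.
    comult D (f h) = tsum K (tensor_module K D D) (\<lambda>x y. tens K D D (f x) (f y)) (comult H h) \<and>
    counit D (f h) = counit H h}"

definition coalg_iso ::
  "('k, 'z) ring_scheme \<Rightarrow> ('k, 'h, 'm) coalg_scheme \<Rightarrow> ('k, 'd, 'n) coalg_scheme \<Rightarrow> ('h \<Rightarrow> 'd) set"
  where "coalg_iso K H D = {f \<in> coalg_hom K H D. bij_betw f (carrier H) (carrier D)}"

definition tensor_coalg ::
  "('k, 'z) ring_scheme \<Rightarrow> ('k, 'l, 'm) coalg_scheme \<Rightarrow> ('k, 'h, 'n) coalg_scheme
    \<Rightarrow> ('k, ('k, 'l, 'h) tensor) coalg"
  where "tensor_coalg K L H =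
    (let T = tensor_module K L H; TT = tensor_module K T T in
      module.extend T (coalg.fields
        (tsum K TT (\<lambda>l h. tsum K TT (\<lambda>l' l''. tsum K TT (\<lambda>h' h''.
           tens K T T (tens K L H l' h') (tens K L H l'' h'')) (comult H h)) (comult L l)))
        (tsum K (ground_module K) (\<lambda>l h. counit L l \<otimes>\<^bsub>K\<^esub> counit H h))))"


section \<open>Convolution algebra and Sweedler product\<close>

definition conv_algebra ::
  "('k, 'z) ring_scheme \<Rightarrow> ('k, 'l, 'm) coalg_scheme \<Rightarrow> ('k, 'b, 'n) module_scheme
    \<Rightarrow> ('k, 'l \<Rightarrow> 'b) module"
  where "conv_algebra K L B = (hom_module K L B)
    \<lparr>mult := (\<lambda>\<alpha> \<beta>. \<lambda>h\<in>carrier L. tsum K B (\<lambda>x y. \<alpha> x \<otimes>\<^bsub>B\<^esub> \<beta> y) (comult L h)),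
     one := (\<lambda>h\<in>carrier L. counit L h \<odot>\<^bsub>B\<^esub> \<one>\<^bsub>B\<^esub>)\<rparr>"

text \<open>\<open>[f, B] : [L', B] \<rightarrow> [L, B]\<close> for \<open>f : L \<rightarrow> L'\<close>.\<close>

definition conv_map :: "('k, 'l, 'm) coalg_scheme \<Rightarrow> ('l \<Rightarrow> 'l') \<Rightarrow> ('l' \<Rightarrow> 'b) \<Rightarrow> ('l \<Rightarrow> 'b)"
  where "conv_map L f \<alpha> = compose (carrier L) \<alpha> f"

type_synonym ('k, 'a, 'l) sweedler = "(('k, 'a, 'l) tensor list \<Rightarrow> 'k) set set"

definition sweedler_relations ::
  "('k, 'z) ring_scheme \<Rightarrow> ('k, 'a, 'm) module_scheme \<Rightarrow> ('k, 'l, 'n) coalg_scheme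
    \<Rightarrow> (('k, 'a, 'l) tensor list \<Rightarrow> 'k) set set"
  where "sweedler_relations K A L =
    (let T = tensor_algebra K (tensor_module K A L);
         \<iota> = (\<lambda>a h. tensor_algebra_incl K (tensor_module K A L) (tens K A L a h)) in
      {\<iota> (a \<otimes>\<^bsub>A\<^esub> a') h \<ominus>\<^bsub>T\<^esub> tsum K T (\<lambda>x y. \<iota> a x \<otimes>\<^bsub>T\<^esub> \<iota> a' y) (comult L h) | a a' h.
         a \<in> carrier A \<and> a' \<in> carrier A \<and> h \<in> carrier L} \<union>
      {\<iota> \<one>\<^bsub>A\<^esub> h \<ominus>\<^bsub>T\<^esub> (counit L h \<odot>\<^bsub>T\<^esub> \<one>\<^bsub>T\<^esub>) | h. h \<in> carrier L})"

definition sweedler_ideal ::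
  "('k, 'z) ring_scheme \<Rightarrow> ('k, 'a, 'm) module_scheme \<Rightarrow> ('k, 'l, 'n) coalg_scheme
    \<Rightarrow> (('k, 'a, 'l) tensor list \<Rightarrow> 'k) set set"
  where "sweedler_ideal K A L =
    genideal (tensor_algebra K (tensor_module K A L)) (sweedler_relations K A L)"

definition sweedler_product ::
  "('k, 'z) ring_scheme \<Rightarrow> ('k, 'a, 'm) module_scheme \<Rightarrow> ('k, 'l, 'n) coalg_scheme
    \<Rightarrow> ('k, ('k, 'a, 'l) sweedler) module"
  where "sweedler_product K A L =
    quot_module (tensor_algebra K (tensor_module K A L)) (sweedler_ideal K A L)"

definition sweedler_gen ::
  "('k, 'z) ring_scheme \<Rightarrow> ('k, 'a, 'm) module_scheme \<Rightarrow> ('k, 'l, 'n) coalg_scheme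
    \<Rightarrow> 'a \<Rightarrow> 'l \<Rightarrow> ('k, 'a, 'l) sweedler"
  where "sweedler_gen K A L a h =
    sweedler_ideal K A L +>\<^bsub>tensor_algebra K (tensor_module K A L)\<^esub>
      tensor_algebra_incl K (tensor_module K A L) (tens K A L a h)"

text \<open>The functorial action on a coalgebra map \<open>f : L \<rightarrow> L'\<close>: the algebra map
  \<open>A \<triangleleft> L \<rightarrow> A \<triangleleft> L'\<close> induced by \<open>a \<otimes> h \<mapsto> a \<otimes> f h\<close>.\<close>

definition sweedler_map ::
  "('k, 'z) ring_scheme \<Rightarrow> ('k, 'a, 'm) module_scheme \<Rightarrow> ('k, 'l, 'n) coalg_scheme
    \<Rightarrow> ('k, 'l', 'n') coalg_scheme \<Rightarrow> ('l \<Rightarrow> 'l') \<Rightarrow> ('k, 'a, 'l) sweedler \<Rightarrow> ('k, 'a, 'l') sweedler"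
  where "sweedler_map K A L L' f = (THE g.
    g \<in> alg_hom K (sweedler_product K A L) (sweedler_product K A L')
      \<inter> extensional (carrier (sweedler_product K A L)) \<and>
    (\<forall>a\<in>carrier A. \<forall>h\<in>carrier L. g (sweedler_gen K A L a h) = sweedler_gen K A L' a (f h)))"


section \<open>Universal measuring coalgebras\<close>

definition alg_measuring ::
  "('k, 'z) ring_scheme \<Rightarrow> ('k, 'h, 'l) coalg_scheme \<Rightarrow> ('k, 'a, 'm) module_scheme
    \<Rightarrow> ('k, 'b, 'n) module_scheme \<Rightarrow> ('h \<Rightarrow> 'a \<Rightarrow> 'b) \<Rightarrow> bool"
  where "alg_measuring K H A B \<rho> \<longleftrightarrow>
    \<rho> \<in> lin_hom K H (hom_module K A B) \<and>
    (\<forall>h\<in>carrier H. \<forall>a\<in>carrier A. \<forall>a'\<in>carrier A.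
      \<rho> h (a \<otimes>\<^bsub>A\<^esub> a') = tsum K B (\<lambda>x y. \<rho> x a \<otimes>\<^bsub>B\<^esub> \<rho> y a') (comult H h)) \<and>
    (\<forall>h\<in>carrier H. \<rho> h \<one>\<^bsub>A\<^esub> = counit H h \<odot>\<^bsub>B\<^esub> \<one>\<^bsub>B\<^esub>)"

definition coalg_measuring ::
  "('k, 'z) ring_scheme \<Rightarrow> ('k, 'l, 'y) coalg_scheme \<Rightarrow> ('k, 'h, 'm) coalg_scheme
    \<Rightarrow> ('k, 'd, 'n) coalg_scheme \<Rightarrow> ('l \<Rightarrow> 'h \<Rightarrow> 'd) \<Rightarrow> bool"
  where "coalg_measuring K L H D lam \<longleftrightarrow>
    lam \<in> lin_hom K L (hom_module K H D) \<and>
    tsum K D lam \<in> coalg_hom K (tensor_coalg K L H) D"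

text \<open>\<open>factors_via K H \<rho> P \<pi> u\<close>: \<open>u\<close> is a coalgebra map \<open>H \<rightarrow> P\<close> with \<open>\<pi> \<circ> u = \<rho>\<close>, normalised to
  \<open>undefined\<close> off the carrier so that uniqueness is uniqueness as a map on \<open>carrier H\<close>.\<close>

definition factors_via ::
  "('k, 'z) ring_scheme \<Rightarrow> ('k, 'h, 'm) coalg_scheme \<Rightarrow> ('h \<Rightarrow> 'x)
    \<Rightarrow> ('k, 'p, 'n) coalg_scheme \<Rightarrow> ('p \<Rightarrow> 'x) \<Rightarrow> ('h \<Rightarrow> 'p) \<Rightarrow> bool"
  where "factors_via K H \<rho> P \<pi> u \<longleftrightarrow>
    u \<in> coalg_hom K H P \<inter> extensional (carrier H) \<and> (\<forall>h\<in>carrier H. \<pi> (u h) = \<rho> h)"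

text \<open>A formula of HOL cannot quantify over types, so the type \<open>'h\<close> from which the test coalgebras
  take their elements is a parameter. Universality among all coalgebras entails each instance; thus
  a theorem assuming only some instances applies to the genuine universal measuring coalgebra.\<close>

definition universal_alg_measuring ::
  "'h itself \<Rightarrow> ('k, 'z) ring_scheme \<Rightarrow> ('k, 'a, 'm) module_scheme \<Rightarrow> ('k, 'b, 'n) module_scheme
    \<Rightarrow> ('k, 'p, 'y) coalg_scheme \<Rightarrow> ('p \<Rightarrow> 'a \<Rightarrow> 'b) \<Rightarrow> bool"
  where "universal_alg_measuring (_ :: 'h itself) K A B P \<pi> \<longleftrightarrow>
    coalgebra K P \<and> alg_measuring K P A B \<pi> \<and>
    (\<forall>(H :: ('k, 'h) coalg) \<rho>. coalgebra K H \<and> alg_measuring K H A B \<rho> \<longrightarrow>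
      (\<exists>!u. factors_via K H \<rho> P \<pi> u))"

definition universal_coalg_measuring ::
  "'l itself \<Rightarrow> ('k, 'z) ring_scheme \<Rightarrow> ('k, 'h, 'm) coalg_scheme \<Rightarrow> ('k, 'd, 'n) coalg_scheme
    \<Rightarrow> ('k, 'p, 'y) coalg_scheme \<Rightarrow> ('p \<Rightarrow> 'h \<Rightarrow> 'd) \<Rightarrow> bool"
  where "universal_coalg_measuring (_ :: 'l itself) K H D P \<pi> \<longleftrightarrow>
    coalgebra K P \<and> coalg_measuring K P H D \<pi> \<and>
    (\<forall>(L :: ('k, 'l) coalg) lam. coalgebra K L \<and> coalg_measuring K L H D lam \<longrightarrow>
      (\<exists>!u. factors_via K L lam P \<pi> u))"

text \<open>The functorial actions \<open>P(f, Y) : P(X', Y) \<rightarrow> P(X, Y)\<close> for \<open>f : X \<rightarrow> X'\<close> and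
  \<open>P(X, g) : P(X, Y) \<rightarrow> P(X, Y')\<close> for \<open>g : Y \<rightarrow> Y'\<close> obtained from the universal property, both for
  algebras and for coalgebras. In each case \<open>P\<close> is the domain and \<open>P'\<close> the codomain.\<close>

definition precomp_map ::
  "('k, 'z) ring_scheme \<Rightarrow> ('k, 'x, 'm) module_scheme \<Rightarrow> ('x \<Rightarrow> 'x')
    \<Rightarrow> ('k, 'p, 'n) coalg_scheme \<Rightarrow> ('p \<Rightarrow> 'x' \<Rightarrow> 'y)
    \<Rightarrow> ('k, 'p', 'n') coalg_scheme \<Rightarrow> ('p' \<Rightarrow> 'x \<Rightarrow> 'y) \<Rightarrow> 'p \<Rightarrow> 'p'"
  where "precomp_map K X f P \<pi> P' \<pi>' =
    (THE u. factors_via K P (\<lambda>p. compose (carrier X) (\<pi> p) f) P' \<pi>' u)"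

definition postcomp_map ::
  "('k, 'z) ring_scheme \<Rightarrow> ('k, 'x, 'm) module_scheme \<Rightarrow> ('y \<Rightarrow> 'y')
    \<Rightarrow> ('k, 'p, 'n) coalg_scheme \<Rightarrow> ('p \<Rightarrow> 'x \<Rightarrow> 'y)
    \<Rightarrow> ('k, 'p', 'n') coalg_scheme \<Rightarrow> ('p' \<Rightarrow> 'x \<Rightarrow> 'y') \<Rightarrow> 'p \<Rightarrow> 'p'"
  where "postcomp_map K X g P \<pi> P' \<pi>' =
    (THE u. factors_via K P (\<lambda>p. compose (carrier X) g (\<pi> p)) P' \<pi>' u)"

end

(*
  A measuring H -> Hom(A, B) is the same thing as an algebra map A -> [H, B], and algebra maps
  A <| L -> D are the same thing as measurings L -> Hom(A, D). Hence a measuring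
  H -> Hom(A <| L, B), a measuring H -> Hom(A, [L, B]), a measuring H (x) L -> Hom(A, B) and, through
  the universal property of P(A, B), a measuring H -> Hom(L, P(A, B)) of coalgebras are the same
  trilinear datum (h, a, l) |-> b. So the three coalgebras represent the same functor of H: the
  universal property yields maps between them, and since coalgebra maps into any of them are
  determined by the trilinear datum, invertibility and naturality are checked on that datum.
*)

theory Submission
  imports Defs
begin

section \<open>Linear maps\<close>

text \<open>Universality cannot quantify over carrier types, so no Yoneda argument over all
  coalgebras is available: each universal object is tested only on the concrete coalgebras that
  occur. These are the candidates \<open>P1 L\<close>, \<open>P2 L\<close>, \<open>P3 L\<close>
  themselves, all on one type, and, for \<open>P(A, B)\<close>, the tensor coalgebra of such a
  candidate with \<open>L\<close>. Hence the tensor product must be proved to be a coalgebra. The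
  universal property of \<open>A <| L\<close> speaks of algebra maps, not of measurings, so a
  measuring of \<open>A <| L\<close> by \<open>H\<close> is first read as an algebra map into
  \<open>[H, B]\<close>. On generators this is a measuring by \<open>L\<close>, and passing to one
  by \<open>H\<close> requires exchanging two coalgebras, which is a Fubini rule for Sweedler sums.
  Tensors are cosets, and a Sweedler sum is evaluated on representatives. A comultiplication is
  therefore never expanded into terms: identities are equalities of linear maps, compared on pure
  tensors, and each step carries the bilinearity of the expression under the sum.\<close>

lemma lin_homI:
  assumes "\<And>x. x \<in> carrier V \<Longrightarrow> f x \<in> carrier W"
    and "\<And>x y. x \<in> carrier V \<Longrightarrow> y \<in> carrier V \<Longrightarrow> f (x \<oplus>\<^bsub>V\<^esub> y) = f x \<oplus>\<^bsub>W\<^esub> f y"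
    and "\<And>c x. c \<in> carrier K \<Longrightarrow> x \<in> carrier V \<Longrightarrow> f (c \<odot>\<^bsub>V\<^esub> x) = c \<odot>\<^bsub>W\<^esub> f x"
  shows "f \<in> lin_hom K V W"
  using assms by (auto simp: lin_hom_def)

lemma lin_hom_closed: "f \<in> lin_hom K V W \<Longrightarrow> x \<in> carrier V \<Longrightarrow> f x \<in> carrier W"
  and lin_hom_add: "f \<in> lin_hom K V W \<Longrightarrow> x \<in> carrier V \<Longrightarrow> y \<in> carrier V \<Longrightarrow>
    f (x \<oplus>\<^bsub>V\<^esub> y) = f x \<oplus>\<^bsub>W\<^esub> f y"
  and lin_hom_smult: "f \<in> lin_hom K V W \<Longrightarrow> c \<in> carrier K \<Longrightarrow> x \<in> carrier V \<Longrightarrow>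
    f (c \<odot>\<^bsub>V\<^esub> x) = c \<odot>\<^bsub>W\<^esub> f x"
  by (auto simp: lin_hom_def)

lemma lin_hom_zero:
  assumes "module K V" "module K W" "f \<in> lin_hom K V W"
  shows "f \<zero>\<^bsub>V\<^esub> = \<zero>\<^bsub>W\<^esub>"
proof -
  interpret V: module K V by fact
  interpret W: module K W by fact
  have "f (\<zero>\<^bsub>K\<^esub> \<odot>\<^bsub>V\<^esub> \<zero>\<^bsub>V\<^esub>) = \<zero>\<^bsub>K\<^esub> \<odot>\<^bsub>W\<^esub> f \<zero>\<^bsub>V\<^esub>"
    by (rule lin_hom_smult[OF assms(3)]) auto
  then show ?thesis using lin_hom_closed[OF assms(3)] by simp
qed

lemma lin_hom_neg:
  assumes "module K V" "module K W" "f \<in> lin_hom K V W" "x \<in> carrier V"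
  shows "f (\<ominus>\<^bsub>V\<^esub> x) = \<ominus>\<^bsub>W\<^esub> f x"
proof -
  interpret V: module K V by fact
  interpret W: module K W by fact
  have fx: "f x \<in> carrier W" "f (\<ominus>\<^bsub>V\<^esub> x) \<in> carrier W"
    using lin_hom_closed[OF assms(3)] assms(4) by auto
  have "f (\<ominus>\<^bsub>V\<^esub> x) \<oplus>\<^bsub>W\<^esub> f x = \<zero>\<^bsub>W\<^esub>"
    using lin_hom_add[OF assms(3), of "\<ominus>\<^bsub>V\<^esub> x" x] assms(4) lin_hom_zero[OF assms(1-3)]
    by (simp add: V.M.l_neg)
  then show ?thesis using fx by (simp add: W.M.minus_equality)
qed

lemma lin_hom_diff:
  assumes "module K V" "module K W" "f \<in> lin_hom K V W" "x \<in> carrier V" "y \<in> carrier V"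
  shows "f (x \<ominus>\<^bsub>V\<^esub> y) = f x \<ominus>\<^bsub>W\<^esub> f y"
proof -
  interpret V: module K V by fact
  show ?thesis
    using assms lin_hom_neg[OF assms(1-3,5)] lin_hom_add[OF assms(3)]
    by (simp add: a_minus_def)
qed

lemma module_diff_eq_zero_iff:
  assumes "module K V" "x \<in> carrier V" "y \<in> carrier V"
  shows "x \<ominus>\<^bsub>V\<^esub> y = \<zero>\<^bsub>V\<^esub> \<longleftrightarrow> x = y"
proof -
  interpret V: module K V by fact
  show ?thesis using assms by (metis V.M.minus_closed V.M.minus_eq V.M.r_neg V.M.minus_equality V.M.add.inv_closed V.M.add.m_comm V.M.minus_minus)
qed

lemma lin_hom_ident: "(\<lambda>x. x) \<in> lin_hom K V V"
  by (auto simp: lin_hom_def)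

lemma lin_hom_comp:
  "f \<in> lin_hom K V W \<Longrightarrow> g \<in> lin_hom K Z V \<Longrightarrow> (\<lambda>z. f (g z)) \<in> lin_hom K Z W"
  by (auto simp: lin_hom_def Pi_def)

text \<open>Membership in \<open>lin_hom\<close> looks only at arguments in the carrier. This allows
  passing between a plain function and its \<open>restrict\<close> or \<open>compose\<close> form,
  which extensionality forces throughout.\<close>

lemma lin_hom_cong:
  assumes "module K V" "f \<in> lin_hom K V W" "\<And>x. x \<in> carrier V \<Longrightarrow> g x = f x"
  shows "g \<in> lin_hom K V W"
proof -
  interpret V: module K V by fact
  show ?thesis using assms by (auto simp: lin_hom_def Pi_def)
qed

lemma lin_hom_const_zero: "module K W \<Longrightarrow> (\<lambda>x. \<zero>\<^bsub>W\<^esub>) \<in> lin_hom K V W"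
proof -
  assume "module K W"
  then interpret W: module K W .
  show ?thesis by (auto simp: lin_hom_def)
qed

lemma lin_hom_plus:
  assumes "module K W" "f \<in> lin_hom K V W" "g \<in> lin_hom K V W"
  shows "(\<lambda>x. f x \<oplus>\<^bsub>W\<^esub> g x) \<in> lin_hom K V W"
proof -
  interpret W: module K W by fact
  show ?thesis
    by (rule lin_homI)
      (use assms(2,3) in \<open>auto simp: lin_hom_closed lin_hom_add lin_hom_smult W.smult_r_distr
         W.M.a_ac\<close>)
qed

lemma lin_hom_scale:
  assumes "module K W" "c \<in> carrier K" "f \<in> lin_hom K V W"
  shows "(\<lambda>x. c \<odot>\<^bsub>W\<^esub> f x) \<in> lin_hom K V W"
proof -
  interpret W: module K W by fact
  show ?thesis
    by (rule lin_homI)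
      (use assms(2,3) in \<open>auto simp: lin_hom_closed lin_hom_add lin_hom_smult W.smult_r_distr
         W.smult_assoc1[symmetric] W.R.m_comm\<close>)
qed

lemma lin_hom_scalar:
  assumes "module K W" "y \<in> carrier W" "f \<in> lin_hom K V (ground_module K)"
  shows "(\<lambda>x. f x \<odot>\<^bsub>W\<^esub> y) \<in> lin_hom K V W"
proof -
  interpret W: module K W by fact
  show ?thesis
    using assms(2,3) by (auto simp: lin_hom_def ground_module_def Pi_def W.smult_l_distr
        W.smult_assoc1)
qed

lemma ground_module_simps:
  "carrier (ground_module K) = carrier K" "add (ground_module K) = add K"
  "zero (ground_module K) = zero K" "mult (ground_module K) = mult K"
  "one (ground_module K) = one K" "smult (ground_module K) = mult K"
  by (simp_all add: ground_module_def)

lemma module_ground_module: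
  assumes "cring K"
  shows "module K (ground_module K)"
proof -
  interpret cring K by fact
  have "\<exists>y\<in>carrier K. y \<oplus>\<^bsub>K\<^esub> x = \<zero>\<^bsub>K\<^esub>" if "x \<in> carrier K" for x
    using that l_neg[OF that] by blast
  then show ?thesis
    by (intro moduleI abelian_groupI)
      (auto simp: ground_module_simps a_ac m_ac l_distr r_distr is_cring)
qed

lemma module_hom_module:
  assumes "module K V" "module K W"
  shows "module K (hom_module K V W)"
proof -
  interpret V: module K V by fact
  interpret W: module K W by fact
  have res: "restrict f (carrier V) \<in> lin_hom K V W \<inter> extensional (carrier V)"
    if "f \<in> lin_hom K V W" for f
    using lin_hom_cong[OF assms(1) that] by auto
  have ext: "f = g" if "f \<in> extensional (carrier V)" "g \<in> extensional (carrier V)"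
    "\<And>x. x \<in> carrier V \<Longrightarrow> f x = g x" for f g :: "'c \<Rightarrow> 'e"
    using that by (auto intro: extensionalityI)
  note cl = lin_hom_closed[of _ K V W]
  show ?thesis
  proof (intro moduleI abelian_groupI)
    fix f assume f: "f \<in> carrier (hom_module K V W)"
    \<comment> \<open>The additive inverse of \<open>f\<close> is \<open>f\<close> scaled by minus
      one, so its linearity is a case of \<open>lin_hom_scale\<close>; restriction then makes it
      extensional.\<close>
    have n: "(\<lambda>x. (\<ominus>\<^bsub>K\<^esub> \<one>\<^bsub>K\<^esub>) \<odot>\<^bsub>W\<^esub> f x) \<in> lin_hom K V W"
      using f by (intro lin_hom_scale assms) (auto simp: hom_module_def)
    define g where "g = restrict (\<lambda>x. (\<ominus>\<^bsub>K\<^esub> \<one>\<^bsub>K\<^esub>) \<odot>\<^bsub>W\<^esub> f x) (carrier V)"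
    have "g \<oplus>\<^bsub>hom_module K V W\<^esub> f = \<zero>\<^bsub>hom_module K V W\<^esub>"
      using f by (auto simp: g_def hom_module_def cl W.smult_l_minus W.M.l_neg intro!: restrict_ext)
    moreover have "g \<in> carrier (hom_module K V W)"
      using res[OF n] by (simp add: g_def hom_module_def)
    ultimately show "\<exists>g\<in>carrier (hom_module K V W). g \<oplus>\<^bsub>hom_module K V W\<^esub> f = \<zero>\<^bsub>hom_module K V W\<^esub>"
      by blast
  next
    show "\<zero>\<^bsub>hom_module K V W\<^esub> \<in> carrier (hom_module K V W)"
      using res[OF lin_hom_const_zero[OF assms(2)]] by (auto simp: hom_module_def)
  next
    fix f g assume "f \<in> carrier (hom_module K V W)" "g \<in> carrier (hom_module K V W)"
    then show "f \<oplus>\<^bsub>hom_module K V W\<^esub> g \<in> carrier (hom_module K V W)"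
      using res[OF lin_hom_plus[OF assms(2)]] by (auto simp: hom_module_def)
  next
    fix c f assume "c \<in> carrier K" "f \<in> carrier (hom_module K V W)"
    then show "c \<odot>\<^bsub>hom_module K V W\<^esub> f \<in> carrier (hom_module K V W)"
      using res[OF lin_hom_scale[OF assms(2)]] by (auto simp: hom_module_def)
  qed (auto simp: hom_module_def cl W.M.a_ac W.smult_l_distr W.smult_r_distr W.smult_assoc1
      V.R.is_cring intro!: restrict_ext intro: ext)
qed

lemma hom_module_simps:
  "f \<in> carrier (hom_module K V W) \<longleftrightarrow> f \<in> lin_hom K V W \<and> f \<in> extensional (carrier V)"
  "\<zero>\<^bsub>hom_module K V W\<^esub> = (\<lambda>x\<in>carrier V. \<zero>\<^bsub>W\<^esub>)"
  "f \<oplus>\<^bsub>hom_module K V W\<^esub> g = (\<lambda>x\<in>carrier V. f x \<oplus>\<^bsub>W\<^esub> g x)"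
  "c \<odot>\<^bsub>hom_module K V W\<^esub> f = (\<lambda>x\<in>carrier V. c \<odot>\<^bsub>W\<^esub> f x)"
  by (simp_all add: hom_module_def)

lemma hom_module_eqI:
  assumes "f \<in> carrier (hom_module K V W)" "g \<in> carrier (hom_module K V W)"
    and "\<And>x. x \<in> carrier V \<Longrightarrow> f x = g x"
  shows "f = g"
  using assms by (auto simp: hom_module_simps intro: extensionalityI)

lemma lin_hom_hom_moduleD:
  "\<phi> \<in> lin_hom K Z (hom_module K V W) \<Longrightarrow> z \<in> carrier Z \<Longrightarrow> \<phi> z \<in> lin_hom K V W"
  by (auto dest!: lin_hom_closed simp: hom_module_simps)

text \<open>With the identity of \<open>hom_module K V W\<close> for \<phi>, this is linearity of
  evaluation at a point, the form needed for convolution algebras.\<close>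

lemma lin_hom_eval:
  assumes "\<phi> \<in> lin_hom K Z (hom_module K V W)" "x \<in> carrier V"
  shows "(\<lambda>z. \<phi> z x) \<in> lin_hom K Z W"
  using assms
  by (intro lin_homI)
    (auto simp: lin_hom_add lin_hom_smult hom_module_simps
      intro: lin_hom_closed lin_hom_hom_moduleD)

section \<open>Free modules, spans and quotients\<close>

lemma module_free_module:
  assumes "cring K"
  shows "module K (free_module K S)"
proof -
  interpret cring K by fact
  have fin: "finite {s. c s \<oplus>\<^bsub>K\<^esub> d s \<noteq> \<zero>\<^bsub>K\<^esub>}"
    if "finite {s. c s \<noteq> \<zero>\<^bsub>K\<^esub>}" "finite {s. d s \<noteq> \<zero>\<^bsub>K\<^esub>}" for c d :: "'c \<Rightarrow> 'a"
    using that by (intro finite_subset[OF _ finite_UnI[OF that]]) auto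
  have fin2: "finite {s. a \<otimes>\<^bsub>K\<^esub> c s \<noteq> \<zero>\<^bsub>K\<^esub>}"
    if "finite {s. c s \<noteq> \<zero>\<^bsub>K\<^esub>}" "a \<in> carrier K" for a and c :: "'c \<Rightarrow> 'a"
    using that by (intro finite_subset[OF _ that(1)]) auto
  show ?thesis
  proof (intro moduleI abelian_groupI)
    fix c assume c: "c \<in> carrier (free_module K S)"
    have "(\<lambda>s. \<ominus>\<^bsub>K\<^esub> c s) \<in> carrier (free_module K S)"
      using c by (auto simp: free_module_def elim!: finite_subset[rotated])
    moreover have "(\<lambda>s. \<ominus>\<^bsub>K\<^esub> c s) \<oplus>\<^bsub>free_module K S\<^esub> c = \<zero>\<^bsub>free_module K S\<^esub>"
      using c by (auto simp: free_module_def l_neg)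
    ultimately show "\<exists>d\<in>carrier (free_module K S). d \<oplus>\<^bsub>free_module K S\<^esub> c = \<zero>\<^bsub>free_module K S\<^esub>"
      by blast
  qed (auto simp: free_module_def a_ac m_ac l_distr r_distr is_cring subset_iff intro!: fin fin2,
      metis l_zero zero_closed, metis r_null)
qed

lemma basis_elt_in_free_module:
  assumes "cring K" "s \<in> S"
  shows "basis_elt K s \<in> carrier (free_module K S)"
proof -
  interpret cring K by fact
  have "{t. basis_elt K s t \<noteq> \<zero>\<^bsub>K\<^esub>} \<subseteq> {s}" by (auto simp: basis_elt_def)
  then show ?thesis using assms(2) finite_subset
    by (fastforce simp: free_module_def basis_elt_def)
qed

text \<open>The induction runs over a finite set containing the support rather than over the support
  itself, so that a coordinate may be cleared without knowing whether it was zero.\<close>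

lemma free_module_induct [consumes 2, case_names zero basis add smult]:
  assumes "cring K" "c \<in> carrier (free_module K S)"
    and "P \<zero>\<^bsub>free_module K S\<^esub>"
    and "\<And>s. s \<in> S \<Longrightarrow> P (basis_elt K s)"
    and add: "\<And>c d. c \<in> carrier (free_module K S) \<Longrightarrow> d \<in> carrier (free_module K S) \<Longrightarrow>
      P c \<Longrightarrow> P d \<Longrightarrow> P (c \<oplus>\<^bsub>free_module K S\<^esub> d)"
    and smult: "\<And>a c. a \<in> carrier K \<Longrightarrow> c \<in> carrier (free_module K S) \<Longrightarrow> P c \<Longrightarrow>
      P (a \<odot>\<^bsub>free_module K S\<^esub> c)"
  shows "P c"
proof -
  interpret cring K by fact
  have "P c" if "finite T" "T \<subseteq> S" "\<And>s. c s \<in> carrier K" "{s. c s \<noteq> \<zero>\<^bsub>K\<^esub>} \<subseteq> T" for T c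
    using that
  proof (induction T arbitrary: c rule: finite_induct)
    case empty
    then have "c = \<zero>\<^bsub>free_module K S\<^esub>" by (auto simp: free_module_def)
    then show ?case using assms by simp
  next
    case (insert t T)
    \<comment> \<open>Clearing the coordinate \<open>t\<close> splits \<open>c\<close> as a multiple
      of the basis element at \<open>t\<close> plus a function supported in the smaller set.\<close>
    define d where "d = c(t := \<zero>\<^bsub>K\<^esub>)"
    have dT: "{s. d s \<noteq> \<zero>\<^bsub>K\<^esub>} \<subseteq> T" using insert.prems by (auto simp: d_def)
    have d: "P d" using insert.prems dT by (intro insert.IH) (auto simp: d_def)
    have dc: "d \<in> carrier (free_module K S)"
      using insert.prems dT finite_subset[OF dT insert.hyps(1)]
      by (auto simp: free_module_def d_def)
    have b: "basis_elt K t \<in> carrier (free_module K S)"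
      using insert.prems by (intro basis_elt_in_free_module assms) auto
    have "c = c t \<odot>\<^bsub>free_module K S\<^esub> basis_elt K t \<oplus>\<^bsub>free_module K S\<^esub> d"
      using insert.prems by (auto simp: free_module_def basis_elt_def d_def)
    moreover have "P (c t \<odot>\<^bsub>free_module K S\<^esub> basis_elt K t)"
      using insert.prems b by (intro smult assms) auto
    ultimately show ?case
      using add[of "c t \<odot>\<^bsub>free_module K S\<^esub> basis_elt K t" d] d dc b insert.prems
        module.smult_closed[OF module_free_module[OF assms(1)]] by metis
  qed
  then show ?thesis using assms(2)[unfolded free_module_def] by auto
qed

lemma free_module_hom_eq:
  assumes "cring K" "module K W"
    and "f \<in> lin_hom K (free_module K S) W" "g \<in> lin_hom K (free_module K S) W"
    and "\<And>s. s \<in> S \<Longrightarrow> f (basis_elt K s) = g (basis_elt K s)"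
    and "c \<in> carrier (free_module K S)"
  shows "f c = g c"
  using assms(1,6)
proof (induction rule: free_module_induct)
  case zero
  then show ?case using lin_hom_zero[OF module_free_module] assms by metis
qed (use assms in \<open>auto simp: lin_hom_add lin_hom_smult\<close>)

text \<open>This is the sum inside \<open>tsum\<close>, for an arbitrary index set:
  \<open>tsum\<close> is the descent of \<open>free_lift\<close> to the cosets of
  \<open>tensor_null\<close>.\<close>

definition free_lift ::
  "('k, 'z) ring_scheme \<Rightarrow> ('k, 'u, 'm) module_scheme \<Rightarrow> ('s \<Rightarrow> 'u) \<Rightarrow> ('s \<Rightarrow> 'k) \<Rightarrow> 'u"
  where "free_lift K U g c = (\<Oplus>\<^bsub>U\<^esub>s\<in>{s. c s \<noteq> \<zero>\<^bsub>K\<^esub>}. c s \<odot>\<^bsub>U\<^esub> g s)"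

text \<open>The sum in \<open>free_lift\<close> runs over the support, which changes under addition
  and scaling. Sums can be combined termwise only after they are brought to a common index
  set.\<close>

lemma free_lift_superset:
  assumes "module K U" "g \<in> S \<rightarrow> carrier U" "c \<in> carrier (free_module K S)"
    and "finite T" "{s. c s \<noteq> \<zero>\<^bsub>K\<^esub>} \<subseteq> T" "T \<subseteq> S"
  shows "free_lift K U g c = (\<Oplus>\<^bsub>U\<^esub>s\<in>T. c s \<odot>\<^bsub>U\<^esub> g s)"
proof -
  interpret U: module K U by fact
  have "g s \<in> carrier U" if "s \<in> T" for s using that assms(2,6) by auto
  then show ?thesis unfolding free_lift_def
    using assms(3-)
    by (intro U.M.add.finprod_mono_neutral_cong_left) (auto simp: free_module_def)
qed

lemma free_lift_lin_hom:
  assumes "module K U" "g \<in> S \<rightarrow> carrier U"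
  shows "free_lift K U g \<in> lin_hom K (free_module K S) U"
proof -
  interpret U: module K U by fact
  interpret F: module K "free_module K S" by (rule module_free_module) (rule U.R.is_cring)
  let ?F = "free_module K S"
  have car: "c s \<in> carrier K" if "c \<in> carrier ?F" for c s
    using that by (auto simp: free_module_def)
  have sup: "finite {s. c s \<noteq> \<zero>\<^bsub>K\<^esub>}" "{s. c s \<noteq> \<zero>\<^bsub>K\<^esub>} \<subseteq> S" if "c \<in> carrier ?F" for c
    using that by (auto simp: free_module_def)
  show ?thesis
  proof (rule lin_homI)
    fix c assume "c \<in> carrier ?F"
    moreover have "c s \<odot>\<^bsub>U\<^esub> g s \<in> carrier U" if "c s \<noteq> \<zero>\<^bsub>K\<^esub>" for s
      using assms(2) car[OF \<open>c \<in> carrier ?F\<close>] sup(2)[OF \<open>c \<in> carrier ?F\<close>] that by blast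
    ultimately show "free_lift K U g c \<in> carrier U"
      unfolding free_lift_def by (intro U.M.finsum_closed) auto
  next
    fix c d assume c: "c \<in> carrier ?F" and d: "d \<in> carrier ?F"
    \<comment> \<open>The union of the two supports serves both summands and contains the support of
      the sum, which may be smaller because of cancellation.\<close>
    define T where "T = {s. c s \<noteq> \<zero>\<^bsub>K\<^esub>} \<union> {s. d s \<noteq> \<zero>\<^bsub>K\<^esub>}"
    have T: "finite T" "T \<subseteq> S" and cT: "{s. c s \<noteq> \<zero>\<^bsub>K\<^esub>} \<subseteq> T"
      and dT: "{s. d s \<noteq> \<zero>\<^bsub>K\<^esub>} \<subseteq> T" using sup c d by (auto simp: T_def)
    have gT: "g s \<in> carrier U" if "s \<in> T" for s using assms(2) T(2) that by blast
    have add_eq: "(c \<oplus>\<^bsub>?F\<^esub> d) s = c s \<oplus>\<^bsub>K\<^esub> d s" for s by (simp add: free_module_def)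
    have "{s. (c \<oplus>\<^bsub>?F\<^esub> d) s \<noteq> \<zero>\<^bsub>K\<^esub>} \<subseteq> T" by (auto simp: free_module_def T_def)
    then have "free_lift K U g (c \<oplus>\<^bsub>?F\<^esub> d) = (\<Oplus>\<^bsub>U\<^esub>s\<in>T. (c \<oplus>\<^bsub>?F\<^esub> d) s \<odot>\<^bsub>U\<^esub> g s)"
      using T c d by (intro free_lift_superset[OF assms]) auto
    also have "\<dots> = (\<Oplus>\<^bsub>U\<^esub>s\<in>T. c s \<odot>\<^bsub>U\<^esub> g s \<oplus>\<^bsub>U\<^esub> d s \<odot>\<^bsub>U\<^esub> g s)"
      using gT car[OF c] car[OF d]
      by (intro U.M.finsum_cong') (auto simp: add_eq U.smult_l_distr)
    also have "\<dots> = (\<Oplus>\<^bsub>U\<^esub>s\<in>T. c s \<odot>\<^bsub>U\<^esub> g s) \<oplus>\<^bsub>U\<^esub> (\<Oplus>\<^bsub>U\<^esub>s\<in>T. d s \<odot>\<^bsub>U\<^esub> g s)"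
      using gT car[OF c] car[OF d] by (intro U.M.finsum_addf) auto
    also have "\<dots> = free_lift K U g c \<oplus>\<^bsub>U\<^esub> free_lift K U g d"
      using free_lift_superset[OF assms c T(1) cT T(2)] free_lift_superset[OF assms d T(1) dT T(2)]
      by simp
    finally show "free_lift K U g (c \<oplus>\<^bsub>?F\<^esub> d) = free_lift K U g c \<oplus>\<^bsub>U\<^esub> free_lift K U g d" .
  next
    fix a c assume a: "a \<in> carrier K" and c: "c \<in> carrier ?F"
    define T where "T = {s. c s \<noteq> \<zero>\<^bsub>K\<^esub>}"
    have gT: "g s \<in> carrier U" if "s \<in> T" for s using assms(2) sup(2)[OF c] that by (auto simp: T_def)
    note cT = car[OF c]
    have smult_eq: "(a \<odot>\<^bsub>?F\<^esub> c) s = a \<otimes>\<^bsub>K\<^esub> c s" for s by (simp add: free_module_def)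
    have "{s. (a \<odot>\<^bsub>?F\<^esub> c) s \<noteq> \<zero>\<^bsub>K\<^esub>} \<subseteq> T" using a by (auto simp: free_module_def T_def)
    then have "free_lift K U g (a \<odot>\<^bsub>?F\<^esub> c) = (\<Oplus>\<^bsub>U\<^esub>s\<in>T. (a \<odot>\<^bsub>?F\<^esub> c) s \<odot>\<^bsub>U\<^esub> g s)"
      using sup[OF c, folded T_def] a c by (intro free_lift_superset[OF assms]) auto
    also have "\<dots> = (\<Oplus>\<^bsub>U\<^esub>s\<in>T. a \<odot>\<^bsub>U\<^esub> (c s \<odot>\<^bsub>U\<^esub> g s))"
      using a gT cT
      by (intro U.M.finsum_cong') (auto simp: smult_eq U.smult_assoc1)
    also have "\<dots> = a \<odot>\<^bsub>U\<^esub> free_lift K U g c"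
      unfolding free_lift_def T_def[symmetric] using sup(1)[OF c, folded T_def] a gT cT
      by (intro U.finsum_smult_ldistr[symmetric]) (auto)
    finally show "free_lift K U g (a \<odot>\<^bsub>?F\<^esub> c) = a \<odot>\<^bsub>U\<^esub> free_lift K U g c" .
  qed
qed

text \<open>The ambient index set is taken to be \<open>{s}\<close>, so only the value at
  \<open>s\<close> must lie in \<open>U\<close>. Summing over \<open>{s}\<close> instead of the
  support also covers a ring with one equal to zero, where the support is empty.\<close>

lemma free_lift_basis:
  assumes "module K U" "g s \<in> carrier U"
  shows "free_lift K U g (basis_elt K s) = g s"
proof -
  interpret U: module K U by fact
  have "free_lift K U g (basis_elt K s) = (\<Oplus>\<^bsub>U\<^esub>t\<in>{s}. basis_elt K s t \<odot>\<^bsub>U\<^esub> g t)"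
    using assms(2) basis_elt_in_free_module[OF U.R.is_cring, of s "{s}"]
    by (intro free_lift_superset[OF assms(1), where S = "{s}"]) (auto simp: basis_elt_def)
  also have "\<dots> = g s" using assms(2) by (simp add: basis_elt_def)
  finally show ?thesis .
qed

lemma submodule_span_superset: "X \<subseteq> submodule_span K M X"
  by (auto simp: submodule_span_def)

lemma submodule_span_subset: "submodule N K M \<Longrightarrow> X \<subseteq> N \<Longrightarrow> submodule_span K M X \<subseteq> N"
  by (auto simp: submodule_span_def)

lemma submodule_submodule_span:
  assumes "module K M" "X \<subseteq> carrier M"
  shows "submodule (submodule_span K M X) K M"
proof -
  interpret M: module K M by fact
  \<comment> \<open>The whole carrier belongs to the family being intersected, which bounds the span
    inside \<open>M\<close>.\<close>
  have c: "submodule (carrier M) K M" by (rule M.carrier_is_submodule)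
  show ?thesis
  proof (rule M.submoduleI)
    show "submodule_span K M X \<subseteq> carrier M" by (rule submodule_span_subset[OF c assms(2)])
    show "\<zero>\<^bsub>M\<^esub> \<in> submodule_span K M X"
      unfolding submodule_span_def
      using subgroup.one_closed[OF submodule.axioms(1)] by fastforce
  qed (auto simp: submodule_span_def M.submoduleE submodule.smult_closed)
qed

text \<open>The kernel of \<open>g\<close> is a submodule containing \<open>X\<close>, hence it
  contains the span.\<close>

lemma lin_hom_vanishes_span:
  assumes "module K M" "module K U" "g \<in> lin_hom K M U" "X \<subseteq> carrier M"
    and "\<And>x. x \<in> X \<Longrightarrow> g x = \<zero>\<^bsub>U\<^esub>" "x \<in> submodule_span K M X"
  shows "g x = \<zero>\<^bsub>U\<^esub>"
proof -
  interpret M: module K M by fact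
  interpret U: module K U by fact
  have "submodule {x \<in> carrier M. g x = \<zero>\<^bsub>U\<^esub>} K M"
    by (rule M.submoduleI)
      (auto simp: lin_hom_zero[OF assms(1-3)] lin_hom_add[OF assms(3)] lin_hom_smult[OF assms(3)]
        lin_hom_neg[OF assms(1-3)])
  then show ?thesis using submodule_span_subset[of _ K M X] assms(4-) by fastforce
qed

section \<open>Quotient of a module by a submodule and its universal property\<close>

locale module_quotient = module K M + submodule N K M for K M N
begin

lemma abelian_subgroup: "abelian_subgroup N M"
  by (intro abelian_subgroupI3 additive_subgroup.intro) (unfold_locales)

sublocale Q: abelian_subgroup N M by (rule abelian_subgroup)

lemma quot_carrier: "carrier (quot_module M N) = (\<lambda>x. N +>\<^bsub>M\<^esub> x) ` carrier M"
  by (auto simp: quot_module_def FactRing_simps)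

lemma quot_add: "x \<in> carrier M \<Longrightarrow> y \<in> carrier M \<Longrightarrow>
    (N +>\<^bsub>M\<^esub> x) \<oplus>\<^bsub>quot_module M N\<^esub> (N +>\<^bsub>M\<^esub> y) = N +>\<^bsub>M\<^esub> (x \<oplus>\<^bsub>M\<^esub> y)"
  by (simp add: quot_module_def FactRing_simps Q.a_rcos_sum)

lemma quot_zero: "\<zero>\<^bsub>quot_module M N\<^esub> = N +>\<^bsub>M\<^esub> \<zero>\<^bsub>M\<^esub>"
  by (simp add: quot_module_def FactRing_def Q.a_rcos_const)

lemma quot_eq_iff: "x \<in> carrier M \<Longrightarrow> y \<in> carrier M \<Longrightarrow>
    N +>\<^bsub>M\<^esub> x = N +>\<^bsub>M\<^esub> y \<longleftrightarrow> x \<ominus>\<^bsub>M\<^esub> y \<in> N"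
  using Q.a_rcos_module[of y x] Q.a_repr_independence'[of y x] Q.a_repr_independence'[of x y]
    Q.a_rcos_self[of x]
  by (auto simp: a_minus_def)

lemma quot_coset_add: "n \<in> N \<Longrightarrow> x \<in> carrier M \<Longrightarrow> N +>\<^bsub>M\<^esub> (n \<oplus>\<^bsub>M\<^esub> x) = N +>\<^bsub>M\<^esub> x"
  by (subst quot_eq_iff) (auto simp: a_minus_def M.a_assoc M.r_neg)

text \<open>The scalar action of \<open>quot_module\<close> is a union over all representatives of
  the coset; the family is constant because \<open>N\<close> is stable under scalars, so the union
  is a single coset.\<close>

lemma quot_smult:
  assumes "c \<in> carrier K" "x \<in> carrier M"
  shows "c \<odot>\<^bsub>quot_module M N\<^esub> (N +>\<^bsub>M\<^esub> x) = N +>\<^bsub>M\<^esub> (c \<odot>\<^bsub>M\<^esub> x)"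
proof -
  have "N +>\<^bsub>M\<^esub> (c \<odot>\<^bsub>M\<^esub> y) = N +>\<^bsub>M\<^esub> (c \<odot>\<^bsub>M\<^esub> x)" if y: "y \<in> N +>\<^bsub>M\<^esub> x" for y
  proof -
    obtain n where n: "n \<in> N" "y = n \<oplus>\<^bsub>M\<^esub> x"
      using y by (auto simp: a_r_coset_def r_coset_def)
    show ?thesis using n assms
      by (simp add: smult_r_distr quot_coset_add smult_closed)
  qed
  moreover have "N +>\<^bsub>M\<^esub> x \<noteq> {}" using Q.a_rcos_self[of x] assms by auto
  ultimately have "(\<Union>y\<in>N +>\<^bsub>M\<^esub> x. N +>\<^bsub>M\<^esub> (c \<odot>\<^bsub>M\<^esub> y)) = N +>\<^bsub>M\<^esub> (c \<odot>\<^bsub>M\<^esub> x)"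
    by (rule SUP_eq_const[rotated])
  then show ?thesis by (simp add: quot_module_def)
qed

lemma module_quot_module: "module K (quot_module M N)"
proof (rule moduleI)
  have inv: "\<exists>y\<in>carrier M. N +>\<^bsub>M\<^esub> (x \<oplus>\<^bsub>M\<^esub> y) = N +>\<^bsub>M\<^esub> \<zero>\<^bsub>M\<^esub>" if "x \<in> carrier M" for x
    using that by (intro bexI[of _ "\<ominus>\<^bsub>M\<^esub> x"]) (auto simp: M.r_neg)
  show "abelian_group (quot_module M N)"
    by (rule abelian_groupI) (auto simp: quot_carrier quot_add quot_zero M.a_ac inv)
qed (auto simp: quot_carrier quot_add quot_smult smult_l_distr smult_r_distr smult_assoc1 R.is_cring)

lemma quot_proj_lin_hom: "(\<lambda>x. N +>\<^bsub>M\<^esub> x) \<in> lin_hom K M (quot_module M N)"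
  by (rule lin_homI) (auto simp: quot_carrier quot_add quot_smult)

text \<open>A linear map killing \<open>N\<close> is constant on each coset, so the image of the
  coset is a singleton and \<open>the_elem\<close> picks its value.\<close>

lemma quot_lift_coset:
  assumes "module K U" "g \<in> lin_hom K M U" "\<And>n. n \<in> N \<Longrightarrow> g n = \<zero>\<^bsub>U\<^esub>" "x \<in> carrier M"
  shows "the_elem (g ` (N +>\<^bsub>M\<^esub> x)) = g x"
proof -
  interpret U: module K U by fact
  have "g y = g x" if y: "y \<in> N +>\<^bsub>M\<^esub> x" for y
  proof -
    obtain n where n: "n \<in> N" "y = n \<oplus>\<^bsub>M\<^esub> x"
      using y by (auto simp: a_r_coset_def r_coset_def)
    show ?thesis using n assms lin_hom_closed[OF assms(2)]
      by (simp add: lin_hom_add[OF assms(2)])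
  qed
  then have "g ` (N +>\<^bsub>M\<^esub> x) = {g x}" using Q.a_rcos_self assms(4) by blast
  then show ?thesis by simp
qed

lemma quot_lift_lin_hom:
  assumes "module K U" "g \<in> lin_hom K M U" "\<And>n. n \<in> N \<Longrightarrow> g n = \<zero>\<^bsub>U\<^esub>"
  shows "(\<lambda>X. the_elem (g ` X)) \<in> lin_hom K (quot_module M N) U"
  by (rule lin_homI)
    (auto simp: quot_carrier quot_add quot_smult quot_lift_coset[OF assms]
      lin_hom_closed[OF assms(2)] lin_hom_add[OF assms(2)] lin_hom_smult[OF assms(2)])

lemma quot_hom_eq:
  assumes "\<And>x. x \<in> carrier M \<Longrightarrow> f (N +>\<^bsub>M\<^esub> x) = g (N +>\<^bsub>M\<^esub> x)" "X \<in> carrier (quot_module M N)"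
  shows "f X = g X"
  using assms by (auto simp: quot_carrier)

end

section \<open>Bilinear maps and tensor products\<close>

definition bilinear_map ::
  "('k, 'z) ring_scheme \<Rightarrow> ('k, 'v, 'm) module_scheme \<Rightarrow> ('k, 'w, 'n) module_scheme
    \<Rightarrow> ('k, 'u, 'o) module_scheme \<Rightarrow> ('v \<Rightarrow> 'w \<Rightarrow> 'u) \<Rightarrow> bool"
  where "bilinear_map K V W U \<beta> \<longleftrightarrow>
    (\<forall>x\<in>carrier V. (\<lambda>y. \<beta> x y) \<in> lin_hom K W U) \<and> (\<forall>y\<in>carrier W. (\<lambda>x. \<beta> x y) \<in> lin_hom K V U)"

lemma bilinear_mapI:
  assumes "\<And>x. x \<in> carrier V \<Longrightarrow> (\<lambda>y. \<beta> x y) \<in> lin_hom K W U"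
    and "\<And>y. y \<in> carrier W \<Longrightarrow> (\<lambda>x. \<beta> x y) \<in> lin_hom K V U"
  shows "bilinear_map K V W U \<beta>"
  using assms by (auto simp: bilinear_map_def)

lemma bilinear_map_right: "bilinear_map K V W U \<beta> \<Longrightarrow> x \<in> carrier V \<Longrightarrow> (\<lambda>y. \<beta> x y) \<in> lin_hom K W U"
  and bilinear_map_left: "bilinear_map K V W U \<beta> \<Longrightarrow> y \<in> carrier W \<Longrightarrow> (\<lambda>x. \<beta> x y) \<in> lin_hom K V U"
  by (auto simp: bilinear_map_def)

lemma bilinear_map_closed:
  "bilinear_map K V W U \<beta> \<Longrightarrow> x \<in> carrier V \<Longrightarrow> y \<in> carrier W \<Longrightarrow> \<beta> x y \<in> carrier U"
  by (auto simp: bilinear_map_def intro: lin_hom_closed)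

lemma bilinear_map_comp:
  assumes "f \<in> lin_hom K U U'" "bilinear_map K V W U \<beta>"
  shows "bilinear_map K V W U' (\<lambda>x y. f (\<beta> x y))"
  by (rule bilinear_mapI;
      rule lin_hom_comp[OF assms(1)], rule bilinear_map_right[OF assms(2)] bilinear_map_left[OF assms(2)])

section \<open>The tensor product of two modules and its universal property\<close>

context
  fixes K :: "('k, 'z) ring_scheme" and V :: "('k, 'v, 'm) module_scheme"
    and W :: "('k, 'w, 'n) module_scheme"
  assumes V: "module K V" and W: "module K W"
begin

interpretation V: module K V by (rule V)
interpretation W: module K W by (rule W)
interpretation F: module K "free_module K (carrier V \<times> carrier W)"
  by (rule module_free_module) (rule V.R.is_cring)

lemma tensor_relations_subset:
  "tensor_relations K V W \<subseteq> carrier (free_module K (carrier V \<times> carrier W))"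
proof -
  have e: "basis_elt K (x, y) \<in> carrier (free_module K (carrier V \<times> carrier W))"
    if "x \<in> carrier V" "y \<in> carrier W" for x y
    using that by (intro basis_elt_in_free_module V.R.is_cring) auto
  show ?thesis unfolding tensor_relations_def Let_def
    by (auto intro!: F.M.minus_closed e F.M.add.m_closed F.smult_closed)
qed

lemma tensor_quotient:
  "module_quotient K (free_module K (carrier V \<times> carrier W)) (tensor_null K V W)"
  unfolding tensor_null_def
  by (intro module_quotient.intro F.module_axioms submodule_submodule_span tensor_relations_subset)

interpretation Q: module_quotient K "free_module K (carrier V \<times> carrier W)" "tensor_null K V W"
  by (rule tensor_quotient)

lemma basis_pair_closed: "x \<in> carrier V \<Longrightarrow> y \<in> carrier W \<Longrightarrow>
    basis_elt K (x, y) \<in> carrier (free_module K (carrier V \<times> carrier W))"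
  by (intro basis_elt_in_free_module V.R.is_cring) auto

lemma module_tensor_module: "module K (tensor_module K V W)"
  unfolding tensor_module_def by (rule Q.module_quot_module)

lemma tens_closed:
  "x \<in> carrier V \<Longrightarrow> y \<in> carrier W \<Longrightarrow> tens K V W x y \<in> carrier (tensor_module K V W)"
  by (auto simp: tens_def tensor_module_def Q.quot_carrier intro: basis_pair_closed)

lemma tens_bilinear: "bilinear_map K V W (tensor_module K V W) (tens K V W)"
proof -
  let ?F = "free_module K (carrier V \<times> carrier W)"
  let ?p = "\<lambda>c. tensor_null K V W +>\<^bsub>?F\<^esub> c"
  note e = basis_pair_closed
  \<comment> \<open>Each of the four linearity laws below is one of the four families of generators
    of \<open>tensor_null\<close>, read modulo \<open>tensor_null\<close>.\<close>
  have rel: "?p c = ?p d" if "c \<ominus>\<^bsub>?F\<^esub> d \<in> tensor_relations K V W" "c \<in> carrier ?F" "d \<in> carrier ?F"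
    for c d
    using that submodule_span_superset[of "tensor_relations K V W" K ?F]
    by (subst Q.quot_eq_iff) (auto simp: tensor_null_def)
  show ?thesis
  proof (intro bilinear_mapI lin_homI)
    fix x y y' assume a: "x \<in> carrier V" "y \<in> carrier W" "y' \<in> carrier W"
    have "?p (basis_elt K (x, y \<oplus>\<^bsub>W\<^esub> y')) = ?p (basis_elt K (x, y) \<oplus>\<^bsub>?F\<^esub> basis_elt K (x, y'))"
      using a by (intro rel e F.M.add.m_closed) (unfold tensor_relations_def Let_def, blast, auto)
    then show "tens K V W x (y \<oplus>\<^bsub>W\<^esub> y') = tens K V W x y \<oplus>\<^bsub>tensor_module K V W\<^esub> tens K V W x y'"
      using a by (simp add: tens_def tensor_module_def Q.quot_add e)
  next
    fix x x' y assume a: "x \<in> carrier V" "x' \<in> carrier V" "y \<in> carrier W"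
    have "?p (basis_elt K (x \<oplus>\<^bsub>V\<^esub> x', y)) = ?p (basis_elt K (x, y) \<oplus>\<^bsub>?F\<^esub> basis_elt K (x', y))"
      using a by (intro rel e F.M.add.m_closed) (unfold tensor_relations_def Let_def, blast, auto)
    then show "tens K V W (x \<oplus>\<^bsub>V\<^esub> x') y = tens K V W x y \<oplus>\<^bsub>tensor_module K V W\<^esub> tens K V W x' y"
      using a by (simp add: tens_def tensor_module_def Q.quot_add e)
  next
    fix c x y assume a: "c \<in> carrier K" "x \<in> carrier V" "y \<in> carrier W"
    have "?p (basis_elt K (x, c \<odot>\<^bsub>W\<^esub> y)) = ?p (c \<odot>\<^bsub>?F\<^esub> basis_elt K (x, y))"
      using a by (intro rel e F.smult_closed) (unfold tensor_relations_def Let_def, blast, auto)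
    then show "tens K V W x (c \<odot>\<^bsub>W\<^esub> y) = c \<odot>\<^bsub>tensor_module K V W\<^esub> tens K V W x y"
      using a by (simp add: tens_def tensor_module_def Q.quot_smult e)
  next
    fix c x y assume a: "c \<in> carrier K" "x \<in> carrier V" "y \<in> carrier W"
    have "?p (basis_elt K (c \<odot>\<^bsub>V\<^esub> x, y)) = ?p (c \<odot>\<^bsub>?F\<^esub> basis_elt K (x, y))"
      using a by (intro rel e F.smult_closed) (unfold tensor_relations_def Let_def, blast, auto)
    then show "tens K V W (c \<odot>\<^bsub>V\<^esub> x) y = c \<odot>\<^bsub>tensor_module K V W\<^esub> tens K V W x y"
      using a by (simp add: tens_def tensor_module_def Q.quot_smult e)
  qed (auto intro: tens_closed)
qed

lemma lin_hom_tens_left: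
  "g \<in> lin_hom K Z V \<Longrightarrow> y \<in> carrier W \<Longrightarrow> (\<lambda>z. tens K V W (g z) y) \<in> lin_hom K Z (tensor_module K V W)"
  by (rule lin_hom_comp[OF bilinear_map_left[OF tens_bilinear]])

lemma lin_hom_tens_right:
  "x \<in> carrier V \<Longrightarrow> g \<in> lin_hom K Z W \<Longrightarrow> (\<lambda>z. tens K V W x (g z)) \<in> lin_hom K Z (tensor_module K V W)"
  by (rule lin_hom_comp[OF bilinear_map_right[OF tens_bilinear]])

text \<open>A tensor is the coset of a combination of basis elements at pairs, and the coset of such
  a basis element is a pure tensor. Nearly every identity about a comultiplication is reduced to
  pure tensors, or to a formal Sweedler computation, through this fact.\<close>

lemma tensor_hom_eq:
  assumes "module K U" "f \<in> lin_hom K (tensor_module K V W) U" "g \<in> lin_hom K (tensor_module K V W) U"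
    and "\<And>x y. x \<in> carrier V \<Longrightarrow> y \<in> carrier W \<Longrightarrow> f (tens K V W x y) = g (tens K V W x y)"
    and "X \<in> carrier (tensor_module K V W)"
  shows "f X = g X"
proof (rule Q.quot_hom_eq)
  note p = Q.quot_proj_lin_hom[folded tensor_module_def]
  show "X \<in> carrier (quot_module (free_module K (carrier V \<times> carrier W)) (tensor_null K V W))"
    using assms(5) by (simp add: tensor_module_def)
  fix c assume c: "c \<in> carrier (free_module K (carrier V \<times> carrier W))"
  show "f (tensor_null K V W +>\<^bsub>free_module K (carrier V \<times> carrier W)\<^esub> c) =
      g (tensor_null K V W +>\<^bsub>free_module K (carrier V \<times> carrier W)\<^esub> c)"
  proof (rule free_module_hom_eq[OF V.R.is_cring assms(1) lin_hom_comp[OF assms(2) p]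
        lin_hom_comp[OF assms(3) p] _ c])
    fix s assume "s \<in> carrier V \<times> carrier W"
    then obtain x y where "s = (x, y)" "x \<in> carrier V" "y \<in> carrier W" by auto
    then show "f (tensor_null K V W +>\<^bsub>free_module K (carrier V \<times> carrier W)\<^esub> basis_elt K s) =
        g (tensor_null K V W +>\<^bsub>free_module K (carrier V \<times> carrier W)\<^esub> basis_elt K s)"
      using assms(4)[of x y] by (simp only: tens_def)
  qed
qed

lemma bilinear_map_cong:
  assumes "bilinear_map K V W U \<beta>"
    and "\<And>x y. x \<in> carrier V \<Longrightarrow> y \<in> carrier W \<Longrightarrow> \<gamma> x y = \<beta> x y"
  shows "bilinear_map K V W U \<gamma>"
proof (rule bilinear_mapI)
  fix x assume "x \<in> carrier V"
  then show "(\<lambda>y. \<gamma> x y) \<in> lin_hom K W U"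
    using assms(2) by (intro lin_hom_cong[OF W bilinear_map_right[OF assms(1)]]) auto
next
  fix y assume "y \<in> carrier W"
  then show "(\<lambda>x. \<gamma> x y) \<in> lin_hom K V U"
    using assms(2) by (intro lin_hom_cong[OF V bilinear_map_left[OF assms(1)]]) auto
qed

lemma tsum_alt: "tsum K U \<beta> X = the_elem (free_lift K U (\<lambda>p. \<beta> (fst p) (snd p)) ` X)"
  by (simp add: tsum_def free_lift_def)

context
  fixes U :: "('k, 'u, 'o) module_scheme"
  assumes U: "module K U"
begin

interpretation U: module K U by (rule U)

text \<open>Bilinearity of \<beta> is exactly the vanishing on the four families of generators; the
  rest of the span follows by linearity. This is what makes \<open>tsum\<close> independent of
  representatives.\<close>

lemma free_lift_vanishes_tensor_null:
  assumes "bilinear_map K V W U \<beta>" "c \<in> tensor_null K V W"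
  shows "free_lift K U (\<lambda>p. \<beta> (fst p) (snd p)) c = \<zero>\<^bsub>U\<^esub>"
proof (rule lin_hom_vanishes_span[OF F.module_axioms U free_lift_lin_hom[OF U] tensor_relations_subset])
  let ?F = "free_module K (carrier V \<times> carrier W)"
  let ?g = "free_lift K U (\<lambda>p. \<beta> (fst p) (snd p))"
  note b = bilinear_map_closed[OF assms(1)]
  show g: "(\<lambda>p. \<beta> (fst p) (snd p)) \<in> carrier V \<times> carrier W \<rightarrow> carrier U"
    using b by auto
  note l = free_lift_lin_hom[OF U g]
  note e = basis_pair_closed
  have ge: "?g (basis_elt K (x, y)) = \<beta> x y" if "x \<in> carrier V" "y \<in> carrier W" for x y
    using that b by (subst free_lift_basis[OF U]) auto
  have z: "?g (c \<ominus>\<^bsub>?F\<^esub> d) = \<zero>\<^bsub>U\<^esub>" if "c \<in> carrier ?F" "d \<in> carrier ?F" "?g c = ?g d" for c d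
    using that lin_hom_closed[OF l] module_diff_eq_zero_iff[OF U]
    by (simp add: lin_hom_diff[OF F.module_axioms U l])
  show "c \<in> submodule_span K ?F (tensor_relations K V W)"
    using assms(2) by (simp add: tensor_null_def)
  fix r assume "r \<in> tensor_relations K V W"
  then show "?g r = \<zero>\<^bsub>U\<^esub>"
    unfolding tensor_relations_def Let_def
    by (auto intro!: z e F.M.add.m_closed F.smult_closed
        simp: lin_hom_add[OF l] lin_hom_smult[OF l] e ge
          lin_hom_add[OF bilinear_map_left[OF assms(1)]] lin_hom_add[OF bilinear_map_right[OF assms(1)]]
          lin_hom_smult[OF bilinear_map_left[OF assms(1)]] lin_hom_smult[OF bilinear_map_right[OF assms(1)]])
qed

lemma tsum_lin_hom:
  assumes "bilinear_map K V W U \<beta>"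
  shows "tsum K U \<beta> \<in> lin_hom K (tensor_module K V W) U"
proof -
  have "(\<lambda>p. \<beta> (fst p) (snd p)) \<in> carrier V \<times> carrier W \<rightarrow> carrier U"
    using bilinear_map_closed[OF assms] by auto
  from Q.quot_lift_lin_hom[OF U free_lift_lin_hom[OF U this] free_lift_vanishes_tensor_null[OF assms]]
  show ?thesis unfolding tsum_alt[abs_def] tensor_module_def .
qed

lemma tsum_closed:
  "bilinear_map K V W U \<beta> \<Longrightarrow> X \<in> carrier (tensor_module K V W) \<Longrightarrow> tsum K U \<beta> X \<in> carrier U"
  by (rule lin_hom_closed[OF tsum_lin_hom])

lemma tsum_tens:
  assumes "bilinear_map K V W U \<beta>" "x \<in> carrier V" "y \<in> carrier W"
  shows "tsum K U \<beta> (tens K V W x y) = \<beta> x y"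
proof -
  have "(\<lambda>p. \<beta> (fst p) (snd p)) \<in> carrier V \<times> carrier W \<rightarrow> carrier U"
    using bilinear_map_closed[OF assms(1)] by auto
  from Q.quot_lift_coset[OF U free_lift_lin_hom[OF U this] free_lift_vanishes_tensor_null[OF assms(1)]
      basis_pair_closed[OF assms(2,3)]]
  show ?thesis unfolding tsum_alt tens_def
    using bilinear_map_closed[OF assms] by (simp add: free_lift_basis[OF U])
qed

text \<open>Uniqueness half of the universal property, used to recognise a given linear map as a
  Sweedler sum of its values on pure tensors.\<close>

lemma tsum_unique:
  assumes "f \<in> lin_hom K (tensor_module K V W) U" "bilinear_map K V W U \<beta>"
    and "\<And>x y. x \<in> carrier V \<Longrightarrow> y \<in> carrier W \<Longrightarrow> f (tens K V W x y) = \<beta> x y"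
    and "X \<in> carrier (tensor_module K V W)"
  shows "f X = tsum K U \<beta> X"
  by (rule tensor_hom_eq[OF U assms(1) tsum_lin_hom[OF assms(2)] _ assms(4)])
    (simp add: assms(3) tsum_tens[OF assms(2)])

lemma tsum_cong:
  assumes "bilinear_map K V W U \<beta>" "X \<in> carrier (tensor_module K V W)"
    and "\<And>x y. x \<in> carrier V \<Longrightarrow> y \<in> carrier W \<Longrightarrow> \<gamma> x y = \<beta> x y"
  shows "tsum K U \<gamma> X = tsum K U \<beta> X"
proof (rule tsum_unique[OF tsum_lin_hom assms(1) _ assms(2)])
  show g: "bilinear_map K V W U \<gamma>" by (rule bilinear_map_cong[OF assms(1,3)])
  show "tsum K U \<gamma> (tens K V W x y) = \<beta> x y" if "x \<in> carrier V" "y \<in> carrier W" for x y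
    using that assms(3) by (simp add: tsum_tens[OF g])
qed


end

text \<open>Both sides are linear in \<open>X\<close> and agree on pure tensors. In Sweedler
  notation, a linear map passes under the sum sign.\<close>

lemma tsum_hom:
  assumes "module K U" "module K U'" "f \<in> lin_hom K U U'" "bilinear_map K V W U \<beta>"
    and "X \<in> carrier (tensor_module K V W)"
  shows "f (tsum K U \<beta> X) = tsum K U' (\<lambda>x y. f (\<beta> x y)) X"
  by (rule tsum_unique[OF assms(2) lin_hom_comp[OF assms(3) tsum_lin_hom[OF assms(1,4)]]
        bilinear_map_comp[OF assms(3,4)] _ assms(5)])
    (simp add: tsum_tens[OF assms(1,4)])

text \<open>Linearity in the parameter \<open>z\<close> is obtained by varying \<open>X\<close>
  instead: for fixed parameters both sides of each law are linear in \<open>X\<close>, and on pure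
  tensors the law is the assumed linearity of \<beta> in \<open>z\<close>.\<close>

lemma lin_hom_tsum_param:
  assumes "module K U" "module K Z" "X \<in> carrier (tensor_module K V W)"
    and bil: "\<And>z. z \<in> carrier Z \<Longrightarrow> bilinear_map K V W U (\<beta> z)"
    and lin: "\<And>x y. x \<in> carrier V \<Longrightarrow> y \<in> carrier W \<Longrightarrow> (\<lambda>z. \<beta> z x y) \<in> lin_hom K Z U"
  shows "(\<lambda>z. tsum K U (\<beta> z) X) \<in> lin_hom K Z U"
proof -
  interpret Z: module K Z by fact
  note l = tsum_lin_hom[OF assms(1) bil]
  show ?thesis
  proof (rule lin_homI)
    fix z assume "z \<in> carrier Z"
    then show "tsum K U (\<beta> z) X \<in> carrier U" by (rule tsum_closed[OF assms(1) bil assms(3)])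
  next
    fix z z' assume z: "z \<in> carrier Z" "z' \<in> carrier Z"
    then have zz: "z \<oplus>\<^bsub>Z\<^esub> z' \<in> carrier Z" by simp
    show "tsum K U (\<beta> (z \<oplus>\<^bsub>Z\<^esub> z')) X = tsum K U (\<beta> z) X \<oplus>\<^bsub>U\<^esub> tsum K U (\<beta> z') X"
      by (rule tensor_hom_eq[OF assms(1) l[OF zz] lin_hom_plus[OF assms(1) l[OF z(1)] l[OF z(2)]] _ assms(3)])
        (simp add: z tsum_tens[OF assms(1) bil] lin_hom_add[OF lin])
  next
    fix c z assume z: "c \<in> carrier K" "z \<in> carrier Z"
    then have zz: "c \<odot>\<^bsub>Z\<^esub> z \<in> carrier Z" by simp
    show "tsum K U (\<beta> (c \<odot>\<^bsub>Z\<^esub> z)) X = c \<odot>\<^bsub>U\<^esub> tsum K U (\<beta> z) X"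
      by (rule tensor_hom_eq[OF assms(1) l[OF zz] lin_hom_scale[OF assms(1) z(1) l[OF z(2)]] _ assms(3)])
        (simp add: z tsum_tens[OF assms(1) bil] lin_hom_smult[OF lin])
  qed
qed

end

text \<open>Fubini for Sweedler sums. Both sides are linear in \<open>X\<close>; when
  \<open>X\<close> is a pure tensor the sum over \<open>X\<close> disappears and the two sides
  become the same sum over \<open>Y\<close>.\<close>

lemma tsum_swap:
  assumes m: "module K V" "module K W" "module K V'" "module K W'" "module K U"
    and X: "X \<in> carrier (tensor_module K V W)" and Y: "Y \<in> carrier (tensor_module K V' W')"
    and inner: "\<And>x y. x \<in> carrier V \<Longrightarrow> y \<in> carrier W \<Longrightarrow> bilinear_map K V' W' U (\<delta> x y)"
    and outer: "\<And>u v. u \<in> carrier V' \<Longrightarrow> v \<in> carrier W' \<Longrightarrow> bilinear_map K V W U (\<lambda>x y. \<delta> x y u v)"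
  shows "tsum K U (\<lambda>x y. tsum K U (\<delta> x y) Y) X = tsum K U (\<lambda>u v. tsum K U (\<lambda>x y. \<delta> x y u v) X) Y"
proof -
  have b: "bilinear_map K V W U (\<lambda>x y. tsum K U (\<delta> x y) Y)"
    by (intro bilinear_mapI lin_hom_tsum_param[OF m(3,4,5) _ Y] m inner
        bilinear_map_right[OF outer] bilinear_map_left[OF outer])
  have b': "bilinear_map K V' W' U (\<lambda>u v. tsum K U (\<lambda>x y. \<delta> x y u v) X)" if "X \<in> carrier (tensor_module K V W)" for X
    using that
    by (intro bilinear_mapI lin_hom_tsum_param[OF m(1,2,5)] m outer
        bilinear_map_right[OF inner] bilinear_map_left[OF inner])
  have l: "(\<lambda>X. tsum K U (\<lambda>u v. tsum K U (\<lambda>x y. \<delta> x y u v) X) Y) \<in> lin_hom K (tensor_module K V W) U"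
    by (intro lin_hom_tsum_param[OF m(3,4,5) _ Y] module_tensor_module m b'
        tsum_lin_hom[OF m(1,2,5)] outer)
  show ?thesis
  proof (rule tsum_unique[OF m(1,2,5) l b _ X, symmetric])
    fix x y assume xy: "x \<in> carrier V" "y \<in> carrier W"
    show "tsum K U (\<lambda>u v. tsum K U (\<lambda>x y. \<delta> x y u v) (tens K V W x y)) Y = tsum K U (\<delta> x y) Y"
      using xy by (intro tsum_cong[OF m(3,4,5) inner Y] tsum_tens[OF m(1,2,5) outer])
  qed
qed

section \<open>Sweedler sums\<close>

lemma coalgebra_module: "coalgebra K C \<Longrightarrow> module K C"
  by (simp add: coalgebra_def)

lemma comult_closed: "coalgebra K C \<Longrightarrow> h \<in> carrier C \<Longrightarrow> comult C h \<in> carrier (tensor_module K C C)"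
  by (rule lin_hom_closed[OF coalgebra.comult_linear])

lemma counit_closed: "coalgebra K C \<Longrightarrow> h \<in> carrier C \<Longrightarrow> counit C h \<in> carrier K"
  using lin_hom_closed[OF coalgebra.counit_linear] by (fastforce simp: ground_module_simps)

lemma sweedler_lin_hom:
  assumes "coalgebra K C" "module K U" "bilinear_map K C C U \<beta>"
  shows "(\<lambda>h. tsum K U \<beta> (comult C h)) \<in> lin_hom K C U"
  using coalgebra_module[OF assms(1)] assms(2,3)
  by (intro lin_hom_comp[OF tsum_lin_hom coalgebra.comult_linear[OF assms(1)]])

text \<open>The coassociativity axiom is an equation in the threefold tensor product; the trilinear
  expression \<gamma> induces a linear map out of that product, and applying it to the axiom gives
  the identity for an arbitrary summand.\<close>

lemma sweedler_coassoc:
  assumes C: "coalgebra K C" and U: "module K U" and h: "h \<in> carrier C"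
    and b: "\<And>x. x \<in> carrier C \<Longrightarrow> bilinear_map K C C U (\<gamma> x)"
    and l: "\<And>u v. u \<in> carrier C \<Longrightarrow> v \<in> carrier C \<Longrightarrow> (\<lambda>x. \<gamma> x u v) \<in> lin_hom K C U"
  shows "tsum K U (\<lambda>x y. tsum K U (\<gamma> x) (comult C y)) (comult C h) =
    tsum K U (\<lambda>x y. tsum K U (\<lambda>u v. \<gamma> u v y) (comult C x)) (comult C h)"
proof -
  note m = coalgebra_module[OF C]
  note mm = module_tensor_module[OF m m]
  note mmm = module_tensor_module[OF m mm]
  let ?T = "tensor_module K C C" and ?T3 = "tensor_module K C (tensor_module K C C)"
  let ?\<beta> = "\<lambda>x t. tsum K U (\<gamma> x) t"
  have \<beta>: "bilinear_map K C ?T U ?\<beta>"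
    by (intro bilinear_mapI tsum_lin_hom[OF m m U] b lin_hom_tsum_param[OF m m U m] l)
  \<comment> \<open>The linear map out of the threefold tensor product induced by \<gamma>, built by
    lifting twice: first in the two inner variables, then in the outer one.\<close>
  let ?F = "tsum K U ?\<beta>"
  have F: "?F \<in> lin_hom K ?T3 U" by (rule tsum_lin_hom[OF m mm U \<beta>])
  have F3: "?F (tens K C ?T x t) = tsum K U (\<gamma> x) t" if "x \<in> carrier C" "t \<in> carrier ?T" for x t
    by (rule tsum_tens[OF m mm U \<beta> that])
  have bl: "bilinear_map K C C ?T3 (\<lambda>x y. tens K C ?T x (comult C y))"
    by (intro bilinear_mapI lin_hom_tens_right[OF m mm] coalgebra.comult_linear[OF C]
        lin_hom_tens_left[OF m mm] lin_hom_ident comult_closed[OF C])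
  have bi: "bilinear_map K C C ?T3 (\<lambda>u v. tens K C ?T u (tens K C C v y))" if "y \<in> carrier C" for y
    using that
    by (intro bilinear_mapI lin_hom_tens_right[OF m mm] lin_hom_tens_left[OF m m]
        lin_hom_tens_left[OF m mm] lin_hom_ident tens_closed[OF m m])
  have br: "bilinear_map K C C ?T3 (\<lambda>x y. tsum K ?T3 (\<lambda>u v. tens K C ?T u (tens K C C v y)) (comult C x))"
    by (intro bilinear_mapI sweedler_lin_hom[OF C mmm] bi lin_hom_tsum_param[OF m m mmm m] comult_closed[OF C]
        lin_hom_tens_right[OF m mm] lin_hom_tens_right[OF m m] lin_hom_ident)
  note c = comult_closed[OF C]
  have "tsum K U (\<lambda>x y. tsum K U (\<gamma> x) (comult C y)) (comult C h) =
      tsum K U (\<lambda>x y. ?F (tens K C ?T x (comult C y))) (comult C h)"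
    by (rule tsum_cong[OF m m U bilinear_map_comp[OF F bl] c[OF h]]) (simp add: F3 c)
  also have "\<dots> = ?F (tsum K ?T3 (\<lambda>x y. tens K C ?T x (comult C y)) (comult C h))"
    by (rule tsum_hom[OF m m mmm U F bl c[OF h], symmetric])
  also have "\<dots> = ?F (tsum K ?T3 (\<lambda>x y. tsum K ?T3 (\<lambda>u v. tens K C ?T u (tens K C C v y)) (comult C x)) (comult C h))"
    by (simp only: coalgebra.coassoc[OF C h])
  also have "\<dots> = tsum K U (\<lambda>x y. ?F (tsum K ?T3 (\<lambda>u v. tens K C ?T u (tens K C C v y)) (comult C x))) (comult C h)"
    by (rule tsum_hom[OF m m mmm U F br c[OF h]])
  also have "\<dots> = tsum K U (\<lambda>x y. tsum K U (\<lambda>u v. \<gamma> u v y) (comult C x)) (comult C h)"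
  proof (rule tsum_cong[OF m m U bilinear_map_comp[OF F br] c[OF h], symmetric])
    fix x y assume xy: "x \<in> carrier C" "y \<in> carrier C"
    have "?F (tsum K ?T3 (\<lambda>u v. tens K C ?T u (tens K C C v y)) (comult C x)) =
        tsum K U (\<lambda>u v. ?F (tens K C ?T u (tens K C C v y))) (comult C x)"
      using xy by (intro tsum_hom[OF m m mmm U F bi c])
    also have "\<dots> = tsum K U (\<lambda>u v. \<gamma> u v y) (comult C x)"
      using xy
      by (intro tsum_cong[OF m m U bilinear_map_comp[OF F bi] c, symmetric])
        (simp_all add: F3 tens_closed[OF m m] tsum_tens[OF m m U b])
    finally show "tsum K U (\<lambda>u v. \<gamma> u v y) (comult C x) =
        ?F (tsum K ?T3 (\<lambda>u v. tens K C ?T u (tens K C C v y)) (comult C x))" ..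
  qed
  finally show ?thesis .
qed

text \<open>Apply \<open>f\<close> to the counit axiom and pull it under the Sweedler sum, where
  homogeneity frees the scalar.\<close>

lemma sweedler_counit_left:
  assumes C: "coalgebra K C" and U: "module K U" and h: "h \<in> carrier C" and f: "f \<in> lin_hom K C U"
  shows "tsum K U (\<lambda>x y. counit C x \<odot>\<^bsub>U\<^esub> f y) (comult C h) = f h"
proof -
  note m = coalgebra_module[OF C]
  have b: "bilinear_map K C C C (\<lambda>x y. counit C x \<odot>\<^bsub>C\<^esub> y)"
    by (intro bilinear_mapI lin_hom_scale[OF m] lin_hom_scalar[OF m] counit_closed[OF C]
        coalgebra.counit_linear[OF C] lin_hom_ident)
  have "f h = tsum K U (\<lambda>x y. f (counit C x \<odot>\<^bsub>C\<^esub> y)) (comult C h)"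
    using tsum_hom[OF m m m U f b comult_closed[OF C h]] coalgebra.counit_left[OF C h] by simp
  also have "\<dots> = tsum K U (\<lambda>x y. counit C x \<odot>\<^bsub>U\<^esub> f y) (comult C h)"
    by (intro tsum_cong[OF m m U bilinear_map_comp[OF f b] comult_closed[OF C h], symmetric])
      (simp add: lin_hom_smult[OF f] counit_closed[OF C])
  finally show ?thesis ..
qed

lemma sweedler_counit_right:
  assumes C: "coalgebra K C" and U: "module K U" and h: "h \<in> carrier C" and f: "f \<in> lin_hom K C U"
  shows "tsum K U (\<lambda>x y. counit C y \<odot>\<^bsub>U\<^esub> f x) (comult C h) = f h"
proof -
  note m = coalgebra_module[OF C]
  have b: "bilinear_map K C C C (\<lambda>x y. counit C y \<odot>\<^bsub>C\<^esub> x)"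
    by (intro bilinear_mapI lin_hom_scale[OF m] lin_hom_scalar[OF m] counit_closed[OF C]
        coalgebra.counit_linear[OF C] lin_hom_ident)
  have "f h = tsum K U (\<lambda>x y. f (counit C y \<odot>\<^bsub>C\<^esub> x)) (comult C h)"
    using tsum_hom[OF m m m U f b comult_closed[OF C h]] coalgebra.counit_right[OF C h] by simp
  also have "\<dots> = tsum K U (\<lambda>x y. counit C y \<odot>\<^bsub>U\<^esub> f x) (comult C h)"
    by (intro tsum_cong[OF m m U bilinear_map_comp[OF f b] comult_closed[OF C h], symmetric])
      (simp add: lin_hom_smult[OF f] counit_closed[OF C])
  finally show ?thesis ..
qed

section \<open>Algebras and the convolution product\<close>

text \<open>Algebras and coalgebras are built by overwriting or extending the record of a module.
  The module axioms see only four fields, so they survive such changes.\<close>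

lemma module_record_cong:
  fixes M :: "('k, 'v, 'm) module_scheme" and M' :: "('k, 'v, 'n) module_scheme"
  assumes "module K M" "carrier M' = carrier M" "add M' = add M" "zero M' = zero M" "smult M' = smult M"
  shows "module K M'"
proof -
  interpret M: module K M by fact
  have inv: "\<exists>y\<in>carrier M. y \<oplus>\<^bsub>M\<^esub> x = \<zero>\<^bsub>M\<^esub>" if "x \<in> carrier M" for x
    using that M.M.l_neg[OF that] M.M.a_inv_closed[OF that] by blast
  show ?thesis
    by (intro moduleI abelian_groupI)
      (auto simp: assms(2-) M.M.a_ac M.smult_l_distr M.smult_r_distr M.smult_assoc1 M.R.is_cring inv)
qed

lemma assoc_algebra_module: "assoc_algebra K A \<Longrightarrow> module K A"
  by (simp add: assoc_algebra_def)

lemma assoc_algebraI: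
  assumes m: "module K M"
    and one: "\<one>\<^bsub>M\<^esub> \<in> carrier M"
    and bil: "bilinear_map K M M M (\<lambda>x y. x \<otimes>\<^bsub>M\<^esub> y)"
    and assoc: "\<And>x y z. x \<in> carrier M \<Longrightarrow> y \<in> carrier M \<Longrightarrow> z \<in> carrier M \<Longrightarrow>
      (x \<otimes>\<^bsub>M\<^esub> y) \<otimes>\<^bsub>M\<^esub> z = x \<otimes>\<^bsub>M\<^esub> (y \<otimes>\<^bsub>M\<^esub> z)"
    and l: "\<And>x. x \<in> carrier M \<Longrightarrow> \<one>\<^bsub>M\<^esub> \<otimes>\<^bsub>M\<^esub> x = x"
    and r: "\<And>x. x \<in> carrier M \<Longrightarrow> x \<otimes>\<^bsub>M\<^esub> \<one>\<^bsub>M\<^esub> = x"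
  shows "assoc_algebra K M"
proof -
  interpret M: module K M by fact
  note bl = bilinear_map_left[OF bil] and br = bilinear_map_right[OF bil]
  have "ring M"
    by (intro ringI monoidI M.M.abelian_group_axioms)
      (auto simp: one l r assoc lin_hom_add[OF bl] lin_hom_add[OF br] bilinear_map_closed[OF bil])
  moreover have "assoc_algebra_axioms K M"
    by unfold_locales (auto simp: lin_hom_smult[OF bl] lin_hom_smult[OF br])
  ultimately show ?thesis by (simp add: assoc_algebra_def m)
qed

lemma lin_hom_mult_left:
  assumes "assoc_algebra K B" "f \<in> lin_hom K Z B" "b \<in> carrier B"
  shows "(\<lambda>z. f z \<otimes>\<^bsub>B\<^esub> b) \<in> lin_hom K Z B"
proof -
  interpret B: assoc_algebra K B by fact
  show ?thesis
    by (rule lin_homI)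
      (use assms(2,3) in \<open>auto simp: lin_hom_closed lin_hom_add lin_hom_smult B.smult_mult_left B.l_distr\<close>)
qed

lemma lin_hom_mult_right:
  assumes "assoc_algebra K B" "f \<in> lin_hom K Z B" "b \<in> carrier B"
  shows "(\<lambda>z. b \<otimes>\<^bsub>B\<^esub> f z) \<in> lin_hom K Z B"
proof -
  interpret B: assoc_algebra K B by fact
  show ?thesis
    by (rule lin_homI)
      (use assms(2,3) in \<open>auto simp: lin_hom_closed lin_hom_add lin_hom_smult B.smult_mult_right B.r_distr\<close>)
qed

lemma bilinear_map_mult:
  assumes "assoc_algebra K B" "f \<in> lin_hom K V B" "g \<in> lin_hom K W B"
  shows "bilinear_map K V W B (\<lambda>x y. f x \<otimes>\<^bsub>B\<^esub> g y)"
  by (intro bilinear_mapI lin_hom_mult_left lin_hom_mult_right assms lin_hom_closed[OF assms(2)]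
      lin_hom_closed[OF assms(3)])

section \<open>The convolution algebra\<close>

lemma conv_algebra_simps:
  "carrier (conv_algebra K C B) = carrier (hom_module K C B)"
  "add (conv_algebra K C B) = add (hom_module K C B)"
  "zero (conv_algebra K C B) = zero (hom_module K C B)"
  "smult (conv_algebra K C B) = smult (hom_module K C B)"
  "h \<in> carrier C \<Longrightarrow> (\<alpha> \<otimes>\<^bsub>conv_algebra K C B\<^esub> \<beta>) h = tsum K B (\<lambda>x y. \<alpha> x \<otimes>\<^bsub>B\<^esub> \<beta> y) (comult C h)"
  "h \<in> carrier C \<Longrightarrow> \<one>\<^bsub>conv_algebra K C B\<^esub> h = counit C h \<odot>\<^bsub>B\<^esub> \<one>\<^bsub>B\<^esub>"
  by (simp_all add: conv_algebra_def)

lemma lin_hom_conv_algebra: "lin_hom K Z (conv_algebra K C B) = lin_hom K Z (hom_module K C B)"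
  and lin_hom_from_conv_algebra: "lin_hom K (conv_algebra K C B) Z = lin_hom K (hom_module K C B) Z"
  by (simp_all add: lin_hom_def conv_algebra_simps)

lemma conv_algebra_eqI:
  assumes "\<alpha> \<in> carrier (conv_algebra K C B)" "\<beta> \<in> carrier (conv_algebra K C B)"
    and "\<And>h. h \<in> carrier C \<Longrightarrow> \<alpha> h = \<beta> h"
  shows "\<alpha> = \<beta>"
  using assms hom_module_eqI[of \<alpha> K C B \<beta>] by (simp add: conv_algebra_simps)

lemma conv_algebra_memI:
  assumes "module K C" "f \<in> lin_hom K C B"
  shows "(\<lambda>h\<in>carrier C. f h) \<in> carrier (conv_algebra K C B)"
  using lin_hom_cong[OF assms] by (simp add: conv_algebra_simps hom_module_simps)

lemma conv_algebra_lin_hom: "\<alpha> \<in> carrier (conv_algebra K C B) \<Longrightarrow> \<alpha> \<in> lin_hom K C B"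
  by (simp add: conv_algebra_simps hom_module_simps)

text \<open>Currying: apart from the normalisation off the carrier, a linear map into a module of
  linear maps is a bilinear map. Measurings are handled in this form from here on.\<close>

lemma lin_hom_hom_module_iff:
  assumes "module K Z" "module K V"
  shows "\<phi> \<in> lin_hom K Z (hom_module K V W) \<longleftrightarrow>
    bilinear_map K Z V W \<phi> \<and> (\<forall>z\<in>carrier Z. \<phi> z \<in> extensional (carrier V))"
proof -
  interpret Z: module K Z by fact
  interpret V: module K V by fact
  have "\<phi> \<in> lin_hom K Z (hom_module K V W)"
    if b: "bilinear_map K Z V W \<phi>" and e: "\<And>z. z \<in> carrier Z \<Longrightarrow> \<phi> z \<in> extensional (carrier V)"
  proof (rule lin_homI)
    note bl = bilinear_map_left[OF b] and br = bilinear_map_right[OF b]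
    show "\<phi> z \<in> carrier (hom_module K V W)" if "z \<in> carrier Z" for z
      using br[OF that] e[OF that] by (simp add: hom_module_simps)
    show "\<phi> (y \<oplus>\<^bsub>Z\<^esub> z) = \<phi> y \<oplus>\<^bsub>hom_module K V W\<^esub> \<phi> z" if "y \<in> carrier Z" "z \<in> carrier Z" for y z
      using that e lin_hom_add[OF bl]
      by (intro extensionalityI[of _ "carrier V"]) (auto simp: hom_module_simps)
    show "\<phi> (c \<odot>\<^bsub>Z\<^esub> z) = c \<odot>\<^bsub>hom_module K V W\<^esub> \<phi> z" if "c \<in> carrier K" "z \<in> carrier Z" for c z
      using that e lin_hom_smult[OF bl]
      by (intro extensionalityI[of _ "carrier V"]) (auto simp: hom_module_simps)
  qed
  moreover have "\<phi> z \<in> extensional (carrier V)" if "\<phi> \<in> lin_hom K Z (hom_module K V W)" "z \<in> carrier Z" for z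
    using lin_hom_closed[OF that] by (simp add: hom_module_simps)
  ultimately show ?thesis
    by (blast intro: bilinear_mapI lin_hom_eval lin_hom_hom_moduleD)
qed

lemma module_conv_algebra:
  assumes "module K C" "module K B"
  shows "module K (conv_algebra K C B)"
  by (rule module_record_cong[OF module_hom_module[OF assms]]) (simp_all add: conv_algebra_simps)

text \<open>Duality: coassociativity of \<open>C\<close> together with associativity in
  \<open>B\<close> gives associativity of convolution, and the two counit axioms give the two unit
  laws.\<close>

lemma assoc_algebra_conv_algebra:
  assumes C: "coalgebra K C" and B: "assoc_algebra K B"
  shows "assoc_algebra K (conv_algebra K C B)"
proof -
  interpret B: assoc_algebra K B by fact
  note mC = coalgebra_module[OF C] and mB = assoc_algebra_module[OF B]
  note c = comult_closed[OF C]
  let ?M = "conv_algebra K C B"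
  note lin = conv_algebra_lin_hom[of _ K C B]
  note bm = bilinear_map_mult[OF B]
  note val = lin_hom_closed[OF lin]
  have closed: "\<alpha> \<otimes>\<^bsub>?M\<^esub> \<beta> \<in> carrier ?M" if "\<alpha> \<in> carrier ?M" "\<beta> \<in> carrier ?M" for \<alpha> \<beta>
    using conv_algebra_memI[OF mC sweedler_lin_hom[OF C mB bm[OF lin lin]], OF that]
    by (simp add: conv_algebra_def)
  have one: "\<one>\<^bsub>?M\<^esub> \<in> carrier ?M"
    using conv_algebra_memI[OF mC lin_hom_scalar[OF mB B.one_closed coalgebra.counit_linear[OF C]]]
    by (simp add: conv_algebra_def)
  show ?thesis
  proof (rule assoc_algebraI)
    show "module K ?M" by (rule module_conv_algebra[OF mC mB])
    show "\<one>\<^bsub>?M\<^esub> \<in> carrier ?M" by (rule one)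
    have ext: "\<alpha> \<otimes>\<^bsub>?M\<^esub> \<beta> \<in> extensional (carrier C)" for \<alpha> \<beta> by (simp add: conv_algebra_def)
    show "bilinear_map K ?M ?M ?M (\<lambda>x y. x \<otimes>\<^bsub>?M\<^esub> y)"
    proof (intro bilinear_mapI)
      fix \<alpha> assume \<alpha>: "\<alpha> \<in> carrier ?M"
      \<comment> \<open>Linearity of the product in one factor is checked pointwise in
        \<open>C\<close>, so evaluation at a point must itself be linear in that factor.\<close>
      have ev: "(\<lambda>\<beta>. \<beta> y) \<in> lin_hom K ?M B" if "y \<in> carrier C" for y
        using lin_hom_eval[OF lin_hom_ident that, of K B] by (simp add: lin_hom_from_conv_algebra)
      show "(\<lambda>\<beta>. \<alpha> \<otimes>\<^bsub>?M\<^esub> \<beta>) \<in> lin_hom K ?M ?M"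
        unfolding lin_hom_conv_algebra lin_hom_hom_module_iff[OF \<open>module K ?M\<close> mC]
      proof (intro conjI ballI ext bilinear_mapI)
        show "\<alpha> \<otimes>\<^bsub>?M\<^esub> \<beta> \<in> lin_hom K C B" if "\<beta> \<in> carrier ?M" for \<beta>
          using closed[OF \<alpha> that] by (rule lin)
        show "(\<lambda>\<beta>. (\<alpha> \<otimes>\<^bsub>?M\<^esub> \<beta>) h) \<in> lin_hom K ?M B" if h: "h \<in> carrier C" for h
          unfolding conv_algebra_simps(5)[OF h]
          by (intro lin_hom_tsum_param[OF mC mC mB] \<open>module K ?M\<close> c h bm lin \<alpha>
              lin_hom_mult_right[OF B] ev val)
      qed
      show "(\<lambda>\<beta>. \<beta> \<otimes>\<^bsub>?M\<^esub> \<alpha>) \<in> lin_hom K ?M ?M"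
        unfolding lin_hom_conv_algebra lin_hom_hom_module_iff[OF \<open>module K ?M\<close> mC]
      proof (intro conjI ballI ext bilinear_mapI)
        show "\<beta> \<otimes>\<^bsub>?M\<^esub> \<alpha> \<in> lin_hom K C B" if "\<beta> \<in> carrier ?M" for \<beta>
          using closed[OF that \<alpha>] by (rule lin)
        show "(\<lambda>\<beta>. (\<beta> \<otimes>\<^bsub>?M\<^esub> \<alpha>) h) \<in> lin_hom K ?M B" if h: "h \<in> carrier C" for h
          unfolding conv_algebra_simps(5)[OF h]
          by (intro lin_hom_tsum_param[OF mC mC mB] \<open>module K ?M\<close> c h bm lin \<alpha>
              lin_hom_mult_left[OF B] ev val)
      qed
    qed
  next
    fix \<alpha> \<beta> \<gamma> assume a: "\<alpha> \<in> carrier ?M" "\<beta> \<in> carrier ?M" "\<gamma> \<in> carrier ?M"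
    note l = lin[OF a(1)] lin[OF a(2)] lin[OF a(3)]
    note v = lin_hom_closed[OF l(1)] lin_hom_closed[OF l(2)] lin_hom_closed[OF l(3)]
    note pl = bm[OF lin lin, OF closed[OF a(1,2)] a(3)] bm[OF lin lin, OF a(1) closed[OF a(2,3)]]
    show "(\<alpha> \<otimes>\<^bsub>?M\<^esub> \<beta>) \<otimes>\<^bsub>?M\<^esub> \<gamma> = \<alpha> \<otimes>\<^bsub>?M\<^esub> (\<beta> \<otimes>\<^bsub>?M\<^esub> \<gamma>)"
    proof (rule conv_algebra_eqI[OF closed[OF closed[OF a(1,2)] a(3)] closed[OF a(1) closed[OF a(2,3)]]])
      fix h assume h: "h \<in> carrier C"
      have "((\<alpha> \<otimes>\<^bsub>?M\<^esub> \<beta>) \<otimes>\<^bsub>?M\<^esub> \<gamma>) h = tsum K B (\<lambda>x y. (\<alpha> \<otimes>\<^bsub>?M\<^esub> \<beta>) x \<otimes>\<^bsub>B\<^esub> \<gamma> y) (comult C h)"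
        using h by (simp add: conv_algebra_simps)
      \<comment> \<open>Right multiplication by \<gamma> \<open>y\<close> does not involve the inner
        sum, hence is a linear map that moves under it; the three values then stand inside one
        iterated sum and coassociativity applies.\<close>
      also have "\<dots> = tsum K B (\<lambda>x y. tsum K B (\<lambda>u w. (\<alpha> u \<otimes>\<^bsub>B\<^esub> \<beta> w) \<otimes>\<^bsub>B\<^esub> \<gamma> y) (comult C x)) (comult C h)"
        using v
        by (intro tsum_cong[OF mC mC mB pl(1) c[OF h], symmetric])
          (simp add: conv_algebra_simps c
            tsum_hom[OF mC mC mB mB lin_hom_mult_left[OF B lin_hom_ident] bm[OF l(1,2)]])
      also have "\<dots> = tsum K B (\<lambda>x y. tsum K B (\<lambda>u w. (\<alpha> x \<otimes>\<^bsub>B\<^esub> \<beta> u) \<otimes>\<^bsub>B\<^esub> \<gamma> w) (comult C y)) (comult C h)"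
        by (intro sweedler_coassoc[OF C mB h, symmetric] bm l lin_hom_mult_left[OF B]
            lin_hom_mult_right[OF B] v)
      also have "\<dots> = tsum K B (\<lambda>x y. \<alpha> x \<otimes>\<^bsub>B\<^esub> (\<beta> \<otimes>\<^bsub>?M\<^esub> \<gamma>) y) (comult C h)"
      proof (intro tsum_cong[OF mC mC mB pl(2) c[OF h]])
        fix x y assume xy: "x \<in> carrier C" "y \<in> carrier C"
        have "tsum K B (\<lambda>u w. (\<alpha> x \<otimes>\<^bsub>B\<^esub> \<beta> u) \<otimes>\<^bsub>B\<^esub> \<gamma> w) (comult C y) =
            tsum K B (\<lambda>u w. \<alpha> x \<otimes>\<^bsub>B\<^esub> (\<beta> u \<otimes>\<^bsub>B\<^esub> \<gamma> w)) (comult C y)"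
          using xy v
          by (intro tsum_cong[OF mC mC mB bilinear_map_comp[OF lin_hom_mult_right[OF B lin_hom_ident] bm[OF l(2,3)]]] c)
            (simp_all add: B.m_assoc)
        then show "tsum K B (\<lambda>u w. (\<alpha> x \<otimes>\<^bsub>B\<^esub> \<beta> u) \<otimes>\<^bsub>B\<^esub> \<gamma> w) (comult C y) = \<alpha> x \<otimes>\<^bsub>B\<^esub> (\<beta> \<otimes>\<^bsub>?M\<^esub> \<gamma>) y"
          using xy v
          by (simp add: conv_algebra_simps c
            tsum_hom[OF mC mC mB mB lin_hom_mult_right[OF B lin_hom_ident] bm[OF l(2,3)]])
      qed
      also have "\<dots> = (\<alpha> \<otimes>\<^bsub>?M\<^esub> (\<beta> \<otimes>\<^bsub>?M\<^esub> \<gamma>)) h" using h by (simp add: conv_algebra_simps)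
      finally show "((\<alpha> \<otimes>\<^bsub>?M\<^esub> \<beta>) \<otimes>\<^bsub>?M\<^esub> \<gamma>) h = (\<alpha> \<otimes>\<^bsub>?M\<^esub> (\<beta> \<otimes>\<^bsub>?M\<^esub> \<gamma>)) h" .
    qed
  next
    fix \<alpha> assume a: "\<alpha> \<in> carrier ?M"
    note v = lin_hom_closed[OF lin[OF a]]
    show "\<one>\<^bsub>?M\<^esub> \<otimes>\<^bsub>?M\<^esub> \<alpha> = \<alpha>"
    proof (rule conv_algebra_eqI[OF closed[OF one a] a])
      fix h assume h: "h \<in> carrier C"
      have "(\<one>\<^bsub>?M\<^esub> \<otimes>\<^bsub>?M\<^esub> \<alpha>) h = tsum K B (\<lambda>x y. \<one>\<^bsub>?M\<^esub> x \<otimes>\<^bsub>B\<^esub> \<alpha> y) (comult C h)"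
        using h by (simp add: conv_algebra_simps)
      also have "\<dots> = tsum K B (\<lambda>x y. counit C x \<odot>\<^bsub>B\<^esub> \<alpha> y) (comult C h)"
        by (intro tsum_cong[OF mC mC mB bm[OF lin[OF one] lin[OF a]] c[OF h], symmetric])
          (simp add: conv_algebra_simps B.smult_mult_left counit_closed[OF C] v)
      finally show "(\<one>\<^bsub>?M\<^esub> \<otimes>\<^bsub>?M\<^esub> \<alpha>) h = \<alpha> h"
        by (simp add: sweedler_counit_left[OF C mB h lin[OF a]])
    qed
    show "\<alpha> \<otimes>\<^bsub>?M\<^esub> \<one>\<^bsub>?M\<^esub> = \<alpha>"
    proof (rule conv_algebra_eqI[OF closed[OF a one] a])
      fix h assume h: "h \<in> carrier C"
      have "(\<alpha> \<otimes>\<^bsub>?M\<^esub> \<one>\<^bsub>?M\<^esub>) h = tsum K B (\<lambda>x y. \<alpha> x \<otimes>\<^bsub>B\<^esub> \<one>\<^bsub>?M\<^esub> y) (comult C h)"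
        using h by (simp add: conv_algebra_simps)
      also have "\<dots> = tsum K B (\<lambda>x y. counit C y \<odot>\<^bsub>B\<^esub> \<alpha> x) (comult C h)"
        by (intro tsum_cong[OF mC mC mB bm[OF lin[OF a] lin[OF one]] c[OF h], symmetric])
          (simp add: conv_algebra_simps B.smult_mult_right counit_closed[OF C] v)
      finally show "(\<alpha> \<otimes>\<^bsub>?M\<^esub> \<one>\<^bsub>?M\<^esub>) h = \<alpha> h"
        by (simp add: sweedler_counit_right[OF C mB h lin[OF a]])
    qed
  qed
qed

lemma alg_homI:
  assumes "f \<in> lin_hom K A B" "f \<one>\<^bsub>A\<^esub> = \<one>\<^bsub>B\<^esub>"
    and "\<And>x y. x \<in> carrier A \<Longrightarrow> y \<in> carrier A \<Longrightarrow> f (x \<otimes>\<^bsub>A\<^esub> y) = f x \<otimes>\<^bsub>B\<^esub> f y"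
  shows "f \<in> alg_hom K A B"
  using assms by (auto simp: alg_hom_def ring_hom_def lin_hom_def)

lemma alg_hom_lin_hom: "f \<in> alg_hom K A B \<Longrightarrow> f \<in> lin_hom K A B"
  and alg_hom_one: "f \<in> alg_hom K A B \<Longrightarrow> f \<one>\<^bsub>A\<^esub> = \<one>\<^bsub>B\<^esub>"
  and alg_hom_mult: "f \<in> alg_hom K A B \<Longrightarrow> x \<in> carrier A \<Longrightarrow> y \<in> carrier A \<Longrightarrow>
    f (x \<otimes>\<^bsub>A\<^esub> y) = f x \<otimes>\<^bsub>B\<^esub> f y"
  by (auto simp: alg_hom_def ring_hom_def)

lemma alg_hom_comp:
  assumes "f \<in> alg_hom K B C" "g \<in> alg_hom K A B"
  shows "(\<lambda>x. f (g x)) \<in> alg_hom K A C"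
  by (rule alg_homI)
    (simp_all add: alg_hom_lin_hom assms alg_hom_one[OF assms(1)] alg_hom_one[OF assms(2)]
      alg_hom_mult[OF assms(1)] alg_hom_mult[OF assms(2)]
      lin_hom_closed[OF alg_hom_lin_hom[OF assms(2)]]
      lin_hom_comp[OF alg_hom_lin_hom[OF assms(1)] alg_hom_lin_hom[OF assms(2)]])

section \<open>Measurings of algebras\<close>

lemma alg_measuring_iff:
  assumes "module K H" "module K A"
  shows "alg_measuring K H A B \<rho> \<longleftrightarrow>
    bilinear_map K H A B \<rho> \<and> (\<forall>h\<in>carrier H. \<rho> h \<in> extensional (carrier A)) \<and>
    (\<forall>h\<in>carrier H. \<forall>a\<in>carrier A. \<forall>a'\<in>carrier A.
      \<rho> h (a \<otimes>\<^bsub>A\<^esub> a') = tsum K B (\<lambda>x y. \<rho> x a \<otimes>\<^bsub>B\<^esub> \<rho> y a') (comult H h)) \<and>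
    (\<forall>h\<in>carrier H. \<rho> h \<one>\<^bsub>A\<^esub> = counit H h \<odot>\<^bsub>B\<^esub> \<one>\<^bsub>B\<^esub>)"
  unfolding alg_measuring_def lin_hom_hom_module_iff[OF assms] by blast

text \<open>Evaluated at \<open>h\<close>, the convolution product is the Sweedler sum of the
  measuring condition and the convolution unit is its unit condition. The two notions differ only by
  the order of arguments.\<close>

lemma alg_measuring_alg_hom:
  assumes H: "coalgebra K H" and A: "assoc_algebra K A" and B: "assoc_algebra K B"
    and \<rho>: "alg_measuring K H A B \<rho>"
  shows "(\<lambda>a. \<lambda>h\<in>carrier H. \<rho> h a) \<in> alg_hom K A (conv_algebra K H B)"
proof -
  interpret A: assoc_algebra K A by fact
  note mH = coalgebra_module[OF H] and mA = assoc_algebra_module[OF A] and mB = assoc_algebra_module[OF B]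
  note M = assoc_algebra_conv_algebra[OF H B]
  interpret M: assoc_algebra K "conv_algebra K H B" by fact
  note r = \<rho>[unfolded alg_measuring_iff[OF mH mA]]
  have b: "bilinear_map K H A B \<rho>" using r by blast
  have "bilinear_map K A H B (\<lambda>a h. \<rho> h a)"
    by (intro bilinear_mapI bilinear_map_left[OF b] bilinear_map_right[OF b])
  then have "bilinear_map K A H B (\<lambda>a. \<lambda>h\<in>carrier H. \<rho> h a)"
    by (rule bilinear_map_cong[OF mA mH]) simp
  then have l: "(\<lambda>a. \<lambda>h\<in>carrier H. \<rho> h a) \<in> lin_hom K A (conv_algebra K H B)"
    by (simp add: lin_hom_conv_algebra lin_hom_hom_module_iff[OF mA mH])
  note cl = lin_hom_closed[OF l]
  show ?thesis
  proof (rule alg_homI[OF l])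
    show "(\<lambda>h\<in>carrier H. \<rho> h \<one>\<^bsub>A\<^esub>) = \<one>\<^bsub>conv_algebra K H B\<^esub>"
      by (rule conv_algebra_eqI[OF cl[OF A.one_closed] M.one_closed]) (use r in \<open>auto simp: conv_algebra_simps\<close>)
    fix a a' assume a: "a \<in> carrier A" "a' \<in> carrier A"
    show "(\<lambda>h\<in>carrier H. \<rho> h (a \<otimes>\<^bsub>A\<^esub> a')) =
        (\<lambda>h\<in>carrier H. \<rho> h a) \<otimes>\<^bsub>conv_algebra K H B\<^esub> (\<lambda>h\<in>carrier H. \<rho> h a')"
    proof (rule conv_algebra_eqI[OF cl M.m_closed[OF cl cl]])
      fix h assume h: "h \<in> carrier H"
      have "tsum K B (\<lambda>x y. restrict (\<lambda>h. \<rho> h a) (carrier H) x \<otimes>\<^bsub>B\<^esub> restrict (\<lambda>h. \<rho> h a') (carrier H) y) (comult H h)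
        = tsum K B (\<lambda>x y. \<rho> x a \<otimes>\<^bsub>B\<^esub> \<rho> y a') (comult H h)"
        using a by (intro tsum_cong[OF mH mH mB bilinear_map_mult[OF B] comult_closed[OF H h]]
            bilinear_map_left[OF b]) auto
      then show "(\<lambda>h\<in>carrier H. \<rho> h (a \<otimes>\<^bsub>A\<^esub> a')) h =
        ((\<lambda>h\<in>carrier H. \<rho> h a) \<otimes>\<^bsub>conv_algebra K H B\<^esub> (\<lambda>h\<in>carrier H. \<rho> h a')) h"
        using h a r by (simp add: conv_algebra_simps)
    qed (use a in auto)
  qed
qed

text \<open>The converse exchange of arguments; the restriction is over \<open>A\<close>, because
  the values must now be extensional in the algebra variable.\<close>

lemma alg_hom_alg_measuring:
  assumes H: "coalgebra K H" and A: "assoc_algebra K A" and B: "assoc_algebra K B"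
    and \<phi>: "\<phi> \<in> alg_hom K A (conv_algebra K H B)"
  shows "alg_measuring K H A B (\<lambda>h. \<lambda>a\<in>carrier A. \<phi> a h)"
proof -
  interpret A: assoc_algebra K A by fact
  note mH = coalgebra_module[OF H] and mA = assoc_algebra_module[OF A]
  have b: "bilinear_map K A H B \<phi>"
    using alg_hom_lin_hom[OF \<phi>] by (simp add: lin_hom_conv_algebra lin_hom_hom_module_iff[OF mA mH])
  have "bilinear_map K H A B (\<lambda>h a. \<phi> a h)"
    by (intro bilinear_mapI bilinear_map_left[OF b] bilinear_map_right[OF b])
  then have "bilinear_map K H A B (\<lambda>h. \<lambda>a\<in>carrier A. \<phi> a h)"
    by (rule bilinear_map_cong[OF mH mA]) auto
  then show ?thesis
    unfolding alg_measuring_iff[OF mH mA]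
    by (simp add: alg_hom_mult[OF \<phi>] alg_hom_one[OF \<phi>] conv_algebra_simps)
qed

text \<open>Linearity carries \<open>F\<close> under the Sweedler sum and multiplicativity splits it
  over the two factors.\<close>

lemma alg_measuring_comp:
  assumes H: "coalgebra K H" and A: "assoc_algebra K A" and B: "assoc_algebra K B"
    and \<rho>: "alg_measuring K H A B \<rho>" and D: "assoc_algebra K D" and F: "F \<in> alg_hom K B D"
  shows "alg_measuring K H A D (\<lambda>h. compose (carrier A) F (\<rho> h))"
proof -
  interpret A: assoc_algebra K A by fact
  interpret B: assoc_algebra K B by fact
  note mH = coalgebra_module[OF H] and mA = assoc_algebra_module[OF A] and mB = assoc_algebra_module[OF B]
    and mD = assoc_algebra_module[OF D]
  note r = \<rho>[unfolded alg_measuring_iff[OF mH mA]]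
  have b: "bilinear_map K H A B \<rho>" using r by blast
  note Fl = alg_hom_lin_hom[OF F]
  note rc = bilinear_map_closed[OF b]
  have "bilinear_map K H A D (\<lambda>h. compose (carrier A) F (\<rho> h))"
    by (rule bilinear_map_cong[OF mH mA bilinear_map_comp[OF Fl b]]) (auto simp: compose_def)
  moreover have "F (tsum K B (\<lambda>x y. \<rho> x a \<otimes>\<^bsub>B\<^esub> \<rho> y a') (comult H h)) =
      tsum K D (\<lambda>x y. F (\<rho> x a) \<otimes>\<^bsub>D\<^esub> F (\<rho> y a')) (comult H h)"
    if "h \<in> carrier H" "a \<in> carrier A" "a' \<in> carrier A" for h a a'
  proof -
    have bb: "bilinear_map K H H B (\<lambda>x y. \<rho> x a \<otimes>\<^bsub>B\<^esub> \<rho> y a')"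
      by (intro bilinear_map_mult[OF B] bilinear_map_left[OF b] that)
    have "F (tsum K B (\<lambda>x y. \<rho> x a \<otimes>\<^bsub>B\<^esub> \<rho> y a') (comult H h)) =
        tsum K D (\<lambda>x y. F (\<rho> x a \<otimes>\<^bsub>B\<^esub> \<rho> y a')) (comult H h)"
      by (rule tsum_hom[OF mH mH mB mD Fl bb comult_closed[OF H that(1)]])
    also have "\<dots> = tsum K D (\<lambda>x y. F (\<rho> x a) \<otimes>\<^bsub>D\<^esub> F (\<rho> y a')) (comult H h)"
      by (rule tsum_cong[OF mH mH mD bilinear_map_comp[OF Fl bb] comult_closed[OF H that(1)], symmetric])
        (simp add: alg_hom_mult[OF F] rc that)
    finally show ?thesis .
  qed
  ultimately show ?thesis
    using r unfolding alg_measuring_iff[OF mH mA]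
    by (simp add: compose_def alg_hom_one[OF F] lin_hom_smult[OF Fl] counit_closed[OF H])
qed

lemma alg_measuring_precomp:
  assumes H: "coalgebra K H" and A: "assoc_algebra K A" and A': "assoc_algebra K A'"
    and \<rho>: "alg_measuring K H A' B \<rho>" and F: "F \<in> alg_hom K A A'"
  shows "alg_measuring K H A B (\<lambda>h. compose (carrier A) (\<rho> h) F)"
proof -
  interpret A: assoc_algebra K A by fact
  interpret A': assoc_algebra K A' by fact
  note mH = coalgebra_module[OF H] and mA = assoc_algebra_module[OF A] and mA' = assoc_algebra_module[OF A']
  note r = \<rho>[unfolded alg_measuring_iff[OF mH mA']]
  have b: "bilinear_map K H A' B \<rho>" using r by blast
  note Fl = alg_hom_lin_hom[OF F]
  have "bilinear_map K H A B (\<lambda>h a. \<rho> h (F a))"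
    by (intro bilinear_mapI lin_hom_comp[OF bilinear_map_right[OF b] Fl] bilinear_map_left[OF b]
        lin_hom_closed[OF Fl])
  then have "bilinear_map K H A B (\<lambda>h. compose (carrier A) (\<rho> h) F)"
    by (rule bilinear_map_cong[OF mH mA]) (simp add: compose_def)
  then show ?thesis
    using r unfolding alg_measuring_iff[OF mH mA]
    by (simp add: compose_def alg_hom_one[OF F] alg_hom_mult[OF F] lin_hom_closed[OF Fl])
qed

text \<open>A measuring \<open>H \<rightarrow> Hom(A, [L, B])\<close> in terms of its values \<open>\<sigma> h a l\<close>. By the interchange of
  Sweedler sums the conditions are symmetric in \<open>H\<close> and \<open>L\<close>.\<close>

definition trilinear_measuring ::
  "('k, 'z) ring_scheme \<Rightarrow> ('k, 'h, 'm) coalg_scheme \<Rightarrow> ('k, 'a, 'n) module_scheme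
    \<Rightarrow> ('k, 'l, 'o) coalg_scheme \<Rightarrow> ('k, 'b, 'q) module_scheme \<Rightarrow> ('h \<Rightarrow> 'a \<Rightarrow> 'l \<Rightarrow> 'b) \<Rightarrow> bool"
  where "trilinear_measuring K H A L B \<sigma> \<longleftrightarrow>
    (\<forall>a\<in>carrier A. \<forall>l\<in>carrier L. (\<lambda>h. \<sigma> h a l) \<in> lin_hom K H B) \<and>
    (\<forall>h\<in>carrier H. \<forall>l\<in>carrier L. (\<lambda>a. \<sigma> h a l) \<in> lin_hom K A B) \<and>
    (\<forall>h\<in>carrier H. \<forall>a\<in>carrier A. \<sigma> h a \<in> lin_hom K L B) \<and>
    (\<forall>h\<in>carrier H. \<forall>l\<in>carrier L. \<forall>a\<in>carrier A. \<forall>a'\<in>carrier A. \<sigma> h (a \<otimes>\<^bsub>A\<^esub> a') l =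
      tsum K B (\<lambda>x y. tsum K B (\<lambda>u v. \<sigma> x a u \<otimes>\<^bsub>B\<^esub> \<sigma> y a' v) (comult L l)) (comult H h)) \<and>
    (\<forall>h\<in>carrier H. \<forall>l\<in>carrier L. \<sigma> h \<one>\<^bsub>A\<^esub> l = counit H h \<odot>\<^bsub>B\<^esub> (counit L l \<odot>\<^bsub>B\<^esub> \<one>\<^bsub>B\<^esub>))"

section \<open>Trilinear data, and the exchange of the two coalgebras\<close>

context
  fixes K :: "('k, 'z) ring_scheme" and H :: "('k, 'h, 'm) coalg_scheme" and L :: "('k, 'l, 'o) coalg_scheme"
    and A :: "('k, 'a, 'n) module_scheme" and B :: "('k, 'b, 'q) module_scheme"
  assumes H: "coalgebra K H" and L: "coalgebra K L" and A: "assoc_algebra K A" and B: "assoc_algebra K B"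
begin

private abbreviation (input) "LB \<equiv> conv_algebra K L B"

private lemmas aLB = assoc_algebra_conv_algebra[OF L B]
private lemmas mod_H = coalgebra_module[OF H] and mod_L = coalgebra_module[OF L]
  and mod_A = assoc_algebra_module[OF A] and mod_B = assoc_algebra_module[OF B]
  and mod_LB = assoc_algebra_module[OF aLB]
private lemmas comult_H = comult_closed[OF H] and comult_L = comult_closed[OF L]

interpretation A: assoc_algebra K A by (rule A)
interpretation B: assoc_algebra K B by (rule B)
interpretation LB: assoc_algebra K LB by (rule aLB)

lemma trilinear_measuring_swap:
  assumes "trilinear_measuring K H A L B \<sigma>"
  shows "trilinear_measuring K L A H B (\<lambda>l a h. \<sigma> h a l)"
proof -
  note r = assms[unfolded trilinear_measuring_def]
  have "tsum K B (\<lambda>x y. tsum K B (\<lambda>u v. \<sigma> x a u \<otimes>\<^bsub>B\<^esub> \<sigma> y a' v) (comult L l)) (comult H h) =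
      tsum K B (\<lambda>u v. tsum K B (\<lambda>x y. \<sigma> x a u \<otimes>\<^bsub>B\<^esub> \<sigma> y a' v) (comult H h)) (comult L l)"
    if "h \<in> carrier H" "l \<in> carrier L" "a \<in> carrier A" "a' \<in> carrier A" for h l a a'
    using r that by (intro tsum_swap[OF mod_H mod_H mod_L mod_L mod_B] comult_H comult_L bilinear_map_mult[OF B]) blast+
  \<comment> \<open>The unit condition carries one counit from each coalgebra; the exchange reverses
    their order, which commutativity of the scalars repairs.\<close>
  moreover have "c \<odot>\<^bsub>B\<^esub> (d \<odot>\<^bsub>B\<^esub> \<one>\<^bsub>B\<^esub>) = d \<odot>\<^bsub>B\<^esub> (c \<odot>\<^bsub>B\<^esub> \<one>\<^bsub>B\<^esub>)"
    if "c \<in> carrier K" "d \<in> carrier K" for c d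
    using that comm_monoid.m_comm[OF cring.axioms(2), of K c d] mod_B
    by (simp add: B.smult_assoc1[symmetric] module_def)
  ultimately show ?thesis
    using r counit_closed[OF H] counit_closed[OF L] unfolding trilinear_measuring_def by simp
qed

private lemma conv_eval: "l \<in> carrier L \<Longrightarrow> (\<lambda>\<beta>. \<beta> l) \<in> lin_hom K LB B"
  using lin_hom_eval[OF lin_hom_ident, of l L K B] by (simp add: lin_hom_from_conv_algebra)

text \<open>Evaluation at \<open>l\<close> is linear on the convolution algebra, so it passes under
  the Sweedler sum over \<open>H\<close>; the convolution product under that sum then contributes
  the sum over \<open>L\<close>.\<close>

lemma alg_measuring_conv_trilinear:
  assumes "alg_measuring K H A LB \<sigma>"
  shows "trilinear_measuring K H A L B \<sigma>"
proof -
  note r = assms[unfolded alg_measuring_iff[OF mod_H mod_A]]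
  have b: "bilinear_map K H A LB \<sigma>" using r by blast
  have "\<sigma> h (a \<otimes>\<^bsub>A\<^esub> a') l = tsum K B (\<lambda>x y. tsum K B (\<lambda>u v. \<sigma> x a u \<otimes>\<^bsub>B\<^esub> \<sigma> y a' v) (comult L l)) (comult H h)"
    if h: "h \<in> carrier H" and l: "l \<in> carrier L" and a: "a \<in> carrier A" "a' \<in> carrier A" for h l a a'
  proof -
    have "bilinear_map K H H LB (\<lambda>x y. \<sigma> x a \<otimes>\<^bsub>LB\<^esub> \<sigma> y a')"
      by (intro bilinear_map_mult[OF aLB] bilinear_map_left[OF b] a)
    from tsum_hom[OF mod_H mod_H mod_LB mod_B conv_eval[OF l] this comult_H[OF h]] show ?thesis
      using r h a by (simp add: conv_algebra_simps(5)[OF l])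
  qed
  moreover have "\<sigma> h \<one>\<^bsub>A\<^esub> l = counit H h \<odot>\<^bsub>B\<^esub> (counit L l \<odot>\<^bsub>B\<^esub> \<one>\<^bsub>B\<^esub>)"
    if "h \<in> carrier H" "l \<in> carrier L" for h l
    using r that by (simp add: conv_algebra_simps hom_module_simps)
  ultimately show ?thesis
    unfolding trilinear_measuring_def
    using lin_hom_comp[OF conv_eval bilinear_map_left[OF b]] lin_hom_comp[OF conv_eval bilinear_map_right[OF b]]
      conv_algebra_lin_hom[OF bilinear_map_closed[OF b]]
    by blast
qed

lemma trilinear_alg_measuring_conv:
  assumes "trilinear_measuring K H A L B \<sigma>"
  shows "alg_measuring K H A LB (\<lambda>h. \<lambda>a\<in>carrier A. \<lambda>l\<in>carrier L. \<sigma> h a l)"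
proof -
  note r = assms[unfolded trilinear_measuring_def]
  \<comment> \<open>Two restrictions are needed: in \<open>l\<close>, for the values to lie in the
    convolution algebra, and in \<open>a\<close>, for the measuring to take values in a module of
    extensional maps.\<close>
  define s where "s = (\<lambda>h. \<lambda>a\<in>carrier A. \<lambda>l\<in>carrier L. \<sigma> h a l)"
  have s: "s h a l = \<sigma> h a l" if "a \<in> carrier A" "l \<in> carrier L" for h a l
    using that by (simp add: s_def)
  have lH: "(\<lambda>h. \<sigma> h a l) \<in> lin_hom K H B" if "a \<in> carrier A" "l \<in> carrier L" for a l using r that by blast
  have lA: "(\<lambda>a. \<sigma> h a l) \<in> lin_hom K A B" if "h \<in> carrier H" "l \<in> carrier L" for h l using r that by blast
  have lL: "\<sigma> h a \<in> lin_hom K L B" if "h \<in> carrier H" "a \<in> carrier A" for h a using r that by blast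
  have sc: "s h a \<in> carrier LB" if "h \<in> carrier H" "a \<in> carrier A" for h a
    using that by (simp add: s_def conv_algebra_memI[OF mod_L lL])
  have sb: "bilinear_map K H A LB s"
  proof (intro bilinear_mapI)
    fix h assume h: "h \<in> carrier H"
    have "bilinear_map K A L B (s h)"
      by (rule bilinear_map_cong[OF mod_A mod_L bilinear_mapI[OF lL[OF h] lA[OF h]]]) (simp_all add: s)
    then show "s h \<in> lin_hom K A LB"
      by (simp add: lin_hom_conv_algebra lin_hom_hom_module_iff[OF mod_A mod_L] s_def)
  next
    fix a assume a: "a \<in> carrier A"
    have "bilinear_map K H L B (\<lambda>h. s h a)"
      by (rule bilinear_map_cong[OF mod_H mod_L bilinear_mapI[OF lL[OF _ a] lH[OF a]]]) (simp_all add: s a)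
    then show "(\<lambda>h. s h a) \<in> lin_hom K H LB"
      using a by (simp add: lin_hom_conv_algebra lin_hom_hom_module_iff[OF mod_H mod_L] s_def)
  qed
  have "s h (a \<otimes>\<^bsub>A\<^esub> a') = tsum K LB (\<lambda>x y. s x a \<otimes>\<^bsub>LB\<^esub> s y a') (comult H h)"
    if h: "h \<in> carrier H" and a: "a \<in> carrier A" "a' \<in> carrier A" for h a a'
  proof -
    have bs: "bilinear_map K H H LB (\<lambda>x y. s x a \<otimes>\<^bsub>LB\<^esub> s y a')"
      by (intro bilinear_map_mult[OF aLB] bilinear_map_left[OF sb] a)
    show ?thesis
    proof (rule conv_algebra_eqI[OF sc[OF h A.m_closed[OF a]] tsum_closed[OF mod_H mod_H mod_LB bs comult_H[OF h]]])
      fix l assume l: "l \<in> carrier L"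
      have "s h (a \<otimes>\<^bsub>A\<^esub> a') l =
          tsum K B (\<lambda>x y. tsum K B (\<lambda>u v. \<sigma> x a u \<otimes>\<^bsub>B\<^esub> \<sigma> y a' v) (comult L l)) (comult H h)"
        using r h a l by (simp add: s)
      also have "\<dots> = tsum K B (\<lambda>x y. (s x a \<otimes>\<^bsub>LB\<^esub> s y a') l) (comult H h)"
      proof (rule tsum_cong[OF mod_H mod_H mod_B bilinear_map_comp[OF conv_eval[OF l] bs] comult_H[OF h]])
        fix x y assume xy: "x \<in> carrier H" "y \<in> carrier H"
        note lin = conv_algebra_lin_hom[OF sc[OF xy(1) a(1)]] conv_algebra_lin_hom[OF sc[OF xy(2) a(2)]]
        show "tsum K B (\<lambda>u v. \<sigma> x a u \<otimes>\<^bsub>B\<^esub> \<sigma> y a' v) (comult L l) = (s x a \<otimes>\<^bsub>LB\<^esub> s y a') l"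
          unfolding conv_algebra_simps(5)[OF l]
          by (rule tsum_cong[OF mod_L mod_L mod_B bilinear_map_mult[OF B lin] comult_L[OF l]]) (simp add: s a)
      qed
      also have "\<dots> = tsum K LB (\<lambda>x y. s x a \<otimes>\<^bsub>LB\<^esub> s y a') (comult H h) l"
        by (rule tsum_hom[OF mod_H mod_H mod_LB mod_B conv_eval[OF l] bs comult_H[OF h], symmetric])
      finally show "s h (a \<otimes>\<^bsub>A\<^esub> a') l = \<dots>" .
    qed
  qed
  moreover have "s h \<one>\<^bsub>A\<^esub> = counit H h \<odot>\<^bsub>LB\<^esub> \<one>\<^bsub>LB\<^esub>" if h: "h \<in> carrier H" for h
    by (rule conv_algebra_eqI[OF sc[OF h A.one_closed] LB.smult_closed[OF counit_closed[OF H h] LB.one_closed]])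
      (use r h in \<open>simp add: s conv_algebra_simps hom_module_simps\<close>)
  ultimately have "alg_measuring K H A LB s"
    unfolding alg_measuring_iff[OF mod_H mod_A] using sb by (simp add: s_def)
  then show ?thesis unfolding s_def .
qed

end

text \<open>The trilinear form treats the two coalgebras alike. This is the bridge between
  measurings \<open>L -> Hom(A, [H, B])\<close>, which the Sweedler product represents, and
  measurings \<open>H -> Hom(A, [L, B])\<close>.\<close>

lemma alg_measuring_conv_swap:
  assumes "coalgebra K H" and "coalgebra K L" and "assoc_algebra K A" and "assoc_algebra K B"
    and "alg_measuring K L A (conv_algebra K H B) \<tau>"
  shows "alg_measuring K H A (conv_algebra K L B) (\<lambda>h. \<lambda>a\<in>carrier A. \<lambda>l\<in>carrier L. \<tau> l a h)"
  by (rule trilinear_alg_measuring_conv[OF assms(1-4)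
        trilinear_measuring_swap[OF assms(2,1,3,4) alg_measuring_conv_trilinear[OF assms(2,1,3-5)]]])

section \<open>Coalgebra maps and tensor products of coalgebras\<close>

text \<open>The tensor product reads only carriers, additions and scalar actions. Consequently
  \<open>tensor_coalg\<close> and the plain \<open>tensor_module\<close> have literally equal tensor
  products, and no isomorphism between them has to be carried along.\<close>

lemma tensor_module_cong:
  assumes "carrier V = carrier V'" "add V = add V'" "smult V = smult V'"
    and "carrier W = carrier W'" "add W = add W'" "smult W = smult W'"
  shows "tensor_module K V W = tensor_module K V' W'" and "tens K V W = tens K V' W'"
proof -
  have "tensor_null K V W = tensor_null K V' W'"
    by (simp add: tensor_null_def tensor_relations_def assms)
  then show "tensor_module K V W = tensor_module K V' W'" "tens K V W = tens K V' W'"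
    by (simp_all add: tensor_module_def tens_def assms fun_eq_iff)
qed

lemma tsum_record_cong:
  assumes "carrier U = carrier U'" "add U = add U'" "zero U = zero U'" "smult U = smult U'"
  shows "tsum K U \<beta> X = tsum K U' \<beta> X"
  by (simp add: tsum_def finsum_def finprod_def assms)

lemma tensor_coalg_simps:
  "carrier (tensor_coalg K L H) = carrier (tensor_module K L H)"
  "add (tensor_coalg K L H) = add (tensor_module K L H)"
  "zero (tensor_coalg K L H) = zero (tensor_module K L H)"
  "smult (tensor_coalg K L H) = smult (tensor_module K L H)"
  by (simp_all add: tensor_coalg_def Let_def module.extend_def)

lemma tensor_coalg_tensor:
  "tensor_module K M (tensor_coalg K L H) = tensor_module K M (tensor_module K L H)"
  "tens K M (tensor_coalg K L H) = tens K M (tensor_module K L H)"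
  "tensor_module K (tensor_coalg K L H) M = tensor_module K (tensor_module K L H) M"
  "tens K (tensor_coalg K L H) M = tens K (tensor_module K L H) M"
  "tsum K (tensor_coalg K L H) \<beta> X = tsum K (tensor_module K L H) \<beta> X"
  "lin_hom K (tensor_coalg K L H) Z = lin_hom K (tensor_module K L H) Z"
  "lin_hom K Z (tensor_coalg K L H) = lin_hom K Z (tensor_module K L H)"
  by ((rule tensor_module_cong tsum_record_cong; simp add: tensor_coalg_simps; fail)+)
    (simp_all add: tensor_coalg_simps lin_hom_def)

lemma comult_tensor_coalg: "comult (tensor_coalg K L H) =
    (let T = tensor_module K L H; TT = tensor_module K T T in
      tsum K TT (\<lambda>l h. tsum K TT (\<lambda>l' l''. tsum K TT (\<lambda>h' h''.
           tens K T T (tens K L H l' h') (tens K L H l'' h'')) (comult H h)) (comult L l)))"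
  and counit_tensor_coalg: "counit (tensor_coalg K L H) =
    tsum K (ground_module K) (\<lambda>l h. counit L l \<otimes>\<^bsub>K\<^esub> counit H h)"
  by (simp_all add: tensor_coalg_def Let_def module.extend_def coalg.fields_def)

section \<open>Coalgebra maps\<close>

lemma coalg_hom_lin_hom: "u \<in> coalg_hom K H D \<Longrightarrow> u \<in> lin_hom K H D"
  and coalg_hom_comult: "u \<in> coalg_hom K H D \<Longrightarrow> h \<in> carrier H \<Longrightarrow>
    comult D (u h) = tsum K (tensor_module K D D) (\<lambda>x y. tens K D D (u x) (u y)) (comult H h)"
  and coalg_hom_counit: "u \<in> coalg_hom K H D \<Longrightarrow> h \<in> carrier H \<Longrightarrow> counit D (u h) = counit H h"
  by (auto simp: coalg_hom_def)

lemma coalg_hom_closed: "u \<in> coalg_hom K H D \<Longrightarrow> h \<in> carrier H \<Longrightarrow> u h \<in> carrier D"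
  by (rule lin_hom_closed[OF coalg_hom_lin_hom])

lemma bilinear_map_comp2:
  assumes "bilinear_map K V W U \<beta>" "f \<in> lin_hom K V' V" "g \<in> lin_hom K W' W"
  shows "bilinear_map K V' W' U (\<lambda>x y. \<beta> (f x) (g y))"
  by (intro bilinear_mapI lin_hom_comp[OF bilinear_map_right[OF assms(1)] assms(3)]
      lin_hom_comp[OF bilinear_map_left[OF assms(1)] assms(2)]
      lin_hom_closed[OF assms(2)] lin_hom_closed[OF assms(3)])

text \<open>Apply the linear map induced by \<beta> to the comultiplication law of \<open>u\<close>.
  In Sweedler notation, the two parts of \<open>u h\<close> are the images of the two parts of
  \<open>h\<close>.\<close>

lemma sweedler_coalg_hom:
  assumes H: "coalgebra K H" and D: "coalgebra K D" and U: "module K U"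
    and u: "u \<in> coalg_hom K H D" and b: "bilinear_map K D D U \<beta>" and h: "h \<in> carrier H"
  shows "tsum K U \<beta> (comult D (u h)) = tsum K U (\<lambda>x y. \<beta> (u x) (u y)) (comult H h)"
proof -
  note mH = coalgebra_module[OF H] and mD = coalgebra_module[OF D]
  note mDD = module_tensor_module[OF mD mD]
  note l = coalg_hom_lin_hom[OF u]
  have bt: "bilinear_map K H H (tensor_module K D D) (\<lambda>x y. tens K D D (u x) (u y))"
    by (rule bilinear_map_comp2[OF tens_bilinear[OF mD mD] l l])
  have "tsum K U \<beta> (comult D (u h)) =
      tsum K U (\<lambda>x y. tsum K U \<beta> (tens K D D (u x) (u y))) (comult H h)"
    unfolding coalg_hom_comult[OF u h]
    by (rule tsum_hom[OF mH mH mDD U tsum_lin_hom[OF mD mD U b] bt comult_closed[OF H h]])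
  also have "\<dots> = tsum K U (\<lambda>x y. \<beta> (u x) (u y)) (comult H h)"
    by (rule tsum_cong[OF mH mH U bilinear_map_comp2[OF b l l] comult_closed[OF H h]])
      (simp add: tsum_tens[OF mD mD U b] lin_hom_closed[OF l])
  finally show ?thesis .
qed

lemma coalg_hom_comp:
  assumes H: "coalgebra K H" and D: "coalgebra K D" and E: "coalgebra K E"
    and v: "v \<in> coalg_hom K D E" and u: "u \<in> coalg_hom K H D"
  shows "(\<lambda>h. v (u h)) \<in> coalg_hom K H E"
proof -
  note mE = coalgebra_module[OF E]
  note lv = coalg_hom_lin_hom[OF v] and lu = coalg_hom_lin_hom[OF u]
  have "bilinear_map K D D (tensor_module K E E) (\<lambda>x y. tens K E E (v x) (v y))"
    by (rule bilinear_map_comp2[OF tens_bilinear[OF mE mE] lv lv])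
  note s = sweedler_coalg_hom[OF H D module_tensor_module[OF mE mE] u this]
  show ?thesis unfolding coalg_hom_def
    using s lin_hom_comp[OF lv lu] lin_hom_closed[OF lu]
    by (simp add: coalg_hom_comult[OF v] coalg_hom_counit[OF v] coalg_hom_counit[OF u])
qed

lemma coalg_hom_cong:
  assumes H: "coalgebra K H" and D: "coalgebra K D" and u: "u \<in> coalg_hom K H D"
    and e: "\<And>h. h \<in> carrier H \<Longrightarrow> v h = u h"
  shows "v \<in> coalg_hom K H D"
proof -
  note mH = coalgebra_module[OF H] and mD = coalgebra_module[OF D]
  note l = coalg_hom_lin_hom[OF u]
  have "tsum K (tensor_module K D D) (\<lambda>x y. tens K D D (v x) (v y)) (comult H h) =
      tsum K (tensor_module K D D) (\<lambda>x y. tens K D D (u x) (u y)) (comult H h)" if "h \<in> carrier H" for h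
    by (rule tsum_cong[OF mH mH module_tensor_module[OF mD mD]
          bilinear_map_comp2[OF tens_bilinear[OF mD mD] l l] comult_closed[OF H that]]) (simp add: e)
  then show ?thesis
    using lin_hom_cong[OF mH l e] u by (simp add: coalg_hom_def e)
qed

lemma coalg_hom_ident:
  assumes H: "coalgebra K H"
  shows "(\<lambda>h. h) \<in> coalg_hom K H H"
proof -
  note mH = coalgebra_module[OF H] and mHH = module_tensor_module[OF coalgebra_module[OF H] coalgebra_module[OF H]]
  \<comment> \<open>The identity is the linear map induced by \<open>tens\<close>, so a
    comultiplication is the Sweedler sum of its own pure tensors.\<close>
  have "X = tsum K (tensor_module K H H) (tens K H H) X" if "X \<in> carrier (tensor_module K H H)" for X
    by (rule tsum_unique[OF mH mH mHH lin_hom_ident tens_bilinear[OF mH mH] _ that]) simp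
  then show ?thesis by (simp add: coalg_hom_def lin_hom_ident comult_closed[OF H])
qed

section \<open>The tensor product of two coalgebras\<close>

context
  fixes K :: "('k, 'z) ring_scheme" and L :: "('k, 'l, 'm) coalg_scheme" and H :: "('k, 'h, 'n) coalg_scheme"
  assumes L: "coalgebra K L" and H: "coalgebra K H"
begin

private lemmas mL = coalgebra_module[OF L] and mH = coalgebra_module[OF H]
private lemmas mT = module_tensor_module[OF mL mH]
private lemmas cL = comult_closed[OF L] and cH = comult_closed[OF H]
private lemmas tl = tens_closed[OF mL mH]

private abbreviation (input) "T \<equiv> tensor_module K L H"
private abbreviation (input) "C \<equiv> tensor_coalg K L H"
text \<open>The Sweedler sum belonging to the pure tensor of \<open>l\<close> and \<open>h\<close>.
  The argument order of \<theta> groups the two left parts and then the two right parts, as the flip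
  in the tensor comultiplication does.\<close>

private abbreviation (input) "dsum U \<theta> l h \<equiv>
  tsum K U (\<lambda>l' l''. tsum K U (\<lambda>h' h''. \<theta> l' h' l'' h'') (comult H h)) (comult L l)"

private lemma mTT: "module K (tensor_module K T T)"
  by (rule module_tensor_module[OF mT mT])

lemma double_sweedler_bilinear:
  assumes U: "module K U"
    and "\<And>l' l''. l' \<in> carrier L \<Longrightarrow> l'' \<in> carrier L \<Longrightarrow> bilinear_map K H H U (\<lambda>h' h''. \<theta> l' h' l'' h'')"
    and "\<And>h' h''. h' \<in> carrier H \<Longrightarrow> h'' \<in> carrier H \<Longrightarrow> bilinear_map K L L U (\<lambda>l' l''. \<theta> l' h' l'' h'')"
  shows "bilinear_map K L H U (dsum U \<theta>)"
    and "h \<in> carrier H \<Longrightarrow> bilinear_map K L L U (\<lambda>l' l''. tsum K U (\<lambda>h' h''. \<theta> l' h' l'' h'') (comult H h))"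
proof -
  show *: "bilinear_map K L L U (\<lambda>l' l''. tsum K U (\<lambda>h' h''. \<theta> l' h' l'' h'') (comult H h))"
    if "h \<in> carrier H" for h
    by (intro bilinear_mapI lin_hom_tsum_param[OF mH mH U mL cH[OF that]] assms
        bilinear_map_right[OF assms(3)] bilinear_map_left[OF assms(3)])
  show "bilinear_map K L H U (dsum U \<theta>)"
    by (intro bilinear_mapI sweedler_lin_hom[OF L U] * lin_hom_tsum_param[OF mL mL U mH] cL
        sweedler_lin_hom[OF H U] assms)
qed

context
  fixes U :: "('k, 'u, 'o) module_scheme" and \<beta>
  assumes U: "module K U" and \<beta>: "bilinear_map K T T U \<beta>"
begin

lemma tensor_bilinear_right:
  "l' \<in> carrier L \<Longrightarrow> l'' \<in> carrier L \<Longrightarrow>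
    bilinear_map K H H U (\<lambda>h' h''. \<beta> (tens K L H l' h') (tens K L H l'' h''))"
  by (intro bilinear_map_comp2[OF \<beta>] lin_hom_tens_right[OF mL mH] lin_hom_ident)

lemma tensor_bilinear_left:
  "h' \<in> carrier H \<Longrightarrow> h'' \<in> carrier H \<Longrightarrow>
    bilinear_map K L L U (\<lambda>l' l''. \<beta> (tens K L H l' h') (tens K L H l'' h''))"
  by (intro bilinear_map_comp2[OF \<beta>] lin_hom_tens_left[OF mL mH] lin_hom_ident)

end

private lemmas tens_TT = tens_bilinear[OF mT mT]

private lemma dsum_bil:
  assumes U: "module K U" and \<beta>: "bilinear_map K T T U \<beta>"
  shows "bilinear_map K L H U (dsum U (\<lambda>l' h' l'' h''. \<beta> (tens K L H l' h') (tens K L H l'' h'')))"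
    and "h \<in> carrier H \<Longrightarrow> bilinear_map K L L U
      (\<lambda>l' l''. tsum K U (\<lambda>h' h''. \<beta> (tens K L H l' h') (tens K L H l'' h'')) (comult H h))"
  by (intro double_sweedler_bilinear tensor_bilinear_right tensor_bilinear_left U \<beta>; assumption)+

lemma comult_tensor_coalg_tens:
  assumes "l \<in> carrier L" "h \<in> carrier H"
  shows "comult C (tens K L H l h) =
    dsum (tensor_module K T T) (\<lambda>l' h' l'' h''. tens K T T (tens K L H l' h') (tens K L H l'' h'')) l h"
  unfolding comult_tensor_coalg Let_def
  by (rule tsum_tens[OF mL mH mTT dsum_bil(1)[OF mTT tens_TT] assms])

lemma counit_tensor_coalg_bilinear:
  "bilinear_map K L H (ground_module K) (\<lambda>l h. counit L l \<otimes>\<^bsub>K\<^esub> counit H h)"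
proof -
  interpret L: coalgebra K L by (rule L)
  note g = module_ground_module[OF L.R.is_cring]
  have e: "(\<lambda>l. counit L l \<otimes>\<^bsub>K\<^esub> c) = (\<lambda>l. counit L l \<odot>\<^bsub>ground_module K\<^esub> c)"
    "(\<lambda>h. c \<otimes>\<^bsub>K\<^esub> counit H h) = (\<lambda>h. c \<odot>\<^bsub>ground_module K\<^esub> counit H h)" for c
    by (simp_all add: ground_module_simps)
  show ?thesis
    by (intro bilinear_mapI; unfold e;
        intro lin_hom_scalar[OF g] lin_hom_scale[OF g] coalgebra.counit_linear L H counit_closed[OF L])
      (simp_all add: ground_module_simps counit_closed[OF H])
qed

lemma counit_tensor_coalg_tens:
  assumes "l \<in> carrier L" "h \<in> carrier H"
  shows "counit C (tens K L H l h) = counit L l \<otimes>\<^bsub>K\<^esub> counit H h"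
proof -
  interpret L: coalgebra K L by (rule L)
  show ?thesis unfolding counit_tensor_coalg
    by (rule tsum_tens[OF mL mH module_ground_module[OF L.R.is_cring] counit_tensor_coalg_bilinear assms])
qed

lemma comult_tensor_coalg_lin_hom: "comult C \<in> lin_hom K T (tensor_module K T T)"
  unfolding comult_tensor_coalg Let_def
  by (rule tsum_lin_hom[OF mL mH mTT dsum_bil(1)[OF mTT tens_TT]])

lemma counit_tensor_coalg_lin_hom: "counit C \<in> lin_hom K T (ground_module K)"
proof -
  interpret L: coalgebra K L by (rule L)
  show ?thesis unfolding counit_tensor_coalg
    by (rule tsum_lin_hom[OF mL mH module_ground_module[OF L.R.is_cring] counit_tensor_coalg_bilinear])
qed

text \<open>On a pure tensor the comultiplication is an iterated sum over the two coalgebras, and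
  the linear map induced by \<beta> passes under both sums. Computations in the tensor coalgebra
  thereby become computations in its two factors.\<close>

lemma sweedler_tensor_coalg_tens:
  assumes U: "module K U" and \<beta>: "bilinear_map K T T U \<beta>" and l: "l \<in> carrier L" and h: "h \<in> carrier H"
  shows "tsum K U \<beta> (comult C (tens K L H l h)) =
    dsum U (\<lambda>l' h' l'' h''. \<beta> (tens K L H l' h') (tens K L H l'' h'')) l h"
proof -
  note b = tsum_lin_hom[OF mT mT U \<beta>]
  note r = tensor_bilinear_right[OF mTT tens_TT]
  note d = dsum_bil(2)[OF mTT tens_TT h]
  let ?t = "\<lambda>l' h' l'' h''. tens K T T (tens K L H l' h') (tens K L H l'' h'')"
  have "tsum K U \<beta> (comult C (tens K L H l h)) =
      tsum K U (\<lambda>l' l''. tsum K U \<beta> (tsum K (tensor_module K T T) (\<lambda>h' h''. ?t l' h' l'' h'') (comult H h))) (comult L l)"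
    unfolding comult_tensor_coalg_tens[OF l h] by (rule tsum_hom[OF mL mL mTT U b d cL[OF l]])
  also have "\<dots> = dsum U (\<lambda>l' h' l'' h''. \<beta> (tens K L H l' h') (tens K L H l'' h'')) l h"
  proof (rule tsum_cong[OF mL mL U dsum_bil(2)[OF U \<beta> h] cL[OF l]])
    fix l' l'' assume a: "l' \<in> carrier L" "l'' \<in> carrier L"
    have "tsum K U \<beta> (tsum K (tensor_module K T T) (\<lambda>h' h''. ?t l' h' l'' h'') (comult H h)) =
        tsum K U (\<lambda>h' h''. tsum K U \<beta> (?t l' h' l'' h'')) (comult H h)"
      by (rule tsum_hom[OF mH mH mTT U b r[OF a] cH[OF h]])
    also have "\<dots> = tsum K U (\<lambda>h' h''. \<beta> (tens K L H l' h') (tens K L H l'' h'')) (comult H h)"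
      using a by (intro tsum_cong[OF mH mH U tensor_bilinear_right[OF U \<beta> a] cH[OF h]])
        (simp add: tsum_tens[OF mT mT U \<beta>] tl)
    finally show "tsum K U \<beta> (tsum K (tensor_module K T T) (\<lambda>h' h''. ?t l' h' l'' h'') (comult H h)) = \<dots>" .
  qed
  finally show ?thesis .
qed

text \<open>Coassociativity of the tensor coalgebra, stated for an arbitrary expression \<theta>
  linear in each of its six variables. The four sums alternate between the coalgebras; after
  interchange they are grouped so that coassociativity of each factor applies separately.\<close>

private lemma double_sweedler_coassoc:
  assumes U: "module K U" and l: "l \<in> carrier L" and h: "h \<in> carrier H"
    and lin: "\<And>b u v w z. b \<in> carrier H \<Longrightarrow> u \<in> carrier L \<Longrightarrow> v \<in> carrier H \<Longrightarrow> w \<in> carrier L \<Longrightarrow> z \<in> carrier H \<Longrightarrow>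
        (\<lambda>a. \<theta> a b u v w z) \<in> lin_hom K L U"
      "\<And>a u v w z. a \<in> carrier L \<Longrightarrow> u \<in> carrier L \<Longrightarrow> v \<in> carrier H \<Longrightarrow> w \<in> carrier L \<Longrightarrow> z \<in> carrier H \<Longrightarrow>
        (\<lambda>b. \<theta> a b u v w z) \<in> lin_hom K H U"
      "\<And>a b v w z. a \<in> carrier L \<Longrightarrow> b \<in> carrier H \<Longrightarrow> v \<in> carrier H \<Longrightarrow> w \<in> carrier L \<Longrightarrow> z \<in> carrier H \<Longrightarrow>
        (\<lambda>u. \<theta> a b u v w z) \<in> lin_hom K L U"
      "\<And>a b u w z. a \<in> carrier L \<Longrightarrow> b \<in> carrier H \<Longrightarrow> u \<in> carrier L \<Longrightarrow> w \<in> carrier L \<Longrightarrow> z \<in> carrier H \<Longrightarrow>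
        (\<lambda>v. \<theta> a b u v w z) \<in> lin_hom K H U"
      "\<And>a b u v z. a \<in> carrier L \<Longrightarrow> b \<in> carrier H \<Longrightarrow> u \<in> carrier L \<Longrightarrow> v \<in> carrier H \<Longrightarrow> z \<in> carrier H \<Longrightarrow>
        (\<lambda>w. \<theta> a b u v w z) \<in> lin_hom K L U"
      "\<And>a b u v w. a \<in> carrier L \<Longrightarrow> b \<in> carrier H \<Longrightarrow> u \<in> carrier L \<Longrightarrow> v \<in> carrier H \<Longrightarrow> w \<in> carrier L \<Longrightarrow>
        (\<lambda>z. \<theta> a b u v w z) \<in> lin_hom K H U"
  shows "dsum U (\<lambda>a b k g. dsum U (\<lambda>u v w z. \<theta> a b u v w z) k g) l h =
    dsum U (\<lambda>k g w z. dsum U (\<lambda>a b u v. \<theta> a b u v w z) k g) l h"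
proof -
  let ?L = "tsum K U" and ?cL = "comult L" and ?cH = "comult H"
  \<comment> \<open>Every side condition asks for linearity of a partial sum in one variable. That
    variable is either the element being comultiplied or a parameter of the summand, and these rules
    cover both cases for both coalgebras.\<close>
  note multi = bilinear_mapI sweedler_lin_hom[OF L U] sweedler_lin_hom[OF H U]
    lin_hom_tsum_param[OF mL mL U mL] lin_hom_tsum_param[OF mH mH U mH]
    lin_hom_tsum_param[OF mL mL U mH] lin_hom_tsum_param[OF mH mH U mL] cL cH lin
  \<comment> \<open>The two middle sums are interchanged, which brings both sums over
    \<open>L\<close> to the outside.\<close>
  have "dsum U (\<lambda>a b k g. dsum U (\<lambda>u v w z. \<theta> a b u v w z) k g) l h =
      ?L (\<lambda>a k. ?L (\<lambda>u w. ?L (\<lambda>b g. ?L (\<lambda>v z. \<theta> a b u v w z) (?cH g)) (?cH h)) (?cL k)) (?cL l)"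
  proof (rule tsum_cong[OF mL mL U _ cL[OF l]])
    show "bilinear_map K L L U (\<lambda>a k. ?L (\<lambda>u w. ?L (\<lambda>b g. ?L (\<lambda>v z. \<theta> a b u v w z) (?cH g)) (?cH h)) (?cL k))"
      using h by (intro multi)
    show "?L (\<lambda>b g. ?L (\<lambda>u w. ?L (\<lambda>v z. \<theta> a b u v w z) (?cH g)) (?cL k)) (?cH h) =
        ?L (\<lambda>u w. ?L (\<lambda>b g. ?L (\<lambda>v z. \<theta> a b u v w z) (?cH g)) (?cH h)) (?cL k)"
      if "a \<in> carrier L" "k \<in> carrier L" for a k
      using that by (intro tsum_swap[OF mH mH mL mL U cH[OF h]] multi)
  qed
  \<comment> \<open>Coassociativity of \<open>H\<close>, applied inside the two sums over
    \<open>L\<close>.\<close>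
  also have "\<dots> = ?L (\<lambda>a k. ?L (\<lambda>u w. ?L (\<lambda>g z. ?L (\<lambda>b v. \<theta> a b u v w z) (?cH g)) (?cH h)) (?cL k)) (?cL l)"
  proof (rule tsum_cong[OF mL mL U _ cL[OF l]])
    show "bilinear_map K L L U (\<lambda>a k. ?L (\<lambda>u w. ?L (\<lambda>g z. ?L (\<lambda>b v. \<theta> a b u v w z) (?cH g)) (?cH h)) (?cL k))"
      using h by (intro multi)
    fix a k assume ak: "a \<in> carrier L" "k \<in> carrier L"
    show "?L (\<lambda>u w. ?L (\<lambda>b g. ?L (\<lambda>v z. \<theta> a b u v w z) (?cH g)) (?cH h)) (?cL k) =
       ?L (\<lambda>u w. ?L (\<lambda>g z. ?L (\<lambda>b v. \<theta> a b u v w z) (?cH g)) (?cH h)) (?cL k)"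
    proof (rule tsum_cong[OF mL mL U _ cL[OF ak(2)]])
      show "bilinear_map K L L U (\<lambda>u w. ?L (\<lambda>g z. ?L (\<lambda>b v. \<theta> a b u v w z) (?cH g)) (?cH h))"
        using h ak by (intro multi)
      show "?L (\<lambda>b g. ?L (\<lambda>v z. \<theta> a b u v w z) (?cH g)) (?cH h) =
          ?L (\<lambda>g z. ?L (\<lambda>b v. \<theta> a b u v w z) (?cH g)) (?cH h)"
        if "u \<in> carrier L" "w \<in> carrier L" for u w
        using ak that by (intro sweedler_coassoc[OF H U h] multi)
    qed
  qed
  \<comment> \<open>Coassociativity of \<open>L\<close>, with both sums over \<open>H\<close> as
    part of the summand.\<close>
  also have "\<dots> = ?L (\<lambda>k w. ?L (\<lambda>a u. ?L (\<lambda>g z. ?L (\<lambda>b v. \<theta> a b u v w z) (?cH g)) (?cH h)) (?cL k)) (?cL l)"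
    using h by (intro sweedler_coassoc[OF L U l] multi)
  \<comment> \<open>The middle sums are interchanged back to restore the alternation.\<close>
  also have "\<dots> = dsum U (\<lambda>k g w z. dsum U (\<lambda>a b u v. \<theta> a b u v w z) k g) l h"
  proof (rule tsum_cong[OF mL mL U _ cL[OF l]])
    show "bilinear_map K L L U (\<lambda>k w. ?L (\<lambda>g z. ?L (\<lambda>a u. ?L (\<lambda>b v. \<theta> a b u v w z) (?cH g)) (?cL k)) (?cH h))"
      using h by (intro multi)
    show "?L (\<lambda>a u. ?L (\<lambda>g z. ?L (\<lambda>b v. \<theta> a b u v w z) (?cH g)) (?cH h)) (?cL k) =
        ?L (\<lambda>g z. ?L (\<lambda>a u. ?L (\<lambda>b v. \<theta> a b u v w z) (?cH g)) (?cL k)) (?cH h)"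
      if "k \<in> carrier L" "w \<in> carrier L" for k w
      using that by (intro tsum_swap[OF mL mL mH mH U _ cH[OF h]] multi)
  qed
  finally show ?thesis .
qed

private lemma double_sweedler_cong:
  assumes U: "module K U" and l: "l \<in> carrier L" and h: "h \<in> carrier H"
    and b: "\<And>l' l''. l' \<in> carrier L \<Longrightarrow> l'' \<in> carrier L \<Longrightarrow> bilinear_map K H H U (\<lambda>h' h''. \<theta> l' h' l'' h'')"
      "\<And>h' h''. h' \<in> carrier H \<Longrightarrow> h'' \<in> carrier H \<Longrightarrow> bilinear_map K L L U (\<lambda>l' l''. \<theta> l' h' l'' h'')"
    and e: "\<And>l' h' l'' h''. l' \<in> carrier L \<Longrightarrow> h' \<in> carrier H \<Longrightarrow> l'' \<in> carrier L \<Longrightarrow> h'' \<in> carrier H \<Longrightarrow>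
      \<eta> l' h' l'' h'' = \<theta> l' h' l'' h''"
  shows "dsum U \<eta> l h = dsum U \<theta> l h"
proof (rule tsum_cong[OF mL mL U double_sweedler_bilinear(2)[OF U b h] cL[OF l]])
  fix l' l'' assume a: "l' \<in> carrier L" "l'' \<in> carrier L"
  show "tsum K U (\<lambda>h' h''. \<eta> l' h' l'' h'') (comult H h) = tsum K U (\<lambda>h' h''. \<theta> l' h' l'' h'') (comult H h)"
    using a by (intro tsum_cong[OF mH mH U b(1)[OF a] cH[OF h]] e)
qed

text \<open>All three axioms equate linear maps on the tensor module, so pure tensors suffice; there
  each axiom reduces to the corresponding one of the two factors.\<close>

lemma coalgebra_tensor_coalg: "coalgebra K C"
proof -
  interpret L: coalgebra K L by (rule L)
  let ?TT = "tensor_module K T T" and ?T3 = "tensor_module K T (tensor_module K T T)"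
  let ?t = "tens K L H" and ?t2 = "tens K T T" and ?t3 = "tens K T (tensor_module K T T)"
  note mT3 = module_tensor_module[OF mT mTT]
  note cl = comult_tensor_coalg_lin_hom and el = counit_tensor_coalg_lin_hom
  note cc = lin_hom_closed[OF cl]
  have ec: "counit C X \<in> carrier K" if "X \<in> carrier T" for X
    using lin_hom_closed[OF el that] by (simp add: ground_module_simps)
  have sl: "(\<lambda>X. tsum K U \<beta> (comult C X)) \<in> lin_hom K T U"
    if "module K U" "bilinear_map K T T U \<beta>" for \<beta> and U :: "('k, 'u, 'o) module_scheme"
    by (rule lin_hom_comp[OF tsum_lin_hom[OF mT mT that] cl])
  have tri: "bilinear_map K T T ?T3 (\<lambda>u v. ?t3 u (?t2 v y))" if "y \<in> carrier T" for y
    by (intro bilinear_mapI lin_hom_tens_right[OF mT mTT] lin_hom_tens_left[OF mT mT]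
        lin_hom_tens_left[OF mT mTT] lin_hom_ident tens_closed[OF mT mT] that)
  have tri': "bilinear_map K T T ?T3 (\<lambda>u v. ?t3 x (?t2 u v))" if "x \<in> carrier T" for x
    by (intro bilinear_mapI lin_hom_tens_right[OF mT mTT] lin_hom_tens_left[OF mT mT]
        lin_hom_tens_right[OF mT mT] lin_hom_ident that)
  have b1: "bilinear_map K T T ?T3 (\<lambda>x y. ?t3 x (comult C y))"
    by (intro bilinear_mapI lin_hom_tens_right[OF mT mTT] lin_hom_tens_left[OF mT mTT] cl cc lin_hom_ident)
  have b2: "bilinear_map K T T ?T3 (\<lambda>x y. tsum K ?T3 (\<lambda>u v. ?t3 u (?t2 v y)) (comult C x))"
    by (intro bilinear_mapI sl[OF mT3] tri lin_hom_tsum_param[OF mT mT mT3 mT] cc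
        lin_hom_tens_right[OF mT mTT] lin_hom_tens_right[OF mT mT] lin_hom_ident)
  have coassoc: "tsum K ?T3 (\<lambda>x y. ?t3 x (comult C y)) (comult C X) =
      tsum K ?T3 (\<lambda>x y. tsum K ?T3 (\<lambda>u v. ?t3 u (?t2 v y)) (comult C x)) (comult C X)"
    if X: "X \<in> carrier T" for X
  proof (rule tensor_hom_eq[OF mL mH mT3 sl[OF mT3 b1] sl[OF mT3 b2] _ X])
    fix l h assume l: "l \<in> carrier L" and h: "h \<in> carrier H"
    let ?\<theta> = "\<lambda>a b u v w z. ?t3 (?t a b) (?t2 (?t u v) (?t w z))"
    have "tsum K ?T3 (\<lambda>x y. ?t3 x (comult C y)) (comult C (?t l h)) =
        dsum ?T3 (\<lambda>a b k g. ?t3 (?t a b) (comult C (?t k g))) l h"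
      by (rule sweedler_tensor_coalg_tens[OF mT3 b1 l h])
    also have "\<dots> = dsum ?T3 (\<lambda>a b k g. dsum ?T3 (\<lambda>u v w z. ?\<theta> a b u v w z) k g) l h"
    proof (rule double_sweedler_cong[OF mT3 l h tensor_bilinear_right[OF mT3 b1] tensor_bilinear_left[OF mT3 b1], symmetric])
      fix a b k g assume a: "a \<in> carrier L" "b \<in> carrier H" "k \<in> carrier L" "g \<in> carrier H"
      \<comment> \<open>Tensoring with a fixed element is linear and hence a Sweedler sum of its
        values on pure tensors. At a comultiplication this exposes the inner double sum.\<close>
      have "?t3 (?t a b) Y = tsum K ?T3 (\<lambda>x y. ?t3 (?t a b) (?t2 x y)) Y" if "Y \<in> carrier ?TT" for Y
        by (rule tsum_unique[OF mT mT mT3 bilinear_map_right[OF tens_bilinear[OF mT mTT] tl[OF a(1,2)]]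
              tri'[OF tl[OF a(1,2)]] _ that]) simp
      then show "dsum ?T3 (\<lambda>u v w z. ?\<theta> a b u v w z) k g = ?t3 (?t a b) (comult C (?t k g))"
        using sweedler_tensor_coalg_tens[OF mT3 tri'[OF tl[OF a(1,2)]] a(3,4)] cc[OF tl[OF a(3,4)]] by simp
    qed
    also have "\<dots> = dsum ?T3 (\<lambda>k g w z. dsum ?T3 (\<lambda>a b u v. ?\<theta> a b u v w z) k g) l h"
      by (rule double_sweedler_coassoc[OF mT3 l h];
          intro lin_hom_tens_right[OF mT mTT] lin_hom_tens_left[OF mT mTT] lin_hom_tens_right[OF mT mT]
            lin_hom_tens_left[OF mT mT] lin_hom_tens_right[OF mL mH] lin_hom_tens_left[OF mL mH]
            lin_hom_ident tl tens_closed[OF mT mT]; assumption)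
    also have "\<dots> = dsum ?T3 (\<lambda>k g w z. tsum K ?T3 (\<lambda>u v. ?t3 u (?t2 v (?t w z))) (comult C (?t k g))) l h"
      by (rule double_sweedler_cong[OF mT3 l h tensor_bilinear_right[OF mT3 b2] tensor_bilinear_left[OF mT3 b2]])
        (simp_all add: sweedler_tensor_coalg_tens[OF mT3 tri] tl)
    also have "\<dots> = tsum K ?T3 (\<lambda>x y. tsum K ?T3 (\<lambda>u v. ?t3 u (?t2 v y)) (comult C x)) (comult C (?t l h))"
      by (rule sweedler_tensor_coalg_tens[OF mT3 b2 l h, symmetric])
    finally show "tsum K ?T3 (\<lambda>x y. ?t3 x (comult C y)) (comult C (?t l h)) = \<dots>" .
  qed
  have e1: "bilinear_map K T T T (\<lambda>x y. counit C x \<odot>\<^bsub>T\<^esub> y)"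
    by (intro bilinear_mapI lin_hom_scale[OF mT] lin_hom_scalar[OF mT] ec el lin_hom_ident)
  have e2: "bilinear_map K T T T (\<lambda>x y. counit C y \<odot>\<^bsub>T\<^esub> x)"
    by (intro bilinear_mapI lin_hom_scale[OF mT] lin_hom_scalar[OF mT] ec el lin_hom_ident)
  note sm = module.smult_assoc1[OF mT] and eL = counit_closed[OF L] and eH = counit_closed[OF H]
  have left: "tsum K T (\<lambda>x y. counit C x \<odot>\<^bsub>T\<^esub> y) (comult C X) = X" if X: "X \<in> carrier T" for X
  proof (rule tensor_hom_eq[OF mL mH mT sl[OF mT e1] lin_hom_ident _ X])
    fix l h assume l: "l \<in> carrier L" and h: "h \<in> carrier H"
    have f: "(\<lambda>y. counit L l' \<odot>\<^bsub>T\<^esub> ?t l'' y) \<in> lin_hom K H T"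
      if "l' \<in> carrier L" "l'' \<in> carrier L" for l' l''
      using that by (intro lin_hom_scale[OF mT] lin_hom_tens_right[OF mL mH] lin_hom_ident eL)
    have "tsum K T (\<lambda>x y. counit C x \<odot>\<^bsub>T\<^esub> y) (comult C (?t l h)) =
        dsum T (\<lambda>a b k g. counit C (?t a b) \<odot>\<^bsub>T\<^esub> ?t k g) l h"
      by (rule sweedler_tensor_coalg_tens[OF mT e1 l h])
    \<comment> \<open>The scalars are reordered so that the counit of \<open>H\<close> stands
      outermost; the inner sum over \<open>H\<close> can then be contracted first, and the remaining
      sum over \<open>L\<close> afterwards.\<close>
    also have "\<dots> = dsum T (\<lambda>a b k g. counit H b \<odot>\<^bsub>T\<^esub> (counit L a \<odot>\<^bsub>T\<^esub> ?t k g)) l h"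
      by (rule double_sweedler_cong[OF mT l h tensor_bilinear_right[OF mT e1] tensor_bilinear_left[OF mT e1], symmetric])
        (simp_all add: counit_tensor_coalg_tens sm[symmetric] eL eH tl L.R.m_comm)
    also have "\<dots> = tsum K T (\<lambda>a k. counit L a \<odot>\<^bsub>T\<^esub> ?t k h) (comult L l)"
      by (rule tsum_cong[OF mL mL mT _ cL[OF l]])
        (auto intro!: bilinear_mapI lin_hom_scale[OF mT] lin_hom_scalar[OF mT] lin_hom_tens_left[OF mL mH]
          lin_hom_ident tl eL h coalgebra.counit_linear[OF L] sweedler_counit_left[OF H mT h] f)
    also have "\<dots> = ?t l h"
      by (intro sweedler_counit_left[OF L mT l] lin_hom_tens_left[OF mL mH] lin_hom_ident h)
    finally show "tsum K T (\<lambda>x y. counit C x \<odot>\<^bsub>T\<^esub> y) (comult C (?t l h)) = ?t l h" .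
  qed
  have right: "tsum K T (\<lambda>x y. counit C y \<odot>\<^bsub>T\<^esub> x) (comult C X) = X" if X: "X \<in> carrier T" for X
  proof (rule tensor_hom_eq[OF mL mH mT sl[OF mT e2] lin_hom_ident _ X])
    fix l h assume l: "l \<in> carrier L" and h: "h \<in> carrier H"
    have f: "(\<lambda>y. counit L l' \<odot>\<^bsub>T\<^esub> ?t l'' y) \<in> lin_hom K H T"
      if "l' \<in> carrier L" "l'' \<in> carrier L" for l' l''
      using that by (intro lin_hom_scale[OF mT] lin_hom_tens_right[OF mL mH] lin_hom_ident eL)
    have "tsum K T (\<lambda>x y. counit C y \<odot>\<^bsub>T\<^esub> x) (comult C (?t l h)) =
        dsum T (\<lambda>a b k g. counit C (?t k g) \<odot>\<^bsub>T\<^esub> ?t a b) l h"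
      by (rule sweedler_tensor_coalg_tens[OF mT e2 l h])
    also have "\<dots> = dsum T (\<lambda>a b k g. counit H g \<odot>\<^bsub>T\<^esub> (counit L k \<odot>\<^bsub>T\<^esub> ?t a b)) l h"
      by (rule double_sweedler_cong[OF mT l h tensor_bilinear_right[OF mT e2] tensor_bilinear_left[OF mT e2], symmetric])
        (simp_all add: counit_tensor_coalg_tens sm[symmetric] eL eH tl L.R.m_comm)
    also have "\<dots> = tsum K T (\<lambda>a k. counit L k \<odot>\<^bsub>T\<^esub> ?t a h) (comult L l)"
      by (rule tsum_cong[OF mL mL mT _ cL[OF l]])
        (auto intro!: bilinear_mapI lin_hom_scale[OF mT] lin_hom_scalar[OF mT] lin_hom_tens_left[OF mL mH]
          lin_hom_ident tl eL h coalgebra.counit_linear[OF L] sweedler_counit_right[OF H mT h] f)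
    also have "\<dots> = ?t l h"
      by (intro sweedler_counit_right[OF L mT l] lin_hom_tens_left[OF mL mH] lin_hom_ident h)
    finally show "tsum K T (\<lambda>x y. counit C y \<odot>\<^bsub>T\<^esub> x) (comult C (?t l h)) = ?t l h" .
  qed
  have "module K C" by (rule module_record_cong[OF mT]) (simp_all add: tensor_coalg_simps)
  moreover have "coalgebra_axioms K C"
    unfolding coalgebra_axioms_def tensor_coalg_tensor tensor_coalg_simps
    using cl el coassoc left right by simp
  ultimately show ?thesis by (rule coalgebra.intro)
qed

text \<open>Compatibility with comultiplication and counit are equations between linear maps on the
  tensor module, hence can be tested on pure tensors.\<close>

lemma coalg_hom_tensor_iff:
  assumes D: "coalgebra K D"
  shows "u \<in> coalg_hom K C D \<longleftrightarrow> u \<in> lin_hom K T D \<and>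
    (\<forall>l\<in>carrier L. \<forall>h\<in>carrier H.
      comult D (u (tens K L H l h)) = dsum (tensor_module K D D)
        (\<lambda>l' h' l'' h''. tens K D D (u (tens K L H l' h')) (u (tens K L H l'' h''))) l h \<and>
      counit D (u (tens K L H l h)) = counit L l \<otimes>\<^bsub>K\<^esub> counit H h)"
proof (cases "u \<in> lin_hom K T D")
  case u: True
  interpret L: coalgebra K L by (rule L)
  note mD = coalgebra_module[OF D] and g = module_ground_module[OF L.R.is_cring]
  note mDD = module_tensor_module[OF mD mD]
  have b: "bilinear_map K T T (tensor_module K D D) (\<lambda>x y. tens K D D (u x) (u y))"
    by (rule bilinear_map_comp2[OF tens_bilinear[OF mD mD] u u])
  note s = sweedler_tensor_coalg_tens[OF mDD b]
  note l1 = lin_hom_comp[OF coalgebra.comult_linear[OF D] u]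
  note l2 = lin_hom_comp[OF tsum_lin_hom[OF mT mT mDD b] comult_tensor_coalg_lin_hom]
  note l3 = lin_hom_comp[OF coalgebra.counit_linear[OF D] u]
  have "u \<in> coalg_hom K C D \<longleftrightarrow> (\<forall>X\<in>carrier T.
      comult D (u X) = tsum K (tensor_module K D D) (\<lambda>x y. tens K D D (u x) (u y)) (comult C X) \<and>
      counit D (u X) = counit C X)"
    using u by (simp add: coalg_hom_def tensor_coalg_tensor tensor_coalg_simps)
  also have "\<dots> \<longleftrightarrow> (\<forall>l\<in>carrier L. \<forall>h\<in>carrier H.
      comult D (u (tens K L H l h)) =
        tsum K (tensor_module K D D) (\<lambda>x y. tens K D D (u x) (u y)) (comult C (tens K L H l h)) \<and>
      counit D (u (tens K L H l h)) = counit C (tens K L H l h))"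
    using tensor_hom_eq[OF mL mH mDD l1 l2] tensor_hom_eq[OF mL mH g l3 counit_tensor_coalg_lin_hom]
    by (auto simp: tl)
  finally show ?thesis using u by (simp add: s counit_tensor_coalg_tens)
qed (simp add: coalg_hom_def tensor_coalg_tensor)

text \<open>The map that has to be a coalgebra map sends the pure tensor of \<open>l\<close> and
  \<open>h\<close> to \<open>lam l h\<close>. This explicit form is the one that composes with
  coalgebra maps on either side.\<close>

lemma coalg_measuring_iff:
  assumes D: "coalgebra K D"
  shows "coalg_measuring K L H D lam \<longleftrightarrow> bilinear_map K L H D lam \<and>
    (\<forall>l\<in>carrier L. lam l \<in> extensional (carrier H)) \<and>
    (\<forall>l\<in>carrier L. \<forall>h\<in>carrier H.
      comult D (lam l h) = dsum (tensor_module K D D)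
        (\<lambda>l' h' l'' h''. tens K D D (lam l' h') (lam l'' h'')) l h \<and>
      counit D (lam l h) = counit L l \<otimes>\<^bsub>K\<^esub> counit H h)"
proof (cases "bilinear_map K L H D lam")
  case b: True
  note mD = coalgebra_module[OF D]
  note mDD = module_tensor_module[OF mD mD]
  have t: "tsum K D lam (tens K L H l h) = lam l h" if "l \<in> carrier L" "h \<in> carrier H" for l h
    by (rule tsum_tens[OF mL mH mD b that])
  have "dsum (tensor_module K D D)
        (\<lambda>l' h' l'' h''. tens K D D (tsum K D lam (tens K L H l' h')) (tsum K D lam (tens K L H l'' h''))) l h =
      dsum (tensor_module K D D) (\<lambda>l' h' l'' h''. tens K D D (lam l' h') (lam l'' h'')) l h"
    if "l \<in> carrier L" "h \<in> carrier H" for l h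
    by (rule double_sweedler_cong[OF mDD that
          bilinear_map_comp2[OF tens_bilinear[OF mD mD] bilinear_map_right[OF b] bilinear_map_right[OF b]]
          bilinear_map_comp2[OF tens_bilinear[OF mD mD] bilinear_map_left[OF b] bilinear_map_left[OF b]]])
      (simp_all add: t)
  then show ?thesis
    unfolding coalg_measuring_def coalg_hom_tensor_iff[OF D] lin_hom_hom_module_iff[OF mL mH]
    using b tsum_lin_hom[OF mL mH mD b] by (simp add: t)
qed (simp add: coalg_measuring_def lin_hom_hom_module_iff[OF mL mH])

lemma coalg_hom_coalg_measuring:
  assumes D: "coalgebra K D" and u: "u \<in> coalg_hom K C D"
  shows "coalg_measuring K L H D (\<lambda>l. \<lambda>h\<in>carrier H. u (tens K L H l h))"
proof -
  note mD = coalgebra_module[OF D]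
  have ul: "u \<in> lin_hom K T D" using coalg_hom_lin_hom[OF u] by (simp add: tensor_coalg_tensor)
  have b: "bilinear_map K L H D (\<lambda>l. \<lambda>h\<in>carrier H. u (tens K L H l h))"
    by (rule bilinear_map_cong[OF mL mH bilinear_map_comp[OF ul tens_bilinear[OF mL mH]]]) simp
  have "tsum K D (\<lambda>l. \<lambda>h\<in>carrier H. u (tens K L H l h)) X = u X" if "X \<in> carrier T" for X
    by (rule tsum_unique[OF mL mH mD ul b _ that, symmetric]) simp
  then have "tsum K D (\<lambda>l. \<lambda>h\<in>carrier H. u (tens K L H l h)) \<in> coalg_hom K C D"
    by (intro coalg_hom_cong[OF coalgebra_tensor_coalg D u]) (simp add: tensor_coalg_simps)
  then show ?thesis
    using b by (simp add: coalg_measuring_def lin_hom_hom_module_iff[OF mL mH])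
qed

text \<open>Evaluated at pure tensors, the measuring condition for the tensor coalgebra is the
  double Sweedler sum of \<open>trilinear_measuring\<close>.\<close>

lemma alg_measuring_from_tensor:
  assumes A: "assoc_algebra K A" and B: "assoc_algebra K B" and \<tau>: "alg_measuring K C A B \<tau>"
  shows "alg_measuring K L A (conv_algebra K H B) (\<lambda>l. \<lambda>a\<in>carrier A. \<lambda>h\<in>carrier H. \<tau> (tens K L H l h) a)"
proof (rule trilinear_alg_measuring_conv[OF L H A B])
  interpret A: assoc_algebra K A by (rule A)
  interpret B: assoc_algebra K B by (rule B)
  note mA = assoc_algebra_module[OF A] and mB = assoc_algebra_module[OF B]
  note t = \<tau>[unfolded alg_measuring_iff[OF coalgebra_module[OF coalgebra_tensor_coalg] mA] tensor_coalg_simps]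
  have b: "bilinear_map K T A B \<tau>"
    using t by (simp add: bilinear_map_def tensor_coalg_tensor tensor_coalg_simps)
  note bl = bilinear_map_left[OF b] and br = bilinear_map_right[OF b]
  have "\<tau> (tens K L H l h) (a \<otimes>\<^bsub>A\<^esub> a') =
      dsum B (\<lambda>l' h' l'' h''. \<tau> (tens K L H l' h') a \<otimes>\<^bsub>B\<^esub> \<tau> (tens K L H l'' h'') a') l h"
    if "l \<in> carrier L" "h \<in> carrier H" "a \<in> carrier A" "a' \<in> carrier A" for l h a a'
    using t that sweedler_tensor_coalg_tens[OF mB bilinear_map_mult[OF B bl bl]] by (simp add: tl)
  moreover have "\<tau> (tens K L H l h) \<one>\<^bsub>A\<^esub> = counit L l \<odot>\<^bsub>B\<^esub> (counit H h \<odot>\<^bsub>B\<^esub> \<one>\<^bsub>B\<^esub>)"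
    if "l \<in> carrier L" "h \<in> carrier H" for l h
    using t that counit_closed[OF L] counit_closed[OF H]
    by (simp add: tl counit_tensor_coalg_tens B.smult_assoc1)
  ultimately show "trilinear_measuring K L A H B (\<lambda>l a h. \<tau> (tens K L H l h) a)"
    unfolding trilinear_measuring_def
    using lin_hom_comp[OF bl lin_hom_tens_left[OF mL mH lin_hom_ident]] br[OF tl]
      lin_hom_comp[OF bl lin_hom_tens_right[OF mL mH _ lin_hom_ident]]
    by simp
qed

text \<open>For each \<open>a\<close> the trilinear datum is bilinear in the two coalgebra variables
  and so extends to tensors. The measuring conditions are linear in the tensor and hold on pure ones
  by assumption.\<close>

lemma alg_measuring_to_tensor:
  assumes A: "assoc_algebra K A" and B: "assoc_algebra K B"
    and \<sigma>: "alg_measuring K L A (conv_algebra K H B) \<sigma>"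
  obtains \<tau> where "alg_measuring K C A B \<tau>"
    and "\<And>l h a. l \<in> carrier L \<Longrightarrow> h \<in> carrier H \<Longrightarrow> a \<in> carrier A \<Longrightarrow> \<tau> (tens K L H l h) a = \<sigma> l a h"
proof -
  interpret A: assoc_algebra K A by (rule A)
  interpret B: assoc_algebra K B by (rule B)
  note mA = assoc_algebra_module[OF A] and mB = assoc_algebra_module[OF B]
  note mC = coalgebra_module[OF coalgebra_tensor_coalg]
  note r = alg_measuring_conv_trilinear[OF L H A B \<sigma>, unfolded trilinear_measuring_def]
  have bs: "bilinear_map K L H B (\<lambda>l h. \<sigma> l a h)" if "a \<in> carrier A" for a
    using r that by (intro bilinear_mapI) blast+
  have la: "(\<lambda>a. \<sigma> l a h) \<in> lin_hom K A B" if "l \<in> carrier L" "h \<in> carrier H" for l h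
    using r that by blast
  define \<tau> where "\<tau> = (\<lambda>X. \<lambda>a\<in>carrier A. tsum K B (\<lambda>l h. \<sigma> l a h) X)"
  have t: "\<tau> X a = tsum K B (\<lambda>l h. \<sigma> l a h) X" if "a \<in> carrier A" for X a
    using that by (simp add: \<tau>_def)
  have tt: "\<tau> (tens K L H l h) a = \<sigma> l a h" if "l \<in> carrier L" "h \<in> carrier H" "a \<in> carrier A" for l h a
    using that by (simp add: t tsum_tens[OF mL mH mB bs])
  have "bilinear_map K T A B (\<lambda>X a. tsum K B (\<lambda>l h. \<sigma> l a h) X)"
    by (intro bilinear_mapI tsum_lin_hom[OF mL mH mB] bs lin_hom_tsum_param[OF mL mH mB mA] la)
  then have tb: "bilinear_map K T A B \<tau>"
    by (rule bilinear_map_cong[OF mT mA]) (simp add: t)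
  note bl = bilinear_map_left[OF tb]
  have mult: "\<tau> X (a \<otimes>\<^bsub>A\<^esub> a') = tsum K B (\<lambda>x y. \<tau> x a \<otimes>\<^bsub>B\<^esub> \<tau> y a') (comult C X)"
    if X: "X \<in> carrier T" and a: "a \<in> carrier A" "a' \<in> carrier A" for X a a'
  proof -
    have bt: "bilinear_map K T T B (\<lambda>x y. \<tau> x a \<otimes>\<^bsub>B\<^esub> \<tau> y a')"
      by (intro bilinear_map_mult[OF B] bl a)
    show ?thesis
    proof (rule tensor_hom_eq[OF mL mH mB bl[OF A.m_closed[OF a]]
          lin_hom_comp[OF tsum_lin_hom[OF mT mT mB bt] comult_tensor_coalg_lin_hom] _ X])
      fix l h assume l: "l \<in> carrier L" and h: "h \<in> carrier H"
      have "\<tau> (tens K L H l h) (a \<otimes>\<^bsub>A\<^esub> a') = dsum B (\<lambda>l' h' l'' h''. \<sigma> l' a h' \<otimes>\<^bsub>B\<^esub> \<sigma> l'' a' h'') l h"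
        using r l h a by (simp add: tt)
      also have "\<dots> = dsum B (\<lambda>l' h' l'' h''. \<tau> (tens K L H l' h') a \<otimes>\<^bsub>B\<^esub> \<tau> (tens K L H l'' h'') a') l h"
        by (rule double_sweedler_cong[OF mB l h tensor_bilinear_right[OF mB bt] tensor_bilinear_left[OF mB bt]])
          (simp_all add: tt a)
      also have "\<dots> = tsum K B (\<lambda>x y. \<tau> x a \<otimes>\<^bsub>B\<^esub> \<tau> y a') (comult C (tens K L H l h))"
        by (rule sweedler_tensor_coalg_tens[OF mB bt l h, symmetric])
      finally show "\<tau> (tens K L H l h) (a \<otimes>\<^bsub>A\<^esub> a') = \<dots>" .
    qed
  qed
  have one: "\<tau> X \<one>\<^bsub>A\<^esub> = counit C X \<odot>\<^bsub>B\<^esub> \<one>\<^bsub>B\<^esub>" if X: "X \<in> carrier T" for X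
    by (rule tensor_hom_eq[OF mL mH mB bl[OF A.one_closed]
          lin_hom_scalar[OF mB B.one_closed counit_tensor_coalg_lin_hom] _ X])
      (use r counit_closed[OF L] counit_closed[OF H] in
        \<open>simp add: tt counit_tensor_coalg_tens B.smult_assoc1\<close>)
  have "bilinear_map K C A B \<tau>"
    using tb by (simp add: bilinear_map_def tensor_coalg_tensor tensor_coalg_simps)
  then have "alg_measuring K C A B \<tau>"
    unfolding alg_measuring_iff[OF mC mA] tensor_coalg_simps using mult one by (simp add: \<tau>_def)
  then show ?thesis by (rule that) (rule tt)
qed

end

section \<open>Quotient algebras\<close>

text \<open>The preimage of a submodule is a submodule. The lemma serves to show that the span of
  the multilinear relations is stable under multiplication by words.\<close>

lemma submodule_span_lin_hom:
  assumes "module K M" "module K M'" "f \<in> lin_hom K M M'" "X \<subseteq> carrier M" "Y \<subseteq> carrier M'"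
    and "\<And>x. x \<in> X \<Longrightarrow> f x \<in> submodule_span K M' Y" "x \<in> submodule_span K M X"
  shows "f x \<in> submodule_span K M' Y"
proof -
  interpret M: module K M by fact
  interpret M': module K M' by fact
  note s = submodule_submodule_span[OF assms(2,5)]
  note z = subgroup.one_closed[OF submodule.axioms(1)[OF s], simplified]
  have "submodule {x \<in> carrier M. f x \<in> submodule_span K M' Y} K M"
    by (rule M.submoduleI)
      (auto simp: lin_hom_zero[OF assms(1-3)] lin_hom_add[OF assms(3)] lin_hom_smult[OF assms(3)]
        lin_hom_neg[OF assms(1-3)] z M'.submoduleE[OF s])
  then show ?thesis using submodule_span_subset[of _ K M X] assms(4,6,7) by fastforce
qed

locale algebra_quotient = assoc_algebra K A + ideal I A for K A I
begin

text \<open>An ideal is closed under ring multiplication only; the scalar \<open>c\<close> acts as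
  multiplication by \<open>c\<close> times the unit.\<close>

lemma submodule_ideal: "submodule I K A"
proof (rule submoduleI)
  fix c x assume c: "c \<in> carrier K" and x: "x \<in> I"
  have "c \<odot>\<^bsub>A\<^esub> x = (c \<odot>\<^bsub>A\<^esub> \<one>\<^bsub>A\<^esub>) \<otimes>\<^bsub>A\<^esub> x"
    using c x a_subset by (subst smult_mult_left) auto
  then show "c \<odot>\<^bsub>A\<^esub> x \<in> I" using c x by (simp add: I_l_closed)
qed (use a_subset in auto)

lemma module_quotient: "module_quotient K A I"
  by (intro module_quotient.intro submodule_ideal) unfold_locales

sublocale Q: module_quotient K A I by (rule module_quotient)

lemma quot_mult: "x \<in> carrier A \<Longrightarrow> y \<in> carrier A \<Longrightarrow>
    (I +>\<^bsub>A\<^esub> x) \<otimes>\<^bsub>quot_module A I\<^esub> (I +>\<^bsub>A\<^esub> y) = I +>\<^bsub>A\<^esub> (x \<otimes>\<^bsub>A\<^esub> y)"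
  by (simp add: quot_module_def FactRing_def rcoset_mult_add)

lemma quot_one: "\<one>\<^bsub>quot_module A I\<^esub> = I +>\<^bsub>A\<^esub> \<one>\<^bsub>A\<^esub>"
  by (simp add: quot_module_def FactRing_def)

lemma assoc_algebra_quot: "assoc_algebra K (quot_module A I)"
proof (rule assoc_algebraI[OF Q.module_quot_module])
  show "bilinear_map K (quot_module A I) (quot_module A I) (quot_module A I) (\<lambda>x y. x \<otimes>\<^bsub>quot_module A I\<^esub> y)"
    by (intro bilinear_mapI lin_homI)
      (auto simp: Q.quot_carrier Q.quot_add Q.quot_smult quot_mult l_distr r_distr smult_mult_left
        smult_mult_right)
qed (auto simp: Q.quot_carrier quot_mult quot_one m_assoc)

lemma quot_proj_alg_hom: "(\<lambda>x. I +>\<^bsub>A\<^esub> x) \<in> alg_hom K A (quot_module A I)"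
  by (rule alg_homI[OF Q.quot_proj_lin_hom]) (simp_all add: quot_one quot_mult)

lemma quot_lift_alg_hom:
  assumes D: "assoc_algebra K D" and g: "g \<in> alg_hom K A D" and z: "\<And>x. x \<in> I \<Longrightarrow> g x = \<zero>\<^bsub>D\<^esub>"
  shows "(\<lambda>X. the_elem (g ` X)) \<in> alg_hom K (quot_module A I) D"
proof -
  note l = assoc_algebra_module[OF D] alg_hom_lin_hom[OF g] z
  show ?thesis
    by (rule alg_homI[OF Q.quot_lift_lin_hom[OF l]])
      (auto simp: Q.quot_carrier quot_one quot_mult Q.quot_lift_coset[OF l] alg_hom_one[OF g]
        alg_hom_mult[OF g])
qed

end

section \<open>The tensor algebra\<close>

lemma word_algebra_simps:
  "carrier (word_algebra K S) = carrier (free_module K (lists S))"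
  "add (word_algebra K S) = add (free_module K (lists S))"
  "zero (word_algebra K S) = zero (free_module K (lists S))"
  "smult (word_algebra K S) = smult (free_module K (lists S))"
  "\<one>\<^bsub>word_algebra K S\<^esub> = basis_elt K []"
  "(c \<otimes>\<^bsub>word_algebra K S\<^esub> d) w = (\<Oplus>\<^bsub>K\<^esub>i\<in>{..length w}. c (take i w) \<otimes>\<^bsub>K\<^esub> d (drop i w))"
  by (simp_all add: word_algebra_def free_module_def)

lemma lin_hom_word_algebra: "lin_hom K (word_algebra K S) Z = lin_hom K (free_module K (lists S)) Z"
  by (simp add: lin_hom_def word_algebra_simps)

section \<open>The free algebra on words\<close>

context
  fixes K :: "('k, 'z) ring_scheme" and S :: "'s set"
  assumes K: "cring K"
begin

interpretation K: cring K by (rule K)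

private abbreviation (input) "FS \<equiv> word_algebra K S"

lemma module_word_algebra: "module K FS"
  by (rule module_record_cong[OF module_free_module[OF K]]) (simp_all add: word_algebra_simps)

lemma basis_word_closed: "w \<in> lists S \<Longrightarrow> basis_elt K w \<in> carrier FS"
  unfolding word_algebra_simps by (rule basis_elt_in_free_module[OF K])

text \<open>Of all the cuts of \<open>w\<close>, only the one at position \<open>length u\<close>
  can have \<open>u\<close> as its left part, so the sum over cuts has at most one nonzero
  term.\<close>

lemma basis_word_mult: "basis_elt K u \<otimes>\<^bsub>FS\<^esub> basis_elt K v = basis_elt K (u @ v)"
proof
  fix w :: "'s list"
  have b: "basis_elt K s t \<in> carrier K" for s t :: "'s list" by (simp add: basis_elt_def)
  have "(\<Oplus>\<^bsub>K\<^esub>i\<in>{..length w}. basis_elt K u (take i w) \<otimes>\<^bsub>K\<^esub> basis_elt K v (drop i w)) =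
      (\<Oplus>\<^bsub>K\<^esub>i\<in>{..length w}. if length u = i then basis_elt K (u @ v) w else \<zero>\<^bsub>K\<^esub>)"
  proof (rule K.finsum_cong')
    fix i assume "i \<in> {..length w}"
    then have i: "i \<le> length w" by simp
    have "w = u @ v \<longleftrightarrow> take i w = u \<and> drop i w = v" if "length u = i"
      using that by (metis append_eq_conv_conj)
    moreover have "take i w \<noteq> u" if "length u \<noteq> i" using that i by auto
    ultimately show "basis_elt K u (take i w) \<otimes>\<^bsub>K\<^esub> basis_elt K v (drop i w) =
        (if length u = i then basis_elt K (u @ v) w else \<zero>\<^bsub>K\<^esub>)"
      using b by (auto simp: basis_elt_def)
  qed (auto simp: b)
  also have "\<dots> = basis_elt K (u @ v) w"
  proof (cases "length u \<le> length w")
    case True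
    then show ?thesis
      using K.add.finprod_singleton[of "length u" "{..length w}" "\<lambda>_. basis_elt K (u @ v) w"] b by simp
  next
    \<comment> \<open>If \<open>w\<close> is shorter than \<open>u\<close>, the decisive cut is out
      of range and the sum is zero, in accordance with \<open>w\<close> not being
      \<open>u @ v\<close>.\<close>
    case False
    then have "(\<Oplus>\<^bsub>K\<^esub>i\<in>{..length w}. if length u = i then basis_elt K (u @ v) w else \<zero>\<^bsub>K\<^esub>) = \<zero>\<^bsub>K\<^esub>"
      by (intro K.add.finprod_one_eqI) auto
    moreover have "w \<noteq> u @ v" using False by auto
    ultimately show ?thesis by (simp add: basis_elt_def)
  qed
  finally show "(basis_elt K u \<otimes>\<^bsub>FS\<^esub> basis_elt K v) w = basis_elt K (u @ v) w"
    by (simp add: word_algebra_simps)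
qed

text \<open>A nonzero coefficient at \<open>w\<close> requires a cut of \<open>w\<close> into a word
  of the support of \<open>c\<close> and a word of the support of \<open>d\<close>, so the support
  lies among finitely many concatenations.\<close>

lemma word_mult_closed:
  assumes c: "c \<in> carrier FS" and d: "d \<in> carrier FS"
  shows "c \<otimes>\<^bsub>FS\<^esub> d \<in> carrier FS"
proof -
  let ?C = "{w. c w \<noteq> \<zero>\<^bsub>K\<^esub>}" and ?D = "{w. d w \<noteq> \<zero>\<^bsub>K\<^esub>}"
  have k: "\<And>w. c w \<in> carrier K" "\<And>w. d w \<in> carrier K" and f: "finite ?C" "finite ?D"
    and s: "?C \<subseteq> lists S" "?D \<subseteq> lists S"
    using c d by (simp_all add: word_algebra_simps free_module_def)
  have "{w. (c \<otimes>\<^bsub>FS\<^esub> d) w \<noteq> \<zero>\<^bsub>K\<^esub>} \<subseteq> (\<lambda>(u, v). u @ v) ` (?C \<times> ?D)"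
  proof
    fix w assume "w \<in> {w. (c \<otimes>\<^bsub>FS\<^esub> d) w \<noteq> \<zero>\<^bsub>K\<^esub>}"
    then have "(\<Oplus>\<^bsub>K\<^esub>i\<in>{..length w}. c (take i w) \<otimes>\<^bsub>K\<^esub> d (drop i w)) \<noteq> \<zero>\<^bsub>K\<^esub>"
      by (simp add: word_algebra_simps)
    moreover have "(\<Oplus>\<^bsub>K\<^esub>i\<in>{..length w}. c (take i w) \<otimes>\<^bsub>K\<^esub> d (drop i w)) = \<zero>\<^bsub>K\<^esub>"
      if "\<forall>i. c (take i w) \<otimes>\<^bsub>K\<^esub> d (drop i w) = \<zero>\<^bsub>K\<^esub>"
      using that by (intro K.add.finprod_one_eqI) auto
    ultimately obtain i where "c (take i w) \<otimes>\<^bsub>K\<^esub> d (drop i w) \<noteq> \<zero>\<^bsub>K\<^esub>" by metis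
    then have "c (take i w) \<noteq> \<zero>\<^bsub>K\<^esub>" "d (drop i w) \<noteq> \<zero>\<^bsub>K\<^esub>" using k by auto
    then show "w \<in> (\<lambda>(u, v). u @ v) ` (?C \<times> ?D)"
      by (intro image_eqI[of _ _ "(take i w, drop i w)"]) auto
  qed
  moreover have "(\<lambda>(u, v). u @ v) ` (?C \<times> ?D) \<subseteq> lists S" using s by fastforce
  moreover have "(c \<otimes>\<^bsub>FS\<^esub> d) w \<in> carrier K" for w
    unfolding word_algebra_simps(6) using k by (intro K.finsum_closed) auto
  ultimately show ?thesis
    using finite_subset[OF _ finite_imageI[OF finite_cartesian_product[OF f]]]
    unfolding word_algebra_simps(1) free_module_def by simp blast
qed

lemma word_mult_bilinear: "bilinear_map K FS FS FS (\<lambda>c d. c \<otimes>\<^bsub>FS\<^esub> d)"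
proof (intro bilinear_mapI lin_homI word_mult_closed)
  have k: "c w \<in> carrier K" if "c \<in> carrier FS" for c w
    using that by (simp add: word_algebra_simps free_module_def)
  have add: "(c \<oplus>\<^bsub>FS\<^esub> d) w = c w \<oplus>\<^bsub>K\<^esub> d w" and smult: "(a \<odot>\<^bsub>FS\<^esub> c) w = a \<otimes>\<^bsub>K\<^esub> c w" for a c d w
    by (simp_all add: word_algebra_simps free_module_def)
  note m = word_algebra_simps(6)
  show "c \<otimes>\<^bsub>FS\<^esub> (d \<oplus>\<^bsub>FS\<^esub> d') = c \<otimes>\<^bsub>FS\<^esub> d \<oplus>\<^bsub>FS\<^esub> c \<otimes>\<^bsub>FS\<^esub> d'"
    "(d \<oplus>\<^bsub>FS\<^esub> d') \<otimes>\<^bsub>FS\<^esub> c = d \<otimes>\<^bsub>FS\<^esub> c \<oplus>\<^bsub>FS\<^esub> d' \<otimes>\<^bsub>FS\<^esub> c"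
    if "c \<in> carrier FS" "d \<in> carrier FS" "d' \<in> carrier FS" for c d d'
    using that k
    by (intro ext; unfold add m; subst K.finsum_addf[symmetric]; auto simp: K.r_distr K.l_distr)+
  show "c \<otimes>\<^bsub>FS\<^esub> (a \<odot>\<^bsub>FS\<^esub> d) = a \<odot>\<^bsub>FS\<^esub> (c \<otimes>\<^bsub>FS\<^esub> d)"
    "(a \<odot>\<^bsub>FS\<^esub> d) \<otimes>\<^bsub>FS\<^esub> c = a \<odot>\<^bsub>FS\<^esub> (d \<otimes>\<^bsub>FS\<^esub> c)"
    if "c \<in> carrier FS" "a \<in> carrier K" "d \<in> carrier FS" for a c d
    using that k
    by (intro ext; unfold smult m; subst K.finsum_rdistr; auto simp: K.m_lcomm K.m_assoc)+
qed

lemma word_algebra_hom_eq: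
  assumes "module K W" "f \<in> lin_hom K FS W" "g \<in> lin_hom K FS W"
    and "\<And>w. w \<in> lists S \<Longrightarrow> f (basis_elt K w) = g (basis_elt K w)" "c \<in> carrier FS"
  shows "f c = g c"
  using free_module_hom_eq[OF K assms(1), of f "lists S" g c] assms
  by (simp add: lin_hom_word_algebra word_algebra_simps)

text \<open>On words the laws are those of concatenation. Associativity is extended linearly one
  factor at a time, starting from the right, as each extension fixes the other two factors.\<close>

lemma assoc_algebra_word_algebra: "assoc_algebra K FS"
proof (rule assoc_algebraI[OF module_word_algebra _ word_mult_bilinear])
  note bl = bilinear_map_left[OF word_mult_bilinear] and br = bilinear_map_right[OF word_mult_bilinear]
  note m = module_word_algebra and mc = word_mult_closed and bc = basis_word_closed
  show one: "\<one>\<^bsub>FS\<^esub> \<in> carrier FS" unfolding word_algebra_simps(5) by (rule bc) simp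
  fix x assume x: "x \<in> carrier FS"
  show "\<one>\<^bsub>FS\<^esub> \<otimes>\<^bsub>FS\<^esub> x = x"
    by (rule word_algebra_hom_eq[OF m br[OF one] lin_hom_ident _ x])
      (simp add: word_algebra_simps(5) basis_word_mult)
  show "x \<otimes>\<^bsub>FS\<^esub> \<one>\<^bsub>FS\<^esub> = x"
    by (rule word_algebra_hom_eq[OF m bl[OF one] lin_hom_ident _ x])
      (simp add: word_algebra_simps(5) basis_word_mult)
  fix y z assume y: "y \<in> carrier FS" and z: "z \<in> carrier FS"
  have 1: "(basis_elt K u \<otimes>\<^bsub>FS\<^esub> basis_elt K v) \<otimes>\<^bsub>FS\<^esub> z = basis_elt K u \<otimes>\<^bsub>FS\<^esub> (basis_elt K v \<otimes>\<^bsub>FS\<^esub> z)"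
    if uv: "u \<in> lists S" "v \<in> lists S" for u v
    by (rule word_algebra_hom_eq[OF m br[OF mc[OF bc[OF uv(1)] bc[OF uv(2)]]]
          lin_hom_comp[OF br[OF bc[OF uv(1)]] br[OF bc[OF uv(2)]]] _ z])
      (simp add: basis_word_mult)
  have 2: "(basis_elt K u \<otimes>\<^bsub>FS\<^esub> y) \<otimes>\<^bsub>FS\<^esub> z = basis_elt K u \<otimes>\<^bsub>FS\<^esub> (y \<otimes>\<^bsub>FS\<^esub> z)" if u: "u \<in> lists S" for u
    by (rule word_algebra_hom_eq[OF m lin_hom_comp[OF bl[OF z] br[OF bc[OF u]]]
          lin_hom_comp[OF br[OF bc[OF u]] bl[OF z]] 1[OF u] y])
  show "(x \<otimes>\<^bsub>FS\<^esub> y) \<otimes>\<^bsub>FS\<^esub> z = x \<otimes>\<^bsub>FS\<^esub> (y \<otimes>\<^bsub>FS\<^esub> z)"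
    by (rule word_algebra_hom_eq[OF m lin_hom_comp[OF bl[OF z] bl[OF y]] bl[OF mc[OF y z]] 2 x])
qed

end

section \<open>The tensor algebra and its universal property\<close>

context
  fixes K :: "('k, 'z) ring_scheme" and V :: "('k, 'v, 'm) module_scheme"
  assumes V: "module K V"
begin

interpretation V: module K V by (rule V)

private lemmas K = V.R.is_cring
private abbreviation (input) "F \<equiv> word_algebra K (carrier V)"
private abbreviation (input) "N \<equiv> tensor_algebra_null K V"
private abbreviation (input) "e \<equiv> basis_elt K"

private lemma aF: "assoc_algebra K F" by (rule assoc_algebra_word_algebra[OF K])

interpretation F: assoc_algebra K F by (rule aF)

private lemmas bc = basis_word_closed[OF K, where S = "carrier V"]
private lemmas bil = word_mult_bilinear[OF K, where S = "carrier V"]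
private lemmas mF = module_word_algebra[OF K, where S = "carrier V"]

lemma multilinear_relations_subset: "multilinear_relations K V \<subseteq> carrier F"
  unfolding multilinear_relations_def Let_def
  by (auto intro!: F.minus_closed F.add.m_closed F.smult_closed bc)

text \<open>A relation carries a left context \<open>u\<close> and a right context \<open>v\<close>;
  multiplication by a word \<open>w\<close> merely replaces them by \<open>w @ u\<close> or
  \<open>v @ w\<close>.\<close>

lemma multilinear_relations_mult:
  assumes r: "r \<in> multilinear_relations K V" and w: "w \<in> lists (carrier V)"
  shows "e w \<otimes>\<^bsub>F\<^esub> r \<in> multilinear_relations K V \<and> r \<otimes>\<^bsub>F\<^esub> e w \<in> multilinear_relations K V"
proof -
  note bl = bilinear_map_left[OF bil bc[OF w]] and br = bilinear_map_right[OF bil bc[OF w]]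
  have "(\<exists>u v x y. r = e (u @ [x \<oplus>\<^bsub>V\<^esub> y] @ v) \<ominus>\<^bsub>F\<^esub> (e (u @ [x] @ v) \<oplus>\<^bsub>F\<^esub> e (u @ [y] @ v)) \<and>
         u \<in> lists (carrier V) \<and> v \<in> lists (carrier V) \<and> x \<in> carrier V \<and> y \<in> carrier V) \<or>
      (\<exists>u v c x. r = e (u @ [c \<odot>\<^bsub>V\<^esub> x] @ v) \<ominus>\<^bsub>F\<^esub> (c \<odot>\<^bsub>F\<^esub> e (u @ [x] @ v)) \<and>
         u \<in> lists (carrier V) \<and> v \<in> lists (carrier V) \<and> c \<in> carrier K \<and> x \<in> carrier V)"
    using r unfolding multilinear_relations_def Let_def by blast
  then show ?thesis
  proof (elim disjE exE conjE)
    fix u v x y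
    assume a: "u \<in> lists (carrier V)" "v \<in> lists (carrier V)" "x \<in> carrier V" "y \<in> carrier V"
      and r: "r = e (u @ [x \<oplus>\<^bsub>V\<^esub> y] @ v) \<ominus>\<^bsub>F\<^esub> (e (u @ [x] @ v) \<oplus>\<^bsub>F\<^esub> e (u @ [y] @ v))"
    have cl: "e (u @ [x \<oplus>\<^bsub>V\<^esub> y] @ v) \<in> carrier F" "e (u @ [x] @ v) \<in> carrier F" "e (u @ [y] @ v) \<in> carrier F"
      using a by (auto intro!: bc)
    have rel: "e (u @ [x \<oplus>\<^bsub>V\<^esub> y] @ v) \<ominus>\<^bsub>F\<^esub> (e (u @ [x] @ v) \<oplus>\<^bsub>F\<^esub> e (u @ [y] @ v)) \<in> multilinear_relations K V"
      if "u \<in> lists (carrier V)" "v \<in> lists (carrier V)" for u v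
      using that a unfolding multilinear_relations_def Let_def by blast
    have "e w \<otimes>\<^bsub>F\<^esub> r \<in> multilinear_relations K V"
      using rel[of "w @ u" v] a w cl
      by (simp add: r lin_hom_diff[OF mF mF br] lin_hom_add[OF br] basis_word_mult[OF K])
    moreover have "r \<otimes>\<^bsub>F\<^esub> e w \<in> multilinear_relations K V"
      using rel[of u "v @ w"] a w cl
      by (simp add: r lin_hom_diff[OF mF mF bl] lin_hom_add[OF bl] basis_word_mult[OF K])
    ultimately show ?thesis by blast
  next
    fix u v c x
    assume a: "u \<in> lists (carrier V)" "v \<in> lists (carrier V)" "c \<in> carrier K" "x \<in> carrier V"
      and r: "r = e (u @ [c \<odot>\<^bsub>V\<^esub> x] @ v) \<ominus>\<^bsub>F\<^esub> (c \<odot>\<^bsub>F\<^esub> e (u @ [x] @ v))"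
    have cl: "e (u @ [c \<odot>\<^bsub>V\<^esub> x] @ v) \<in> carrier F" "e (u @ [x] @ v) \<in> carrier F"
      using a by (auto intro!: bc)
    have rel: "e (u @ [c \<odot>\<^bsub>V\<^esub> x] @ v) \<ominus>\<^bsub>F\<^esub> (c \<odot>\<^bsub>F\<^esub> e (u @ [x] @ v)) \<in> multilinear_relations K V"
      if "u \<in> lists (carrier V)" "v \<in> lists (carrier V)" for u v
      using that a unfolding multilinear_relations_def Let_def by blast
    have "e w \<otimes>\<^bsub>F\<^esub> r \<in> multilinear_relations K V"
      using rel[of "w @ u" v] a w cl
      by (simp add: r lin_hom_diff[OF mF mF br] lin_hom_smult[OF br] basis_word_mult[OF K])
    moreover have "r \<otimes>\<^bsub>F\<^esub> e w \<in> multilinear_relations K V"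
      using rel[of u "v @ w"] a w cl
      by (simp add: r lin_hom_diff[OF mF mF bl] lin_hom_smult[OF bl] basis_word_mult[OF K])
    ultimately show ?thesis by blast
  qed
qed

lemma submodule_tensor_algebra_null: "submodule N K F"
  unfolding tensor_algebra_null_def by (rule submodule_submodule_span[OF mF multilinear_relations_subset])

text \<open>The null space is defined only as a linear span. It is a two-sided ideal because the
  relations are stable under words on both sides and words span the algebra.\<close>

lemma tensor_algebra_null_ideal: "ideal N F"
proof -
  note s = submodule_tensor_algebra_null
  note sE = F.submoduleE[OF s]
  have z: "\<zero>\<^bsub>F\<^esub> \<in> N" using subgroup.one_closed[OF submodule.axioms(1)[OF s]] by simp
  note bl = bilinear_map_left[OF bil] and br = bilinear_map_right[OF bil]
  have sup: "r \<in> N" if "r \<in> multilinear_relations K V" for r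
    unfolding tensor_algebra_null_def by (rule subsetD[OF submodule_span_superset that])
  have word: "e w \<otimes>\<^bsub>F\<^esub> n \<in> N \<and> n \<otimes>\<^bsub>F\<^esub> e w \<in> N" if w: "w \<in> lists (carrier V)" and n: "n \<in> N" for w n
  proof
    note rs = multilinear_relations_subset
    note rm = sup[OF conjunct1[OF multilinear_relations_mult[OF _ w]], unfolded tensor_algebra_null_def]
      sup[OF conjunct2[OF multilinear_relations_mult[OF _ w]], unfolded tensor_algebra_null_def]
    show "e w \<otimes>\<^bsub>F\<^esub> n \<in> N" unfolding tensor_algebra_null_def
      by (rule submodule_span_lin_hom[OF mF mF br[OF bc[OF w]] rs rs rm(1) n[unfolded tensor_algebra_null_def]])
    show "n \<otimes>\<^bsub>F\<^esub> e w \<in> N" unfolding tensor_algebra_null_def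
      by (rule submodule_span_lin_hom[OF mF mF bl[OF bc[OF w]] rs rs rm(2) n[unfolded tensor_algebra_null_def]])
  qed
  have nF: "n \<in> carrier F" if "n \<in> N" for n using sE(1) that by blast
  have "c \<otimes>\<^bsub>F\<^esub> n \<in> N \<and> n \<otimes>\<^bsub>F\<^esub> c \<in> N" if "c \<in> carrier F" and n: "n \<in> N" for c n
    using K that(1)[unfolded word_algebra_simps]
  proof (induction rule: free_module_induct)
    case zero
    show ?case unfolding word_algebra_simps(3)[symmetric] using nF[OF n] z by simp
  next
    case (basis w)
    then show ?case using word n by blast
  next
    case (add c d)
    then show ?case unfolding word_algebra_simps(1,2)[symmetric, where S = "carrier V"]
      using nF[OF n] sE(5) by (simp add: F.l_distr F.r_distr)
  next
    case (smult a c)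
    then show ?case unfolding word_algebra_simps(1,4)[symmetric, where S = "carrier V"]
      using nF[OF n] sE(4) by (simp add: F.smult_mult_left F.smult_mult_right)
  qed
  then show ?thesis
    using submodule.axioms(1)[OF s] by (intro idealI F.ring_axioms) auto
qed

interpretation Q: algebra_quotient K F N
  by (intro algebra_quotient.intro aF tensor_algebra_null_ideal)

lemma assoc_algebra_tensor_algebra: "assoc_algebra K (tensor_algebra K V)"
  unfolding tensor_algebra_def by (rule Q.assoc_algebra_quot)

private lemma proj: "(\<lambda>c. N +>\<^bsub>F\<^esub> c) \<in> alg_hom K F (tensor_algebra K V)"
  unfolding tensor_algebra_def by (rule Q.quot_proj_alg_hom)

lemma tensor_algebra_incl_lin_hom: "tensor_algebra_incl K V \<in> lin_hom K V (tensor_algebra K V)"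
proof -
  note p = alg_hom_lin_hom[OF proj]
  have eq: "N +>\<^bsub>F\<^esub> c = N +>\<^bsub>F\<^esub> d" if "c \<ominus>\<^bsub>F\<^esub> d \<in> multilinear_relations K V" "c \<in> carrier F" "d \<in> carrier F" for c d
    using that submodule_span_superset[of "multilinear_relations K V" K F]
    by (subst Q.Q.quot_eq_iff) (auto simp: tensor_algebra_null_def)
  have c: "e [x] \<in> carrier F" if "x \<in> carrier V" for x using that by (intro bc) auto
  show ?thesis
  proof (rule lin_homI)
    fix x assume x: "x \<in> carrier V"
    show "tensor_algebra_incl K V x \<in> carrier (tensor_algebra K V)"
      unfolding tensor_algebra_incl_def by (rule lin_hom_closed[OF p c[OF x]])
  next
    fix x y assume x: "x \<in> carrier V" and y: "y \<in> carrier V"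
    \<comment> \<open>A relation with empty contexts is linearity of the inclusion of letters; the
      empty lists are written out so that it matches the definition.\<close>
    have "e ([] @ [x \<oplus>\<^bsub>V\<^esub> y] @ []) \<ominus>\<^bsub>F\<^esub> (e ([] @ [x] @ []) \<oplus>\<^bsub>F\<^esub> e ([] @ [y] @ [])) \<in> multilinear_relations K V"
      using x y unfolding multilinear_relations_def Let_def by blast
    then have "N +>\<^bsub>F\<^esub> e [x \<oplus>\<^bsub>V\<^esub> y] = N +>\<^bsub>F\<^esub> (e [x] \<oplus>\<^bsub>F\<^esub> e [y])"
      using x y by (intro eq c F.add.m_closed) auto
    then show "tensor_algebra_incl K V (x \<oplus>\<^bsub>V\<^esub> y) =
        tensor_algebra_incl K V x \<oplus>\<^bsub>tensor_algebra K V\<^esub> tensor_algebra_incl K V y"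
      by (simp add: tensor_algebra_incl_def lin_hom_add[OF p] c x y)
  next
    fix a x assume a: "a \<in> carrier K" and x: "x \<in> carrier V"
    have "e ([] @ [a \<odot>\<^bsub>V\<^esub> x] @ []) \<ominus>\<^bsub>F\<^esub> (a \<odot>\<^bsub>F\<^esub> e ([] @ [x] @ [])) \<in> multilinear_relations K V"
      using x a unfolding multilinear_relations_def Let_def by blast
    then have "N +>\<^bsub>F\<^esub> e [a \<odot>\<^bsub>V\<^esub> x] = N +>\<^bsub>F\<^esub> (a \<odot>\<^bsub>F\<^esub> e [x])"
      using x a by (intro eq c F.smult_closed) auto
    then show "tensor_algebra_incl K V (a \<odot>\<^bsub>V\<^esub> x) = a \<odot>\<^bsub>tensor_algebra K V\<^esub> tensor_algebra_incl K V x"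
      by (simp add: tensor_algebra_incl_def lin_hom_smult[OF p] c x a)
  qed
qed

text \<open>A word is the product of its letters, so algebra maps agreeing on letters agree on
  words, and these span.\<close>

lemma tensor_algebra_hom_eq:
  assumes D: "assoc_algebra K D"
    and f: "f \<in> alg_hom K (tensor_algebra K V) D" and g: "g \<in> alg_hom K (tensor_algebra K V) D"
    and fg: "\<And>x. x \<in> carrier V \<Longrightarrow> f (tensor_algebra_incl K V x) = g (tensor_algebra_incl K V x)"
    and X: "X \<in> carrier (tensor_algebra K V)"
  shows "f X = g X"
proof -
  note f' = alg_hom_comp[OF f proj] and g' = alg_hom_comp[OF g proj]
  have w: "f (N +>\<^bsub>F\<^esub> e w) = g (N +>\<^bsub>F\<^esub> e w)" if "w \<in> lists (carrier V)" for w
    using that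
  proof (induction w)
    case Nil
    then show ?case using alg_hom_one[OF f'] alg_hom_one[OF g'] by (simp add: word_algebra_simps)
  next
    case (Cons x w)
    have c: "e [x] \<in> carrier F" "e w \<in> carrier F" using Cons by (auto intro!: bc)
    have "e (x # w) = e [x] \<otimes>\<^bsub>F\<^esub> e w" by (simp add: basis_word_mult[OF K])
    then show ?case
      using Cons fg[of x] alg_hom_mult[OF f' c] alg_hom_mult[OF g' c] by (simp add: tensor_algebra_incl_def)
  qed
  obtain c where c: "c \<in> carrier F" "X = N +>\<^bsub>F\<^esub> c"
    using X by (auto simp: tensor_algebra_def Q.Q.quot_carrier)
  show ?thesis unfolding c(2)
    by (rule word_algebra_hom_eq[OF K assoc_algebra_module[OF D] alg_hom_lin_hom[OF f'] alg_hom_lin_hom[OF g'] w c(1)])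
qed

text \<open>A word is sent to the product \<open>p\<close> of the images of its letters, with the
  empty word going to the unit. Linearity of \<open>f\<close> makes the linear extension
  \<open>h\<close> vanish on the multilinear relations, so it descends.\<close>

lemma tensor_algebra_lift:
  assumes D: "assoc_algebra K D" and f: "f \<in> lin_hom K V D"
  obtains g where "g \<in> alg_hom K (tensor_algebra K V) D"
    and "\<And>x. x \<in> carrier V \<Longrightarrow> g (tensor_algebra_incl K V x) = f x"
proof -
  interpret D: assoc_algebra K D by (rule D)
  note mD = assoc_algebra_module[OF D]
  note fc = lin_hom_closed[OF f]
  define p where "p = (\<lambda>w. foldr (\<lambda>x y. f x \<otimes>\<^bsub>D\<^esub> y) w \<one>\<^bsub>D\<^esub>)"
  have pc: "p w \<in> carrier D" if "w \<in> lists (carrier V)" for w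
    using that by (induction w) (auto simp: p_def fc)
  have p_append: "p (u @ v) = p u \<otimes>\<^bsub>D\<^esub> p v" if "u \<in> lists (carrier V)" "v \<in> lists (carrier V)" for u v
    using that(1)
  proof (induction u)
    case Nil
    then show ?case using pc[OF that(2)] by (simp add: p_def)
  next
    case (Cons x u)
    then show ?case using fc[of x] pc[of u] pc[OF that(2)] by (simp add: p_def D.m_assoc)
  qed
  have p1: "p [x] = f x" if "x \<in> carrier V" for x using fc[OF that] by (simp add: p_def)
  define h where "h = free_lift K D p"
  have hl: "h \<in> lin_hom K F D"
    unfolding h_def lin_hom_word_algebra by (rule free_lift_lin_hom[OF mD]) (auto simp: pc)
  have he: "h (e w) = p w" if "w \<in> lists (carrier V)" for w
    unfolding h_def by (rule free_lift_basis[where g = p, OF mD pc[OF that]])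
  note hc = lin_hom_closed[OF hl]
  note bl = bilinear_map_left[OF bil] and br = bilinear_map_right[OF bil]
  \<comment> \<open>Multiplicativity holds on pairs of words by \<open>p_append\<close>; it is
    extended linearly in the right factor here and in the left factor next.\<close>
  have h1: "h (e u \<otimes>\<^bsub>F\<^esub> d) = h (e u) \<otimes>\<^bsub>D\<^esub> h d" if u: "u \<in> lists (carrier V)" and d: "d \<in> carrier F" for u d
    by (rule word_algebra_hom_eq[OF K mD lin_hom_comp[OF hl br[OF bc[OF u]]]
          lin_hom_mult_right[OF D hl hc[OF bc[OF u]]] _ d])
      (simp add: basis_word_mult[OF K] he u p_append)
  have hm: "h (c \<otimes>\<^bsub>F\<^esub> d) = h c \<otimes>\<^bsub>D\<^esub> h d" if c: "c \<in> carrier F" and d: "d \<in> carrier F" for c d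
    by (rule word_algebra_hom_eq[OF K mD lin_hom_comp[OF hl bl[OF d]]
          lin_hom_mult_left[OF D hl hc[OF d]] h1[OF _ d] c])
  have h: "h \<in> alg_hom K F D"
    using he[of "[]"] by (intro alg_homI hl hm) (simp_all add: word_algebra_simps p_def)
  have diff: "h (c \<ominus>\<^bsub>F\<^esub> d) = \<zero>\<^bsub>D\<^esub>" if "c \<in> carrier F" "d \<in> carrier F" "h c = h d" for c d
    using that hc module_diff_eq_zero_iff[OF mD] by (simp add: lin_hom_diff[OF mF mD hl])
  have pxy: "p (u @ [x] @ v) = p u \<otimes>\<^bsub>D\<^esub> f x \<otimes>\<^bsub>D\<^esub> p v"
    if "u \<in> lists (carrier V)" "v \<in> lists (carrier V)" "x \<in> carrier V" for u v x
    using that by (simp add: p_append[of u "[x] @ v"] p_append[of "[x]" v] p1 pc fc D.m_assoc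
        del: append_Cons append_Nil)
  have rel: "h r = \<zero>\<^bsub>D\<^esub>" if "r \<in> multilinear_relations K V" for r
  proof -
    have wc: "u @ [x] @ v \<in> lists (carrier V)"
      if "u \<in> lists (carrier V)" "v \<in> lists (carrier V)" "x \<in> carrier V" for u v x
      using that by auto
    note wcl = bc[OF wc]
    show ?thesis
      using that unfolding multilinear_relations_def Let_def
      by (elim UnE CollectE exE conjE; hypsubst;
          intro diff wcl F.add.m_closed F.smult_closed;
          (simp del: append_Cons append_Nil add: lin_hom_add[OF hl] lin_hom_smult[OF hl] wcl he[OF wc] pxy pc fc
            lin_hom_add[OF f] lin_hom_smult[OF f] D.l_distr D.r_distr D.smult_mult_left D.smult_mult_right)?)
  qed
  have van: "h n = \<zero>\<^bsub>D\<^esub>" if "n \<in> N" for n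
    using lin_hom_vanishes_span[OF mF mD hl multilinear_relations_subset rel] that
    by (simp add: tensor_algebra_null_def)
  show ?thesis
  proof (rule that)
    show "(\<lambda>X. the_elem (h ` X)) \<in> alg_hom K (tensor_algebra K V) D"
      unfolding tensor_algebra_def by (rule Q.quot_lift_alg_hom[OF D h van])
    fix x assume x: "x \<in> carrier V"
    then show "the_elem (h ` tensor_algebra_incl K V x) = f x"
      unfolding tensor_algebra_incl_def
      using Q.Q.quot_lift_coset[OF mD hl van bc[of "[x]"]] he[of "[x]"] p1 by simp
  qed
qed

end

section \<open>The Sweedler product\<close>

context
  fixes K :: "('k, 'z) ring_scheme" and A :: "('k, 'a, 'm) module_scheme" and L :: "('k, 'l, 'n) coalg_scheme"
  assumes A: "assoc_algebra K A" and L: "coalgebra K L"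
begin

private lemmas module_A = assoc_algebra_module[OF A] and module_L = coalgebra_module[OF L]
private lemmas mAL = module_tensor_module[OF module_A module_L]
private lemmas comult_closed_L = comult_closed[OF L]
private abbreviation (input) "TA \<equiv> tensor_algebra K (tensor_module K A L)"
private abbreviation (input) "I \<equiv> sweedler_ideal K A L"
private abbreviation (input) "\<iota> a h \<equiv> tensor_algebra_incl K (tensor_module K A L) (tens K A L a h)"

interpretation A: assoc_algebra K A by (rule A)
interpretation TA: assoc_algebra K TA by (rule assoc_algebra_tensor_algebra[OF mAL])

private lemmas aTA = assoc_algebra_tensor_algebra[OF mAL]
private lemmas mTA = assoc_algebra_module[OF aTA]

private lemma incl_bilinear: "bilinear_map K A L TA \<iota>"
  by (rule bilinear_map_comp[OF tensor_algebra_incl_lin_hom[OF mAL] tens_bilinear[OF module_A module_L]])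

private lemma incl_mult_bilinear:
  "a \<in> carrier A \<Longrightarrow> a' \<in> carrier A \<Longrightarrow> bilinear_map K L L TA (\<lambda>x y. \<iota> a x \<otimes>\<^bsub>TA\<^esub> \<iota> a' y)"
  by (intro bilinear_map_mult[OF aTA] bilinear_map_right[OF incl_bilinear])

lemma sweedler_relations_subset: "sweedler_relations K A L \<subseteq> carrier TA"
  unfolding sweedler_relations_def Let_def
  using counit_closed[OF L]
  by (auto intro!: TA.minus_closed TA.smult_closed bilinear_map_closed[OF incl_bilinear]
      tsum_closed[OF module_L module_L mTA incl_mult_bilinear] comult_closed_L)

interpretation Q: algebra_quotient K TA I
  unfolding sweedler_ideal_def
  by (intro algebra_quotient.intro aTA TA.genideal_ideal sweedler_relations_subset)

lemma assoc_algebra_sweedler_product: "assoc_algebra K (sweedler_product K A L)"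
  unfolding sweedler_product_def by (rule Q.assoc_algebra_quot)

private lemma sweedler_proj: "(\<lambda>x. I +>\<^bsub>TA\<^esub> x) \<in> alg_hom K TA (sweedler_product K A L)"
  unfolding sweedler_product_def by (rule Q.quot_proj_alg_hom)

private lemmas sweedler_proj_lin = alg_hom_lin_hom[OF sweedler_proj]

private abbreviation (input) "S \<equiv> sweedler_product K A L"
private abbreviation (input) "gen \<equiv> sweedler_gen K A L"

lemma sweedler_gen_bilinear: "bilinear_map K A L S gen"
  unfolding sweedler_gen_def[abs_def] by (rule bilinear_map_comp[OF sweedler_proj_lin incl_bilinear])

private lemma rel_eq:
  assumes "x \<ominus>\<^bsub>TA\<^esub> y \<in> sweedler_relations K A L" "x \<in> carrier TA" "y \<in> carrier TA"
  shows "I +>\<^bsub>TA\<^esub> x = I +>\<^bsub>TA\<^esub> y"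
  using subsetD[OF TA.genideal_self[OF sweedler_relations_subset] assms(1), folded sweedler_ideal_def]
    Q.Q.quot_eq_iff[OF assms(2,3)] by simp

text \<open>The defining relation holds in the quotient, and the projection, being an algebra map,
  passes under the Sweedler sum and splits over the product there.\<close>

lemma sweedler_gen_mult:
  assumes a: "a \<in> carrier A" "a' \<in> carrier A" and h: "h \<in> carrier L"
  shows "gen (a \<otimes>\<^bsub>A\<^esub> a') h = tsum K S (\<lambda>x y. gen a x \<otimes>\<^bsub>S\<^esub> gen a' y) (comult L h)"
proof -
  note mS = assoc_algebra_module[OF assoc_algebra_sweedler_product]
  note b = incl_mult_bilinear[OF a]
  have "\<iota> (a \<otimes>\<^bsub>A\<^esub> a') h \<ominus>\<^bsub>TA\<^esub> tsum K TA (\<lambda>x y. \<iota> a x \<otimes>\<^bsub>TA\<^esub> \<iota> a' y) (comult L h) \<in> sweedler_relations K A L"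
    using a h unfolding sweedler_relations_def Let_def by blast
  from rel_eq[OF this bilinear_map_closed[OF incl_bilinear A.m_closed[OF a] h] tsum_closed[OF module_L module_L mTA b comult_closed_L[OF h]]]
  have "gen (a \<otimes>\<^bsub>A\<^esub> a') h = I +>\<^bsub>TA\<^esub> tsum K TA (\<lambda>x y. \<iota> a x \<otimes>\<^bsub>TA\<^esub> \<iota> a' y) (comult L h)"
    by (simp add: sweedler_gen_def)
  also have "\<dots> = tsum K S (\<lambda>x y. I +>\<^bsub>TA\<^esub> (\<iota> a x \<otimes>\<^bsub>TA\<^esub> \<iota> a' y)) (comult L h)"
    by (rule tsum_hom[OF module_L module_L mTA mS sweedler_proj_lin b comult_closed_L[OF h]])
  also have "\<dots> = tsum K S (\<lambda>x y. gen a x \<otimes>\<^bsub>S\<^esub> gen a' y) (comult L h)"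
    by (rule tsum_cong[OF module_L module_L mS bilinear_map_comp[OF sweedler_proj_lin b] comult_closed_L[OF h], symmetric])
      (simp add: sweedler_gen_def alg_hom_mult[OF sweedler_proj] bilinear_map_closed[OF incl_bilinear] a)
  finally show ?thesis .
qed

lemma sweedler_gen_one:
  assumes h: "h \<in> carrier L"
  shows "gen \<one>\<^bsub>A\<^esub> h = counit L h \<odot>\<^bsub>S\<^esub> \<one>\<^bsub>S\<^esub>"
proof -
  note c = counit_closed[OF L h]
  have "\<iota> \<one>\<^bsub>A\<^esub> h \<ominus>\<^bsub>TA\<^esub> (counit L h \<odot>\<^bsub>TA\<^esub> \<one>\<^bsub>TA\<^esub>) \<in> sweedler_relations K A L"
    using h unfolding sweedler_relations_def Let_def by blast
  from rel_eq[OF this bilinear_map_closed[OF incl_bilinear A.one_closed h] TA.smult_closed[OF c TA.one_closed]]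
  show ?thesis
    using c by (simp add: sweedler_gen_def lin_hom_smult[OF sweedler_proj_lin] alg_hom_one[OF sweedler_proj])
qed

text \<open>The canonical measuring \<open>L -> Hom(A, A <| L)\<close>. Every measuring of
  \<open>A\<close> by \<open>L\<close> arises from it by composing with an algebra map out of
  \<open>A <| L\<close>.\<close>

lemma sweedler_gen_measuring: "alg_measuring K L A S (\<lambda>l. \<lambda>a\<in>carrier A. gen a l)"
proof -
  have "bilinear_map K L A S (\<lambda>l a. gen a l)"
    by (intro bilinear_mapI bilinear_map_left[OF sweedler_gen_bilinear] bilinear_map_right[OF sweedler_gen_bilinear])
  then have "bilinear_map K L A S (\<lambda>l. \<lambda>a\<in>carrier A. gen a l)"
    by (rule bilinear_map_cong[OF module_L module_A]) simp
  then show ?thesis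
    unfolding alg_measuring_iff[OF module_L module_A] by (simp add: sweedler_gen_mult sweedler_gen_one)
qed

text \<open>Agreement spreads from pure tensors to all tensors by linearity, and from these to the
  tensor algebra by multiplicativity; the projection onto the quotient is onto.\<close>

lemma sweedler_product_hom_eq:
  assumes D: "assoc_algebra K D" and f: "f \<in> alg_hom K S D" and g: "g \<in> alg_hom K S D"
    and fg: "\<And>a h. a \<in> carrier A \<Longrightarrow> h \<in> carrier L \<Longrightarrow> f (gen a h) = g (gen a h)"
    and X: "X \<in> carrier S"
  shows "f X = g X"
proof -
  note f' = alg_hom_comp[OF f sweedler_proj] and g' = alg_hom_comp[OF g sweedler_proj]
  note i = tensor_algebra_incl_lin_hom[OF mAL]
  have "f (I +>\<^bsub>TA\<^esub> tensor_algebra_incl K (tensor_module K A L) t) =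
      g (I +>\<^bsub>TA\<^esub> tensor_algebra_incl K (tensor_module K A L) t)" if "t \<in> carrier (tensor_module K A L)" for t
    by (rule tensor_hom_eq[OF module_A module_L assoc_algebra_module[OF D] lin_hom_comp[OF alg_hom_lin_hom[OF f'] i]
          lin_hom_comp[OF alg_hom_lin_hom[OF g'] i] _ that])
      (use fg in \<open>simp add: sweedler_gen_def\<close>)
  note t = tensor_algebra_hom_eq[OF mAL D f' g' this]
  obtain c where "c \<in> carrier TA" "X = I +>\<^bsub>TA\<^esub> c"
    using X by (auto simp: sweedler_product_def Q.Q.quot_carrier)
  then show ?thesis using t by simp
qed

text \<open>The measuring is a linear map on the tensor product, hence an algebra map on the tensor
  algebra. Its two conditions say that this map kills the two families of Sweedler
  relations.\<close>

lemma sweedler_product_lift: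
  assumes D: "assoc_algebra K D" and \<rho>: "alg_measuring K L A D \<rho>"
  obtains g where "g \<in> alg_hom K S D"
    and "\<And>a h. a \<in> carrier A \<Longrightarrow> h \<in> carrier L \<Longrightarrow> g (gen a h) = \<rho> h a"
proof -
  interpret D: assoc_algebra K D by (rule D)
  note mD = assoc_algebra_module[OF D]
  note r = \<rho>[unfolded alg_measuring_iff[OF module_L module_A]]
  have b: "bilinear_map K L A D \<rho>" using r by blast
  have b': "bilinear_map K A L D (\<lambda>a h. \<rho> h a)"
    by (intro bilinear_mapI bilinear_map_left[OF b] bilinear_map_right[OF b])
  obtain g where g: "g \<in> alg_hom K TA D"
    and gt: "\<And>t. t \<in> carrier (tensor_module K A L) \<Longrightarrow>
      g (tensor_algebra_incl K (tensor_module K A L) t) = tsum K D (\<lambda>a h. \<rho> h a) t"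
    using tensor_algebra_lift[OF mAL D tsum_lin_hom[OF module_A module_L mD b']] by blast
  note gl = alg_hom_lin_hom[OF g]
  have gi: "g (\<iota> a h) = \<rho> h a" if "a \<in> carrier A" "h \<in> carrier L" for a h
    using that by (simp add: gt tens_closed[OF module_A module_L] tsum_tens[OF module_A module_L mD b'])
  have diff: "g (x \<ominus>\<^bsub>TA\<^esub> y) = \<zero>\<^bsub>D\<^esub>" if "x \<in> carrier TA" "y \<in> carrier TA" "g x = g y" for x y
    using that lin_hom_closed[OF gl] module_diff_eq_zero_iff[OF mD] by (simp add: lin_hom_diff[OF mTA mD gl])
  note ic = bilinear_map_closed[OF incl_bilinear]
  have rel: "g x = \<zero>\<^bsub>D\<^esub>" if "x \<in> sweedler_relations K A L" for x
  proof -
    have 1: "g (\<iota> (a \<otimes>\<^bsub>A\<^esub> a') h \<ominus>\<^bsub>TA\<^esub> tsum K TA (\<lambda>x y. \<iota> a x \<otimes>\<^bsub>TA\<^esub> \<iota> a' y) (comult L h)) = \<zero>\<^bsub>D\<^esub>"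
      if a: "a \<in> carrier A" "a' \<in> carrier A" and h: "h \<in> carrier L" for a a' h
    proof (rule diff[OF ic[OF A.m_closed[OF a] h] tsum_closed[OF module_L module_L mTA incl_mult_bilinear[OF a] comult_closed_L[OF h]]])
      have "g (tsum K TA (\<lambda>x y. \<iota> a x \<otimes>\<^bsub>TA\<^esub> \<iota> a' y) (comult L h)) =
          tsum K D (\<lambda>x y. g (\<iota> a x \<otimes>\<^bsub>TA\<^esub> \<iota> a' y)) (comult L h)"
        by (rule tsum_hom[OF module_L module_L mTA mD gl incl_mult_bilinear[OF a] comult_closed_L[OF h]])
      also have "\<dots> = tsum K D (\<lambda>x y. \<rho> x a \<otimes>\<^bsub>D\<^esub> \<rho> y a') (comult L h)"
        by (rule tsum_cong[OF module_L module_L mD _ comult_closed_L[OF h]])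
          (simp_all add: bilinear_map_mult[OF D] bilinear_map_left[OF b] a alg_hom_mult[OF g] ic gi)
      finally show "g (\<iota> (a \<otimes>\<^bsub>A\<^esub> a') h) = g (tsum K TA (\<lambda>x y. \<iota> a x \<otimes>\<^bsub>TA\<^esub> \<iota> a' y) (comult L h))"
        using r a h by (simp add: gi)
    qed
    have 2: "g (\<iota> \<one>\<^bsub>A\<^esub> h \<ominus>\<^bsub>TA\<^esub> (counit L h \<odot>\<^bsub>TA\<^esub> \<one>\<^bsub>TA\<^esub>)) = \<zero>\<^bsub>D\<^esub>" if h: "h \<in> carrier L" for h
      using r h counit_closed[OF L h]
      by (intro diff ic) (simp_all add: gi lin_hom_smult[OF gl] alg_hom_one[OF g])
    show ?thesis using that unfolding sweedler_relations_def Let_def by (auto simp: 1 2)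
  qed
  \<comment> \<open>The relations generate \<open>I\<close> as an ideal rather than as a span, so
    vanishing on \<open>I\<close> comes from the kernel being an ideal that contains them.\<close>
  have "ring_hom_ring TA D g"
    using g by (intro ring_hom_ringI2 TA.ring_axioms D.ring_axioms) (simp add: alg_hom_def)
  then have "ideal (a_kernel TA D g) TA" by (rule ring_hom_ring.kernel_is_ideal)
  moreover have "sweedler_relations K A L \<subseteq> a_kernel TA D g"
    using rel sweedler_relations_subset by (auto simp: a_kernel_def')
  ultimately have "I \<subseteq> a_kernel TA D g"
    unfolding sweedler_ideal_def by (rule TA.genideal_minimal)
  then have van: "g x = \<zero>\<^bsub>D\<^esub>" if "x \<in> I" for x using that by (auto simp: a_kernel_def')
  show ?thesis
  proof (rule that)
    show "(\<lambda>X. the_elem (g ` X)) \<in> alg_hom K S D"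
      unfolding sweedler_product_def by (rule Q.quot_lift_alg_hom[OF D g van])
    show "the_elem (g ` gen a h) = \<rho> h a" if "a \<in> carrier A" "h \<in> carrier L" for a h
      unfolding sweedler_gen_def using Q.Q.quot_lift_coset[OF mD gl van ic[OF that]] gi[OF that] by simp
  qed
qed

end

section \<open>Pullback of measurings along coalgebra maps, and functoriality in
  \<open>L\<close>\<close>

lemma alg_measuring_comp_coalg_hom:
  assumes P: "coalgebra K P" and H: "coalgebra K H" and A: "assoc_algebra K A" and B: "assoc_algebra K B"
    and \<rho>: "alg_measuring K P A B \<rho>" and u: "u \<in> coalg_hom K H P"
  shows "alg_measuring K H A B (\<lambda>h. \<rho> (u h))"
proof -
  interpret A: assoc_algebra K A by (rule A)
  note mP = coalgebra_module[OF P] and mA = assoc_algebra_module[OF A] and mH = coalgebra_module[OF H]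
    and mB = assoc_algebra_module[OF B]
  note ul = coalg_hom_lin_hom[OF u] and uc = lin_hom_closed[OF coalg_hom_lin_hom[OF u]]
  note r = \<rho>[unfolded alg_measuring_iff[OF mP mA]]
  have b: "bilinear_map K P A B \<rho>" using r by blast
  note s = sweedler_coalg_hom[OF H P mB u bilinear_map_mult[OF B bilinear_map_left[OF b] bilinear_map_left[OF b]]]
  show ?thesis
    unfolding alg_measuring_iff[OF mH mA]
    using r s bilinear_map_comp2[OF b ul lin_hom_ident]
    by (simp add: uc coalg_hom_counit[OF u])
qed

text \<open>Resolves the definite description. Existence is the lift of the canonical measuring of
  \<open>A\<close> by \<open>L'\<close> pulled back along \<open>f\<close>; uniqueness holds because
  the generators determine an algebra map and extensionality fixes it off the carrier.\<close>

lemma sweedler_map: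
  assumes A: "assoc_algebra K A" and L: "coalgebra K L" and L': "coalgebra K L'" and f: "f \<in> coalg_hom K L L'"
  shows "sweedler_map K A L L' f \<in> alg_hom K (sweedler_product K A L) (sweedler_product K A L')"
    and "a \<in> carrier A \<Longrightarrow> h \<in> carrier L \<Longrightarrow>
      sweedler_map K A L L' f (sweedler_gen K A L a h) = sweedler_gen K A L' a (f h)"
proof -
  let ?S = "sweedler_product K A L" and ?S' = "sweedler_product K A L'"
  let ?P = "\<lambda>g. g \<in> alg_hom K ?S ?S' \<inter> extensional (carrier ?S) \<and>
    (\<forall>a\<in>carrier A. \<forall>h\<in>carrier L. g (sweedler_gen K A L a h) = sweedler_gen K A L' a (f h))"
  note aS = assoc_algebra_sweedler_product[OF A L] and aS' = assoc_algebra_sweedler_product[OF A L']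
  interpret A: assoc_algebra K A by (rule A)
  interpret S: assoc_algebra K ?S by (rule aS)
  from sweedler_product_lift[OF A L aS'
      alg_measuring_comp_coalg_hom[OF L' L A aS' sweedler_gen_measuring[OF A L'] f]]
  obtain g where g: "g \<in> alg_hom K ?S ?S'"
    and g': "\<And>a h. a \<in> carrier A \<Longrightarrow> h \<in> carrier L \<Longrightarrow>
      g (sweedler_gen K A L a h) = (\<lambda>a\<in>carrier A. sweedler_gen K A L' a (f h)) a"
    by blast
  have gg: "g (sweedler_gen K A L a h) = sweedler_gen K A L' a (f h)" if "a \<in> carrier A" "h \<in> carrier L" for a h
    using g'[OF that] that by simp
  have "restrict g (carrier ?S) \<in> alg_hom K ?S ?S'"
    by (rule alg_homI[OF lin_hom_cong[OF assoc_algebra_module[OF aS] alg_hom_lin_hom[OF g]]])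
      (simp_all add: alg_hom_one[OF g] alg_hom_mult[OF g])
  then have P: "?P (restrict g (carrier ?S))"
    using gg bilinear_map_closed[OF sweedler_gen_bilinear[OF A L]] by simp
  have un: "h = restrict g (carrier ?S)" if "?P h" for h
    using that P sweedler_product_hom_eq[OF A L aS', of h "restrict g (carrier ?S)"]
    by (intro extensionalityI[of _ "carrier ?S"]) auto
  have "sweedler_map K A L L' f = restrict g (carrier ?S)"
    unfolding sweedler_map_def using P un by (rule the_equality)
  then show "sweedler_map K A L L' f \<in> alg_hom K ?S ?S'"
    and "a \<in> carrier A \<Longrightarrow> h \<in> carrier L \<Longrightarrow>
      sweedler_map K A L L' f (sweedler_gen K A L a h) = sweedler_gen K A L' a (f h)"
    using P by auto
qed

text \<open>\<open>[f, B]\<close> corresponds to the evaluation measuring \<open>L' \<rightarrow> Hom([L', B], B)\<close> pulled back along \<open>f\<close>.\<close>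

lemma conv_map_alg_hom:
  assumes L: "coalgebra K L" and L': "coalgebra K L'" and B: "assoc_algebra K B" and f: "f \<in> coalg_hom K L L'"
  shows "conv_map L f \<in> alg_hom K (conv_algebra K L' B) (conv_algebra K L B)"
proof -
  let ?M = "conv_algebra K L B" and ?M' = "conv_algebra K L' B"
  note aM' = assoc_algebra_conv_algebra[OF L' B]
  interpret M': assoc_algebra K ?M' by (rule aM')
  have "(\<lambda>\<alpha>. \<alpha>) \<in> alg_hom K ?M' ?M'" by (intro alg_homI lin_hom_ident) simp_all
  note ev = alg_hom_alg_measuring[OF L' aM' B this]
  note g = alg_measuring_alg_hom[OF L aM' B alg_measuring_comp_coalg_hom[OF L' L aM' B ev f]]
  have e: "conv_map L f \<alpha> = (\<lambda>l\<in>carrier L. (\<lambda>\<alpha>\<in>carrier ?M'. \<alpha> (f l)) \<alpha>)" if "\<alpha> \<in> carrier ?M'" for \<alpha>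
    using that by (simp add: conv_map_def compose_def)
  show ?thesis
    by (rule alg_homI[OF lin_hom_cong[OF assoc_algebra_module[OF aM'] alg_hom_lin_hom[OF g] e]])
      (simp_all only: e M'.one_closed M'.m_closed alg_hom_one[OF g] alg_hom_mult[OF g])
qed

text \<open>Inside the sum over \<open>P\<close>, the parts of \<open>f l\<close> are replaced by
  the images of the parts of \<open>l\<close>, which is where \<open>f\<close> being a coalgebra map
  enters.\<close>

lemma coalg_measuring_precomp:
  assumes P: "coalgebra K P" and L: "coalgebra K L" and L': "coalgebra K L'" and D: "coalgebra K D"
    and lam: "coalg_measuring K P L' D lam" and f: "f \<in> coalg_hom K L L'"
  shows "coalg_measuring K P L D (\<lambda>p. compose (carrier L) (lam p) f)"
proof -
  note mP = coalgebra_module[OF P] and mL = coalgebra_module[OF L]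
    and mD = coalgebra_module[OF D]
  note mDD = module_tensor_module[OF mD mD]
  note fl = coalg_hom_lin_hom[OF f] and fc = lin_hom_closed[OF coalg_hom_lin_hom[OF f]]
  note r = lam[unfolded coalg_measuring_iff[OF P L' D]]
  have b: "bilinear_map K P L' D lam" using r by blast
  note b2 = bilinear_map_comp2[OF b lin_hom_ident fl]
  have b': "bilinear_map K P L D (\<lambda>p. compose (carrier L) (lam p) f)"
    by (rule bilinear_map_cong[OF mP mL b2]) (simp add: compose_def)
  let ?DD = "tensor_module K D D"
  let ?t = "\<lambda>p' l' p'' l''. tens K D D (lam p' l') (lam p'' l'')"
  note tb = bilinear_map_comp2[OF tens_bilinear[OF mD mD]]
  have "comult D (lam p (f l)) = tsum K ?DD (\<lambda>p' p''. tsum K ?DD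
      (\<lambda>l' l''. tens K D D (compose (carrier L) (lam p') f l') (compose (carrier L) (lam p'') f l''))
      (comult L l)) (comult P p)"
    if p: "p \<in> carrier P" and l: "l \<in> carrier L" for p l
  proof -
    have "comult D (lam p (f l)) = tsum K ?DD (\<lambda>p' p''. tsum K ?DD (\<lambda>l' l''. ?t p' l' p'' l'') (comult L' (f l))) (comult P p)"
      using r p fc[OF l] by simp
    also have "\<dots> = tsum K ?DD (\<lambda>p' p''. tsum K ?DD
        (\<lambda>l' l''. tens K D D (compose (carrier L) (lam p') f l') (compose (carrier L) (lam p'') f l''))
        (comult L l)) (comult P p)"
    proof (rule tsum_cong[OF mP mP mDD _ comult_closed[OF P p]])
      show "bilinear_map K P P ?DD (\<lambda>p' p''. tsum K ?DD
        (\<lambda>l' l''. tens K D D (compose (carrier L) (lam p') f l') (compose (carrier L) (lam p'') f l'')) (comult L l))"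
        by (rule double_sweedler_bilinear(2)[OF P L mDD tb[OF bilinear_map_right[OF b'] bilinear_map_right[OF b']]
              tb[OF bilinear_map_left[OF b'] bilinear_map_left[OF b']] l])
      fix p' p'' assume pp: "p' \<in> carrier P" "p'' \<in> carrier P"
      have "tsum K ?DD (\<lambda>l' l''. ?t p' l' p'' l'') (comult L' (f l)) =
          tsum K ?DD (\<lambda>l' l''. ?t p' (f l') p'' (f l'')) (comult L l)"
        by (rule sweedler_coalg_hom[OF L L' mDD f tb[OF bilinear_map_right[OF b pp(1)] bilinear_map_right[OF b pp(2)]] l])
      also have "\<dots> = tsum K ?DD (\<lambda>l' l''.
          tens K D D (compose (carrier L) (lam p') f l') (compose (carrier L) (lam p'') f l'')) (comult L l)"
        by (rule tsum_cong[OF mL mL mDD tb[OF bilinear_map_right[OF b' pp(1)] bilinear_map_right[OF b' pp(2)]]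
              comult_closed[OF L l]]) (simp add: compose_def)
      finally show "tsum K ?DD (\<lambda>l' l''. ?t p' l' p'' l'') (comult L' (f l)) = \<dots>" .
    qed
    finally show ?thesis .
  qed
  then show ?thesis
    using r b' unfolding coalg_measuring_iff[OF P L D]
    by (auto simp: compose_eq fc coalg_hom_counit[OF f])
qed

lemma coalg_measuring_comp:
  assumes P: "coalgebra K P" and H: "coalgebra K H" and L: "coalgebra K L" and D: "coalgebra K D"
    and lam: "coalg_measuring K P L D lam" and u: "u \<in> coalg_hom K H P"
  shows "coalg_measuring K H L D (\<lambda>h. lam (u h))"
proof -
  note mD = coalgebra_module[OF D]
  note mDD = module_tensor_module[OF mD mD]
  note ul = coalg_hom_lin_hom[OF u] and uc = lin_hom_closed[OF coalg_hom_lin_hom[OF u]]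
  note r = lam[unfolded coalg_measuring_iff[OF P L D]]
  have b: "bilinear_map K P L D lam" using r by blast
  note tb = bilinear_map_comp2[OF tens_bilinear[OF mD mD]]
  have "bilinear_map K P P (tensor_module K D D) (\<lambda>p' p''. tsum K (tensor_module K D D)
      (\<lambda>l' l''. tens K D D (lam p' l') (lam p'' l'')) (comult L l))" if "l \<in> carrier L" for l
    by (rule double_sweedler_bilinear(2)[OF P L mDD tb[OF bilinear_map_right[OF b] bilinear_map_right[OF b]]
          tb[OF bilinear_map_left[OF b] bilinear_map_left[OF b]] that])
  note s = sweedler_coalg_hom[OF H P mDD u this]
  show ?thesis
    unfolding coalg_measuring_iff[OF H L D]
    using r s bilinear_map_comp2[OF b ul lin_hom_ident]
    by (simp add: uc coalg_hom_counit[OF u])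
qed

section \<open>Universal measuring coalgebras\<close>

lemma factors_viaI:
  assumes "coalgebra K H" "coalgebra K P" "u \<in> coalg_hom K H P" "\<And>h. h \<in> carrier H \<Longrightarrow> \<pi> (u h) = \<rho> h"
  shows "factors_via K H \<rho> P \<pi> (restrict u (carrier H))"
  using coalg_hom_cong[OF assms(1-3), of "restrict u (carrier H)"] assms(4) by (simp add: factors_via_def)

lemma universal_alg_measuring_coalgebra: "universal_alg_measuring TYPE('h) K A B P \<pi> \<Longrightarrow> coalgebra K P"
  and universal_alg_measuring_measuring: "universal_alg_measuring TYPE('h) K A B P \<pi> \<Longrightarrow> alg_measuring K P A B \<pi>"
  by (simp_all add: universal_alg_measuring_def)

lemma universal_coalg_measuring_coalgebra: "universal_coalg_measuring TYPE('h) K A B P \<pi> \<Longrightarrow> coalgebra K P"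
  and universal_coalg_measuring_measuring: "universal_coalg_measuring TYPE('h) K A B P \<pi> \<Longrightarrow> coalg_measuring K P A B \<pi>"
  by (simp_all add: universal_coalg_measuring_def)

lemma universal_alg_measuring_ex1:
  fixes H :: "('k, 'h) coalg"
  assumes "universal_alg_measuring TYPE('h) K A B P \<pi>" "coalgebra K H" "alg_measuring K H A B \<rho>"
  shows "\<exists>!u. factors_via K H \<rho> P \<pi> u"
  using assms by (simp add: universal_alg_measuring_def)

lemma universal_coalg_measuring_ex1:
  fixes H :: "('k, 'h) coalg"
  assumes "universal_coalg_measuring TYPE('h) K A B P \<pi>" "coalgebra K H" "coalg_measuring K H A B \<rho>"
  shows "\<exists>!u. factors_via K H \<rho> P \<pi> u"
  using assms by (simp add: universal_coalg_measuring_def)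

text \<open>After restriction both \<open>u\<close> and \<open>v\<close> factor the same measuring,
  \<pi> composed with \<open>v\<close>. Unique existence is therefore required at that measuring
  only, which makes the argument common to algebras and coalgebras.\<close>

lemma factors_via_unique:
  assumes H: "coalgebra K H" and P: "coalgebra K P" and ex1: "\<exists>!w. factors_via K H (\<lambda>h. \<pi> (v h)) P \<pi> w"
    and u: "u \<in> coalg_hom K H P" and v: "v \<in> coalg_hom K H P"
    and e: "\<And>h. h \<in> carrier H \<Longrightarrow> \<pi> (u h) = \<pi> (v h)" and h: "h \<in> carrier H"
  shows "u h = v h"
proof -
  have "factors_via K H (\<lambda>h. \<pi> (v h)) P \<pi> (restrict u (carrier H))"
    by (rule factors_viaI[OF H P u]) (rule e)
  moreover have "factors_via K H (\<lambda>h. \<pi> (v h)) P \<pi> (restrict v (carrier H))"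
    by (rule factors_viaI[OF H P v]) simp
  ultimately have "restrict u (carrier H) = restrict v (carrier H)" using ex1 by blast
  then show ?thesis using h by (metis restrict_apply)
qed

text \<open>Cancellation of \<pi>: its composite with a coalgebra map is again a measuring, to which
  the universal property applies.\<close>

lemma universal_alg_measuring_unique:
  fixes H :: "('k, 'h) coalg"
  assumes U: "universal_alg_measuring TYPE('h) K A B P \<pi>" and A: "assoc_algebra K A" and B: "assoc_algebra K B"
    and H: "coalgebra K H" and u: "u \<in> coalg_hom K H P" and v: "v \<in> coalg_hom K H P"
    and e: "\<And>h. h \<in> carrier H \<Longrightarrow> \<pi> (u h) = \<pi> (v h)" and h: "h \<in> carrier H"
  shows "u h = v h"
proof -
  note P = universal_alg_measuring_coalgebra[OF U]
  show ?thesis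
    by (rule factors_via_unique[OF H P universal_alg_measuring_ex1[OF U H] u v e h])
      (rule alg_measuring_comp_coalg_hom[OF P H A B universal_alg_measuring_measuring[OF U] v])
qed

lemma universal_coalg_measuring_unique:
  fixes H :: "('k, 'h) coalg"
  assumes U: "universal_coalg_measuring TYPE('h) K L D P \<pi>" and L: "coalgebra K L" and D: "coalgebra K D"
    and H: "coalgebra K H" and u: "u \<in> coalg_hom K H P" and v: "v \<in> coalg_hom K H P"
    and e: "\<And>h. h \<in> carrier H \<Longrightarrow> \<pi> (u h) = \<pi> (v h)" and h: "h \<in> carrier H"
  shows "u h = v h"
proof -
  note P = universal_coalg_measuring_coalgebra[OF U]
  show ?thesis
    by (rule factors_via_unique[OF H P universal_coalg_measuring_ex1[OF U H] u v e h])
      (rule coalg_measuring_comp[OF P H L D universal_coalg_measuring_measuring[OF U] v])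
qed

lemma universal_alg_measuring_factor:
  fixes H :: "('k, 'h) coalg"
  assumes "universal_alg_measuring TYPE('h) K A B P \<pi>" "coalgebra K H" "alg_measuring K H A B \<rho>"
  obtains u where "u \<in> coalg_hom K H P" and "\<And>h. h \<in> carrier H \<Longrightarrow> \<pi> (u h) = \<rho> h"
  using ex1_implies_ex[OF universal_alg_measuring_ex1[OF assms]] unfolding factors_via_def by blast

lemma universal_coalg_measuring_factor:
  fixes H :: "('k, 'h) coalg"
  assumes "universal_coalg_measuring TYPE('h) K L D P \<pi>" "coalgebra K H" "coalg_measuring K H L D \<rho>"
  obtains u where "u \<in> coalg_hom K H P" and "\<And>h. h \<in> carrier H \<Longrightarrow> \<pi> (u h) = \<rho> h"
  using ex1_implies_ex[OF universal_coalg_measuring_ex1[OF assms]] unfolding factors_via_def by blast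

lemma coalg_isoI:
  assumes "f \<in> coalg_hom K P Q" "g \<in> coalg_hom K Q P"
    and "\<And>p. p \<in> carrier P \<Longrightarrow> g (f p) = p" "\<And>q. q \<in> carrier Q \<Longrightarrow> f (g q) = q"
  shows "f \<in> coalg_iso K P Q"
proof -
  have "bij_betw f (carrier P) (carrier Q)"
    using assms coalg_hom_closed[OF assms(1)] coalg_hom_closed[OF assms(2)]
    by (intro bij_betw_byWitness[where f' = g]) auto
  then show ?thesis using assms(1) by (simp add: coalg_iso_def)
qed

section \<open>The three kinds of measurings\<close>

text \<open>As an algebra map \<open>A <| L -> [H, B]\<close>, \<rho> can be composed with the
  canonical measuring \<open>L -> Hom(A, A <| L)\<close>. The result is a measuring by
  \<open>L\<close> into \<open>[H, B]\<close>, and exchanging \<open>H\<close> and \<open>L\<close>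
  gives the required one.\<close>

lemma sweedler_measuring_to_conv:
  assumes H: "coalgebra K H" and L: "coalgebra K L" and A: "assoc_algebra K A" and B: "assoc_algebra K B"
    and \<rho>: "alg_measuring K H (sweedler_product K A L) B \<rho>"
  obtains \<sigma> where "alg_measuring K H A (conv_algebra K L B) \<sigma>"
    and "\<And>h a l. h \<in> carrier H \<Longrightarrow> a \<in> carrier A \<Longrightarrow> l \<in> carrier L \<Longrightarrow> \<sigma> h a l = \<rho> h (sweedler_gen K A L a l)"
proof -
  note S = assoc_algebra_sweedler_product[OF A L] and HB = assoc_algebra_conv_algebra[OF H B]
  note m = alg_measuring_conv_swap[OF H L A B alg_measuring_comp[OF L A S sweedler_gen_measuring[OF A L] HB
        alg_measuring_alg_hom[OF H S B \<rho>]]]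
  show ?thesis by (rule that[OF m]) (simp add: compose_def)
qed

text \<open>The same chain backwards: exchange the coalgebras, lift to an algebra map
  \<open>A <| L -> [H, B]\<close>, and read it as a measuring by \<open>H\<close>.\<close>

lemma conv_measuring_to_sweedler:
  assumes H: "coalgebra K H" and L: "coalgebra K L" and A: "assoc_algebra K A" and B: "assoc_algebra K B"
    and \<sigma>: "alg_measuring K H A (conv_algebra K L B) \<sigma>"
  obtains \<rho> where "alg_measuring K H (sweedler_product K A L) B \<rho>"
    and "\<And>h a l. h \<in> carrier H \<Longrightarrow> a \<in> carrier A \<Longrightarrow> l \<in> carrier L \<Longrightarrow> \<rho> h (sweedler_gen K A L a l) = \<sigma> h a l"
proof -
  note S = assoc_algebra_sweedler_product[OF A L] and HB = assoc_algebra_conv_algebra[OF H B]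
  note gc = bilinear_map_closed[OF sweedler_gen_bilinear[OF A L]]
  from sweedler_product_lift[OF A L HB alg_measuring_conv_swap[OF L H A B \<sigma>]]
  obtain g where g: "g \<in> alg_hom K (sweedler_product K A L) (conv_algebra K H B)"
    and gg: "\<And>a l. a \<in> carrier A \<Longrightarrow> l \<in> carrier L \<Longrightarrow>
      g (sweedler_gen K A L a l) = (\<lambda>a\<in>carrier A. \<lambda>h\<in>carrier H. \<sigma> h a l) a"
    by blast
  show ?thesis by (rule that[OF alg_hom_alg_measuring[OF H S B g]]) (simp add: gg gc)
qed

text \<open>A single \<rho> \<open>h\<close> is not an algebra map, so generators do not determine
  it in isolation. The whole family is one algebra map into \<open>[H, B]\<close>, and this is
  determined by the generators; hence the hypothesis for all \<open>h\<close>.\<close>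

lemma sweedler_measuring_eq:
  assumes H: "coalgebra K H" and L: "coalgebra K L" and A: "assoc_algebra K A" and B: "assoc_algebra K B"
    and \<rho>: "alg_measuring K H (sweedler_product K A L) B \<rho>"
    and \<rho>': "alg_measuring K H (sweedler_product K A L) B \<rho>'"
    and e: "\<And>h a l. h \<in> carrier H \<Longrightarrow> a \<in> carrier A \<Longrightarrow> l \<in> carrier L \<Longrightarrow>
      \<rho> h (sweedler_gen K A L a l) = \<rho>' h (sweedler_gen K A L a l)"
    and h: "h \<in> carrier H"
  shows "\<rho> h = \<rho>' h"
proof -
  note S = assoc_algebra_sweedler_product[OF A L] and HB = assoc_algebra_conv_algebra[OF H B]
  note mH = coalgebra_module[OF H] and mS = assoc_algebra_module[OF S]
  have "(\<lambda>h\<in>carrier H. \<rho> h X) = (\<lambda>h\<in>carrier H. \<rho>' h X)" if "X \<in> carrier (sweedler_product K A L)" for X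
    by (rule sweedler_product_hom_eq[OF A L HB alg_measuring_alg_hom[OF H S B \<rho>]
          alg_measuring_alg_hom[OF H S B \<rho>'] _ that]) (auto simp: e intro!: restrict_ext)
  then have "\<rho> h X = \<rho>' h X" if "X \<in> carrier (sweedler_product K A L)" for X
    using that h by (metis restrict_apply)
  then show ?thesis
    using \<rho> \<rho>' h unfolding alg_measuring_iff[OF mH mS]
    by (intro extensionalityI[of _ "carrier (sweedler_product K A L)"]) auto
qed

text \<open>Extensionality in two layers, over \<open>A\<close> for the measuring and over
  \<open>L\<close> for the elements of the convolution algebra.\<close>

lemma conv_measuring_eq:
  assumes H: "coalgebra K H" and L: "coalgebra K L" and A: "assoc_algebra K A" and B: "assoc_algebra K B"
    and \<sigma>: "alg_measuring K H A (conv_algebra K L B) \<sigma>" and \<sigma>': "alg_measuring K H A (conv_algebra K L B) \<sigma>'"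
    and e: "\<And>a l. a \<in> carrier A \<Longrightarrow> l \<in> carrier L \<Longrightarrow> \<sigma> h a l = \<sigma>' h a l"
    and h: "h \<in> carrier H"
  shows "\<sigma> h = \<sigma>' h"
proof (rule extensionalityI[of _ "carrier A"])
  note r = \<sigma>[unfolded alg_measuring_iff[OF coalgebra_module[OF H] assoc_algebra_module[OF A]]]
  note r' = \<sigma>'[unfolded alg_measuring_iff[OF coalgebra_module[OF H] assoc_algebra_module[OF A]]]
  show "\<sigma> h \<in> extensional (carrier A)" "\<sigma>' h \<in> extensional (carrier A)" using r r' h by blast+
  fix a assume a: "a \<in> carrier A"
  show "\<sigma> h a = \<sigma>' h a"
    by (rule conv_algebra_eqI[OF bilinear_map_closed[OF conjunct1[OF r] h a]
          bilinear_map_closed[OF conjunct1[OF r'] h a]]) (simp add: e a)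
qed

lemma universal_conv_measuring_eq:
  fixes H :: "('k, 'h) coalg"
  assumes U: "universal_alg_measuring TYPE('h) K A (conv_algebra K L B) P \<pi>"
    and L: "coalgebra K L" and A: "assoc_algebra K A" and B: "assoc_algebra K B"
    and H: "coalgebra K H" and u: "u \<in> coalg_hom K H P" and v: "v \<in> coalg_hom K H P"
    and e: "\<And>h a l. h \<in> carrier H \<Longrightarrow> a \<in> carrier A \<Longrightarrow> l \<in> carrier L \<Longrightarrow> \<pi> (u h) a l = \<pi> (v h) a l"
    and h: "h \<in> carrier H"
  shows "u h = v h"
proof (rule universal_alg_measuring_unique[OF U A assoc_algebra_conv_algebra[OF L B] H u v _ h])
  note P = universal_alg_measuring_coalgebra[OF U] and m = universal_alg_measuring_measuring[OF U]
  note LB = assoc_algebra_conv_algebra[OF L B]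
  fix h assume h: "h \<in> carrier H"
  show "\<pi> (u h) = \<pi> (v h)"
    by (rule conv_measuring_eq[OF H L A B alg_measuring_comp_coalg_hom[OF P H A LB m u]
          alg_measuring_comp_coalg_hom[OF P H A LB m v] e[OF h] h])
qed

lemma universal_sweedler_measuring_eq:
  fixes H :: "('k, 'h) coalg"
  assumes U: "universal_alg_measuring TYPE('h) K (sweedler_product K A L) B P \<pi>"
    and L: "coalgebra K L" and A: "assoc_algebra K A" and B: "assoc_algebra K B"
    and H: "coalgebra K H" and u: "u \<in> coalg_hom K H P" and v: "v \<in> coalg_hom K H P"
    and e: "\<And>h a l. h \<in> carrier H \<Longrightarrow> a \<in> carrier A \<Longrightarrow> l \<in> carrier L \<Longrightarrow>
      \<pi> (u h) (sweedler_gen K A L a l) = \<pi> (v h) (sweedler_gen K A L a l)"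
    and h: "h \<in> carrier H"
  shows "u h = v h"
proof (rule universal_alg_measuring_unique[OF U assoc_algebra_sweedler_product[OF A L] B H u v _ h])
  note P = universal_alg_measuring_coalgebra[OF U] and m = universal_alg_measuring_measuring[OF U]
  note S = assoc_algebra_sweedler_product[OF A L]
  fix h assume h: "h \<in> carrier H"
  show "\<pi> (u h) = \<pi> (v h)"
    by (rule sweedler_measuring_eq[OF H L A B alg_measuring_comp_coalg_hom[OF P H S B m u]
          alg_measuring_comp_coalg_hom[OF P H S B m v] e h])
qed

text \<open>Uniqueness is used twice. The maps \<open>H (x) L -> Q\<close> belonging to
  \<open>u\<close> and \<open>v\<close> agree after \<kappa>, so they are equal by uniqueness for
  \<open>Q\<close>; then \<open>u\<close> and \<open>v\<close> agree after \<pi>, so they are equal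
  by uniqueness for \<open>P\<close>. The first use explains the test type of
  \<open>Q\<close>.\<close>

lemma universal_coalg_measuring_eq:
  fixes H :: "('k, 'h) coalg" and L :: "('k, 'l) coalg" and Q :: "('k, 'q) coalg"
  assumes U: "universal_coalg_measuring TYPE('h) K L Q P \<pi>"
    and Q: "universal_alg_measuring TYPE(('k, 'h, 'l) tensor) K A B Q \<kappa>"
    and L: "coalgebra K L" and A: "assoc_algebra K A" and B: "assoc_algebra K B"
    and H: "coalgebra K H" and u: "u \<in> coalg_hom K H P" and v: "v \<in> coalg_hom K H P"
    and e: "\<And>h a l. h \<in> carrier H \<Longrightarrow> a \<in> carrier A \<Longrightarrow> l \<in> carrier L \<Longrightarrow> \<kappa> (\<pi> (u h) l) a = \<kappa> (\<pi> (v h) l) a"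
    and h: "h \<in> carrier H"
  shows "u h = v h"
proof -
  note P = universal_coalg_measuring_coalgebra[OF U] and m = universal_coalg_measuring_measuring[OF U]
  note cQ = universal_alg_measuring_coalgebra[OF Q] and mk = universal_alg_measuring_measuring[OF Q]
  note mH = coalgebra_module[OF H] and mL = coalgebra_module[OF L] and mQ = coalgebra_module[OF cQ]
  note mA = assoc_algebra_module[OF A] and mB = assoc_algebra_module[OF B]
  note HL = coalgebra_tensor_coalg[OF H L]
  note r = mk[unfolded alg_measuring_iff[OF mQ mA]]
  note kb = conjunct1[OF r]
  note um = coalg_measuring_comp[OF P H L cQ m u] and vm = coalg_measuring_comp[OF P H L cQ m v]
  note ub = conjunct1[OF um[unfolded coalg_measuring_iff[OF H L cQ]]]
  note vb = conjunct1[OF vm[unfolded coalg_measuring_iff[OF H L cQ]]]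
  note ul = tsum_lin_hom[OF mH mL mQ ub] and vl = tsum_lin_hom[OF mH mL mQ vb]
  have uh: "tsum K Q (\<lambda>h. \<pi> (u h)) \<in> coalg_hom K (tensor_coalg K H L) Q"
    and vh: "tsum K Q (\<lambda>h. \<pi> (v h)) \<in> coalg_hom K (tensor_coalg K H L) Q"
    using um vm by (simp_all add: coalg_measuring_def)
  have "\<kappa> (tsum K Q (\<lambda>h. \<pi> (u h)) X) = \<kappa> (tsum K Q (\<lambda>h. \<pi> (v h)) X)"
    if X: "X \<in> carrier (tensor_module K H L)" for X
  proof (rule extensionalityI[of _ "carrier A"])
    show "\<kappa> (tsum K Q (\<lambda>h. \<pi> (u h)) X) \<in> extensional (carrier A)"
      "\<kappa> (tsum K Q (\<lambda>h. \<pi> (v h)) X) \<in> extensional (carrier A)"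
      using r lin_hom_closed[OF ul X] lin_hom_closed[OF vl X] by blast+
    fix a assume a: "a \<in> carrier A"
    note kl = bilinear_map_left[OF kb a]
    show "\<kappa> (tsum K Q (\<lambda>h. \<pi> (u h)) X) a = \<kappa> (tsum K Q (\<lambda>h. \<pi> (v h)) X) a"
      by (rule tensor_hom_eq[OF mH mL mB lin_hom_comp[OF kl ul] lin_hom_comp[OF kl vl] _ X])
        (simp add: tsum_tens[OF mH mL mQ ub] tsum_tens[OF mH mL mQ vb] e a)
  qed
  \<comment> \<open>Uniqueness for \<open>Q\<close>, tested on the tensor coalgebra. Evaluated at
    pure tensors this becomes equality of the two coalgebra measurings.\<close>
  then have eq: "tsum K Q (\<lambda>h. \<pi> (u h)) X = tsum K Q (\<lambda>h. \<pi> (v h)) X"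
    if "X \<in> carrier (tensor_module K H L)" for X
    using that
    by (intro universal_alg_measuring_unique[OF Q A B HL uh vh]) (simp_all add: tensor_coalg_simps)
  show ?thesis
  proof (rule universal_coalg_measuring_unique[OF U L cQ H u v _ h])
    fix h assume h: "h \<in> carrier H"
    show "\<pi> (u h) = \<pi> (v h)"
    proof (rule extensionalityI[of _ "carrier L"])
      show "\<pi> (u h) \<in> extensional (carrier L)" "\<pi> (v h) \<in> extensional (carrier L)"
        using um[unfolded coalg_measuring_iff[OF H L cQ]] vm[unfolded coalg_measuring_iff[OF H L cQ]] h
        by blast+
      fix l assume l: "l \<in> carrier L"
      show "\<pi> (u h) l = \<pi> (v h) l"
        using eq[OF tens_closed[OF mH mL h l]] tsum_tens[OF mH mL mQ ub h l] tsum_tens[OF mH mL mQ vb h l]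
        by simp
    qed
  qed
qed

text \<open>The datum is a measuring of \<open>A\<close> by the tensor coalgebra, which factors
  through \<open>Q\<close> by a coalgebra map; such a map \<open>H (x) L -> Q\<close> is by
  definition a measuring of coalgebras.\<close>

lemma conv_measuring_to_coalg_measuring:
  fixes H :: "('k, 'h) coalg" and L :: "('k, 'l) coalg" and Q :: "('k, 'q) coalg"
  assumes Q: "universal_alg_measuring TYPE(('k, 'h, 'l) tensor) K A B Q \<kappa>"
    and L: "coalgebra K L" and A: "assoc_algebra K A" and B: "assoc_algebra K B" and H: "coalgebra K H"
    and \<sigma>: "alg_measuring K H A (conv_algebra K L B) \<sigma>"
  obtains lam where "coalg_measuring K H L Q lam"
    and "\<And>h a l. h \<in> carrier H \<Longrightarrow> a \<in> carrier A \<Longrightarrow> l \<in> carrier L \<Longrightarrow> \<kappa> (lam h l) a = \<sigma> h a l"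
proof -
  note HL = coalgebra_tensor_coalg[OF H L] and tc = tens_closed[OF coalgebra_module[OF H] coalgebra_module[OF L]]
  obtain \<tau> where \<tau>: "alg_measuring K (tensor_coalg K H L) A B \<tau>"
    and t: "\<And>h l a. h \<in> carrier H \<Longrightarrow> l \<in> carrier L \<Longrightarrow> a \<in> carrier A \<Longrightarrow> \<tau> (tens K H L h l) a = \<sigma> h a l"
    using alg_measuring_to_tensor[OF H L A B \<sigma>] by blast
  obtain u where u: "u \<in> coalg_hom K (tensor_coalg K H L) Q"
    and ut: "\<And>X. X \<in> carrier (tensor_coalg K H L) \<Longrightarrow> \<kappa> (u X) = \<tau> X"
    using universal_alg_measuring_factor[OF Q HL \<tau>] by blast
  show ?thesis
    by (rule that[OF coalg_hom_coalg_measuring[OF H L universal_alg_measuring_coalgebra[OF Q] u]])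
      (simp add: ut t tensor_coalg_simps tc)
qed

text \<open>A coalgebra measuring is a coalgebra map from the tensor coalgebra to \<open>Q\<close>;
  pulling \<kappa> back along it gives a measuring of \<open>A\<close>, which is then curried in
  \<open>L\<close>.\<close>

lemma coalg_measuring_to_conv_measuring:
  assumes Q: "coalgebra K Q" and \<kappa>: "alg_measuring K Q A B \<kappa>"
    and L: "coalgebra K L" and A: "assoc_algebra K A" and B: "assoc_algebra K B" and H: "coalgebra K H"
    and lam: "coalg_measuring K H L Q lam"
  obtains \<sigma> where "alg_measuring K H A (conv_algebra K L B) \<sigma>"
    and "\<And>h a l. h \<in> carrier H \<Longrightarrow> a \<in> carrier A \<Longrightarrow> l \<in> carrier L \<Longrightarrow> \<sigma> h a l = \<kappa> (lam h l) a"
proof -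
  note HL = coalgebra_tensor_coalg[OF H L]
  note b = conjunct1[OF lam[unfolded coalg_measuring_iff[OF H L Q]]]
  note t = tsum_tens[OF coalgebra_module[OF H] coalgebra_module[OF L] coalgebra_module[OF Q] b]
  have "tsum K Q lam \<in> coalg_hom K (tensor_coalg K H L) Q"
    using lam by (simp add: coalg_measuring_def)
  from alg_measuring_from_tensor[OF H L A B alg_measuring_comp_coalg_hom[OF Q HL A B \<kappa> this]]
  show ?thesis by (rule that) (simp add: t)
qed

text \<open>Precomposition with the algebra map \<open>f\<close> is again a measuring, so the
  definite description is legitimate. Its value under the universal measuring is the only fact about
  the functorial action that naturality uses.\<close>

lemma precomp_map_alg:
  fixes P :: "('k, 'p) coalg"
  assumes U: "universal_alg_measuring TYPE('p) K X Y P' \<pi>'"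
    and X: "assoc_algebra K X" and X': "assoc_algebra K X'" and Y: "assoc_algebra K Y"
    and P: "coalgebra K P" and \<pi>: "alg_measuring K P X' Y \<pi>" and f: "f \<in> alg_hom K X X'"
  shows "precomp_map K X f P \<pi> P' \<pi>' \<in> coalg_hom K P P'"
    and "p \<in> carrier P \<Longrightarrow> \<pi>' (precomp_map K X f P \<pi> P' \<pi>' p) = compose (carrier X) (\<pi> p) f"
  using theI'[OF universal_alg_measuring_ex1[OF U P alg_measuring_precomp[OF P X X' \<pi> f]], folded precomp_map_def]
  by (auto simp: factors_via_def)

lemma postcomp_map_alg:
  fixes P :: "('k, 'p) coalg"
  assumes U: "universal_alg_measuring TYPE('p) K X Y' P' \<pi>'"
    and X: "assoc_algebra K X" and Y: "assoc_algebra K Y" and Y': "assoc_algebra K Y'"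
    and P: "coalgebra K P" and \<pi>: "alg_measuring K P X Y \<pi>" and g: "g \<in> alg_hom K Y Y'"
  shows "postcomp_map K X g P \<pi> P' \<pi>' \<in> coalg_hom K P P'"
    and "p \<in> carrier P \<Longrightarrow> \<pi>' (postcomp_map K X g P \<pi> P' \<pi>' p) = compose (carrier X) g (\<pi> p)"
  using theI'[OF universal_alg_measuring_ex1[OF U P alg_measuring_comp[OF P X Y \<pi> Y' g]], folded postcomp_map_def]
  by (auto simp: factors_via_def)

lemma precomp_map_coalg:
  fixes P :: "('k, 'p) coalg"
  assumes U: "universal_coalg_measuring TYPE('p) K L D P' \<pi>'"
    and L: "coalgebra K L" and L': "coalgebra K L'" and D: "coalgebra K D"
    and P: "coalgebra K P" and \<pi>: "coalg_measuring K P L' D \<pi>" and f: "f \<in> coalg_hom K L L'"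
  shows "precomp_map K L f P \<pi> P' \<pi>' \<in> coalg_hom K P P'"
    and "p \<in> carrier P \<Longrightarrow> \<pi>' (precomp_map K L f P \<pi> P' \<pi>' p) = compose (carrier L) (\<pi> p) f"
  using theI'[OF universal_coalg_measuring_ex1[OF U P coalg_measuring_precomp[OF P L L' D \<pi> f]], folded precomp_map_def]
  by (auto simp: factors_via_def)

text \<open>The three families share the carrier type \<open>'p\<close>, so that each can be a test
  coalgebra for the others. The coalgebra \<open>P\<^sub>A\<^sub>B\<close> is tested at
  \<open>('k, 'p, 'l) tensor\<close>, the carrier type of the tensor product of such a coalgebra
  with \<open>L\<close>. All three functors are contravariant in \<open>L\<close>, so both
  naturality squares start at \<open>L'\<close>.\<close>

theorem theorem2p12:
  fixes K :: "'k ring"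
    and A :: "('k, 'a) module" and B :: "('k, 'b) module"
    and P\<^sub>A\<^sub>B :: "('k, 'q) coalg" and \<pi>\<^sub>A\<^sub>B :: "'q \<Rightarrow> 'a \<Rightarrow> 'b"
    and P1 :: "('k, 'l) coalg \<Rightarrow> ('k, 'p) coalg"
    and \<pi>1 :: "('k, 'l) coalg \<Rightarrow> 'p \<Rightarrow> ('k, 'a, 'l) sweedler \<Rightarrow> 'b"
    and P2 :: "('k, 'l) coalg \<Rightarrow> ('k, 'p) coalg"
    and \<pi>2 :: "('k, 'l) coalg \<Rightarrow> 'p \<Rightarrow> 'a \<Rightarrow> ('l \<Rightarrow> 'b)"
    and P3 :: "('k, 'l) coalg \<Rightarrow> ('k, 'p) coalg"
    and \<pi>3 :: "('k, 'l) coalg \<Rightarrow> 'p \<Rightarrow> 'l \<Rightarrow> 'q"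
  assumes "field K" and "assoc_algebra K A" and "assoc_algebra K B"
    and P\<^sub>A\<^sub>B: "universal_alg_measuring TYPE(('k, 'p, 'l) tensor) K A B P\<^sub>A\<^sub>B \<pi>\<^sub>A\<^sub>B"
    and P1: "\<And>L. coalgebra K L \<Longrightarrow>
      universal_alg_measuring TYPE('p) K (sweedler_product K A L) B (P1 L) (\<pi>1 L)"
    and P2: "\<And>L. coalgebra K L \<Longrightarrow>
      universal_alg_measuring TYPE('p) K A (conv_algebra K L B) (P2 L) (\<pi>2 L)"
    and P3: "\<And>L. coalgebra K L \<Longrightarrow>
      universal_coalg_measuring TYPE('p) K L P\<^sub>A\<^sub>B (P3 L) (\<pi>3 L)"
  shows "\<exists>\<Phi> \<Psi>.
    (\<forall>L. coalgebra K L \<longrightarrow>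
      \<Phi> L \<in> coalg_iso K (P1 L) (P2 L) \<and> \<Psi> L \<in> coalg_iso K (P2 L) (P3 L)) \<and>
    (\<forall>L L' f. coalgebra K L \<and> coalgebra K L' \<and> f \<in> coalg_hom K L L' \<longrightarrow>
      (\<forall>p\<in>carrier (P1 L').
        \<Phi> L (precomp_map K (sweedler_product K A L) (sweedler_map K A L L' f)
               (P1 L') (\<pi>1 L') (P1 L) (\<pi>1 L) p) =
        postcomp_map K A (conv_map L f) (P2 L') (\<pi>2 L') (P2 L) (\<pi>2 L) (\<Phi> L' p)) \<and>
      (\<forall>p\<in>carrier (P2 L').
        \<Psi> L (postcomp_map K A (conv_map L f) (P2 L') (\<pi>2 L') (P2 L) (\<pi>2 L) p) =
        precomp_map K L f (P3 L') (\<pi>3 L') (P3 L) (\<pi>3 L) (\<Psi> L' p)))"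
proof -
  note A = \<open>assoc_algebra K A\<close> and B = \<open>assoc_algebra K B\<close>
  let ?S = "sweedler_product K A" and ?gen = "sweedler_gen K A"
  note S = assoc_algebra_sweedler_product[OF A] and LB = assoc_algebra_conv_algebra[OF _ B]
  note Q = universal_alg_measuring_coalgebra[OF P\<^sub>A\<^sub>B] and \<kappa> = universal_alg_measuring_measuring[OF P\<^sub>A\<^sub>B]
  note c1 = universal_alg_measuring_coalgebra[OF P1] and m1 = universal_alg_measuring_measuring[OF P1]
    and c2 = universal_alg_measuring_coalgebra[OF P2] and m2 = universal_alg_measuring_measuring[OF P2]
    and c3 = universal_coalg_measuring_coalgebra[OF P3] and m3 = universal_coalg_measuring_measuring[OF P3]
  note eq1 = universal_sweedler_measuring_eq[OF P1 _ A B]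
    and eq2 = universal_conv_measuring_eq[OF P2 _ A B]
    and eq3 = universal_coalg_measuring_eq[OF P3 P\<^sub>A\<^sub>B _ A B]
  have "\<exists>u. u \<in> coalg_hom K (P1 L) (P2 L) \<and> (\<forall>p\<in>carrier (P1 L). \<forall>a\<in>carrier A. \<forall>l\<in>carrier L.
      \<pi>2 L (u p) a l = \<pi>1 L p (?gen L a l))" if L: "coalgebra K L" for L
  proof -
    obtain \<sigma> where \<sigma>: "alg_measuring K (P1 L) A (conv_algebra K L B) \<sigma>"
      and s: "\<And>h a l. h \<in> carrier (P1 L) \<Longrightarrow> a \<in> carrier A \<Longrightarrow> l \<in> carrier L \<Longrightarrow> \<sigma> h a l = \<pi>1 L h (?gen L a l)"
      using sweedler_measuring_to_conv[OF c1[OF L] L A B m1[OF L]] by blast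
    obtain u where "u \<in> coalg_hom K (P1 L) (P2 L)" "\<And>h. h \<in> carrier (P1 L) \<Longrightarrow> \<pi>2 L (u h) = \<sigma> h"
      using universal_alg_measuring_factor[OF P2[OF L] c1[OF L] \<sigma>] by blast
    then show ?thesis using s by (intro exI[of _ u]) simp
  qed
  \<comment> \<open>One choice for all \<open>L\<close> at once, recording the trilinear datum:
    \<Phi> preserves it, and neither invertibility nor naturality needs anything else about
    it.\<close>
  then obtain \<Phi> where \<Phi>: "\<And>L. coalgebra K L \<Longrightarrow> \<Phi> L \<in> coalg_hom K (P1 L) (P2 L)"
    and \<Phi>v: "\<And>L p a l. coalgebra K L \<Longrightarrow> p \<in> carrier (P1 L) \<Longrightarrow> a \<in> carrier A \<Longrightarrow> l \<in> carrier L \<Longrightarrow>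
      \<pi>2 L (\<Phi> L p) a l = \<pi>1 L p (?gen L a l)"
    by metis
  have "\<exists>u. u \<in> coalg_hom K (P2 L) (P3 L) \<and> (\<forall>p\<in>carrier (P2 L). \<forall>a\<in>carrier A. \<forall>l\<in>carrier L.
      \<pi>\<^sub>A\<^sub>B (\<pi>3 L (u p) l) a = \<pi>2 L p a l)" if L: "coalgebra K L" for L
  proof -
    obtain lam where lam: "coalg_measuring K (P2 L) L P\<^sub>A\<^sub>B lam"
      and s: "\<And>h a l. h \<in> carrier (P2 L) \<Longrightarrow> a \<in> carrier A \<Longrightarrow> l \<in> carrier L \<Longrightarrow> \<pi>\<^sub>A\<^sub>B (lam h l) a = \<pi>2 L h a l"
      using conv_measuring_to_coalg_measuring[OF P\<^sub>A\<^sub>B L A B c2[OF L] m2[OF L]] by blast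
    obtain u where "u \<in> coalg_hom K (P2 L) (P3 L)" "\<And>h. h \<in> carrier (P2 L) \<Longrightarrow> \<pi>3 L (u h) = lam h"
      using universal_coalg_measuring_factor[OF P3[OF L] c2[OF L] lam] by blast
    then show ?thesis using s by (intro exI[of _ u]) simp
  qed
  then obtain \<Psi> where \<Psi>: "\<And>L. coalgebra K L \<Longrightarrow> \<Psi> L \<in> coalg_hom K (P2 L) (P3 L)"
    and \<Psi>v: "\<And>L p a l. coalgebra K L \<Longrightarrow> p \<in> carrier (P2 L) \<Longrightarrow> a \<in> carrier A \<Longrightarrow> l \<in> carrier L \<Longrightarrow>
      \<pi>\<^sub>A\<^sub>B (\<pi>3 L (\<Psi> L p) l) a = \<pi>2 L p a l"
    by metis
  have iso1: "\<Phi> L \<in> coalg_iso K (P1 L) (P2 L)" if L: "coalgebra K L" for L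
  proof -
    obtain \<rho> where \<rho>: "alg_measuring K (P2 L) (?S L) B \<rho>"
      and r: "\<And>h a l. h \<in> carrier (P2 L) \<Longrightarrow> a \<in> carrier A \<Longrightarrow> l \<in> carrier L \<Longrightarrow> \<rho> h (?gen L a l) = \<pi>2 L h a l"
      using conv_measuring_to_sweedler[OF c2[OF L] L A B m2[OF L]] by blast
    \<comment> \<open>The candidate inverse comes from universality of \<open>P1 L\<close> tested on
      \<open>P2 L\<close>. Both composites preserve the trilinear datum, as the identities
      do.\<close>
    obtain v where v: "v \<in> coalg_hom K (P2 L) (P1 L)" and vr: "\<And>h. h \<in> carrier (P2 L) \<Longrightarrow> \<pi>1 L (v h) = \<rho> h"
      using universal_alg_measuring_factor[OF P1[OF L] c2[OF L] \<rho>] by blast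
    note vc = coalg_hom_closed[OF v] and \<Phi>c = coalg_hom_closed[OF \<Phi>[OF L]]
    show ?thesis
    proof (rule coalg_isoI[OF \<Phi>[OF L] v])
      show "v (\<Phi> L p) = p" if "p \<in> carrier (P1 L)" for p
        by (rule eq1[OF L L c1[OF L] coalg_hom_comp[OF c1[OF L] c2[OF L] c1[OF L] v \<Phi>[OF L]]
              coalg_hom_ident[OF c1[OF L]] _ that])
          (simp add: vr \<Phi>c r \<Phi>v[OF L])
      show "\<Phi> L (v p) = p" if "p \<in> carrier (P2 L)" for p
        by (rule eq2[OF L L c2[OF L] coalg_hom_comp[OF c2[OF L] c1[OF L] c2[OF L] \<Phi>[OF L] v]
              coalg_hom_ident[OF c2[OF L]] _ that])
          (simp add: vr vc r \<Phi>v[OF L])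
    qed
  qed
  have iso2: "\<Psi> L \<in> coalg_iso K (P2 L) (P3 L)" if L: "coalgebra K L" for L
  proof -
    obtain \<sigma> where \<sigma>: "alg_measuring K (P3 L) A (conv_algebra K L B) \<sigma>"
      and r: "\<And>h a l. h \<in> carrier (P3 L) \<Longrightarrow> a \<in> carrier A \<Longrightarrow> l \<in> carrier L \<Longrightarrow> \<sigma> h a l = \<pi>\<^sub>A\<^sub>B (\<pi>3 L h l) a"
      using coalg_measuring_to_conv_measuring[OF Q \<kappa> L A B c3[OF L] m3[OF L]] by blast
    \<comment> \<open>Here the inverse comes from universality of \<open>P2 L\<close> tested on
      \<open>P3 L\<close>, applied to the measuring read off from \<pi>3 followed by
      \<open>\<pi>\<^sub>A\<^sub>B\<close>.\<close>
    obtain v where v: "v \<in> coalg_hom K (P3 L) (P2 L)" and vr: "\<And>h. h \<in> carrier (P3 L) \<Longrightarrow> \<pi>2 L (v h) = \<sigma> h"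
      using universal_alg_measuring_factor[OF P2[OF L] c3[OF L] \<sigma>] by blast
    note vc = coalg_hom_closed[OF v] and \<Psi>c = coalg_hom_closed[OF \<Psi>[OF L]]
    show ?thesis
    proof (rule coalg_isoI[OF \<Psi>[OF L] v])
      show "v (\<Psi> L p) = p" if "p \<in> carrier (P2 L)" for p
        by (rule eq2[OF L L c2[OF L] coalg_hom_comp[OF c2[OF L] c3[OF L] c2[OF L] v \<Psi>[OF L]]
              coalg_hom_ident[OF c2[OF L]] _ that])
          (simp add: vr \<Psi>c r \<Psi>v[OF L])
      show "\<Psi> L (v p) = p" if "p \<in> carrier (P3 L)" for p
        by (rule eq3[OF L L c3[OF L] coalg_hom_comp[OF c3[OF L] c2[OF L] c3[OF L] \<Psi>[OF L] v]
              coalg_hom_ident[OF c3[OF L]] _ that])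
          (simp add: vr vc r \<Psi>v[OF L])
    qed
  qed
  have nat: "(\<forall>p\<in>carrier (P1 L').
        \<Phi> L (precomp_map K (?S L) (sweedler_map K A L L' f) (P1 L') (\<pi>1 L') (P1 L) (\<pi>1 L) p) =
        postcomp_map K A (conv_map L f) (P2 L') (\<pi>2 L') (P2 L) (\<pi>2 L) (\<Phi> L' p)) \<and>
      (\<forall>p\<in>carrier (P2 L').
        \<Psi> L (postcomp_map K A (conv_map L f) (P2 L') (\<pi>2 L') (P2 L) (\<pi>2 L) p) =
        precomp_map K L f (P3 L') (\<pi>3 L') (P3 L) (\<pi>3 L) (\<Psi> L' p))"
    if L: "coalgebra K L" and L': "coalgebra K L'" and f: "f \<in> coalg_hom K L L'" for L L' f
  proof (intro conjI ballI)
    note sm = sweedler_map[OF A L L' f] and fc = coalg_hom_closed[OF f]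
    note gc = bilinear_map_closed[OF sweedler_gen_bilinear[OF A L]]
    note q1 = precomp_map_alg[OF P1[OF L] S[OF L] S[OF L'] B c1[OF L'] m1[OF L'] sm(1)]
    note q2 = postcomp_map_alg[OF P2[OF L] A LB[OF L'] LB[OF L] c2[OF L'] m2[OF L'] conv_map_alg_hom[OF L L' B f]]
    note cl = coalg_hom_closed[OF q1(1)] coalg_hom_closed[OF \<Phi>[OF L']]
    fix p assume p: "p \<in> carrier (P1 L')"
    show "\<Phi> L (precomp_map K (?S L) (sweedler_map K A L L' f) (P1 L') (\<pi>1 L') (P1 L) (\<pi>1 L) p) =
        postcomp_map K A (conv_map L f) (P2 L') (\<pi>2 L') (P2 L) (\<pi>2 L) (\<Phi> L' p)"
      \<comment> \<open>Both sides are coalgebra maps \<open>P1 L' -> P2 L\<close>, and at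
        \<open>a\<close>, \<open>l\<close> both have the value of \<open>\<pi>1 L' p\<close> at the
        generator of \<open>a\<close> and \<open>f l\<close>.\<close>
      by (rule eq2[OF L L c1[OF L'] coalg_hom_comp[OF c1[OF L'] c1[OF L] c2[OF L] \<Phi>[OF L] q1(1)]
            coalg_hom_comp[OF c1[OF L'] c2[OF L'] c2[OF L] q2(1) \<Phi>[OF L']] _ p])
        (simp add: \<Phi>v L L' q1(2) q2(2) cl gc fc sm(2) compose_def conv_map_def)
  next
    note fc = coalg_hom_closed[OF f]
    note q2 = postcomp_map_alg[OF P2[OF L] A LB[OF L'] LB[OF L] c2[OF L'] m2[OF L'] conv_map_alg_hom[OF L L' B f]]
    note q3 = precomp_map_coalg[OF P3[OF L] L L' Q c3[OF L'] m3[OF L'] f]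
    note cl = coalg_hom_closed[OF q2(1)] coalg_hom_closed[OF \<Psi>[OF L']]
    fix p assume p: "p \<in> carrier (P2 L')"
    show "\<Psi> L (postcomp_map K A (conv_map L f) (P2 L') (\<pi>2 L') (P2 L) (\<pi>2 L) p) =
        precomp_map K L f (P3 L') (\<pi>3 L') (P3 L) (\<pi>3 L) (\<Psi> L' p)"
      \<comment> \<open>The common value of the two maps \<open>P2 L' -> P3 L\<close> at
        \<open>a\<close>, \<open>l\<close> is \<open>\<pi>2 L' p a (f l)\<close>.\<close>
      by (rule eq3[OF L L c2[OF L'] coalg_hom_comp[OF c2[OF L'] c2[OF L] c3[OF L] \<Psi>[OF L] q2(1)]
            coalg_hom_comp[OF c2[OF L'] c3[OF L'] c3[OF L] q3(1) \<Psi>[OF L']] _ p])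
        (simp add: \<Psi>v L L' q2(2) q3(2) cl fc compose_def conv_map_def)
  qed
  show ?thesis
    by (rule exI[of _ \<Phi>], rule exI[of _ \<Psi>]) (use iso1 iso2 nat in blast)
qed

end
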